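(* Let $\mu\in\mathcal P_p(\mathbb R^2)$ satisfy condition $\mathbf C$. Let $\Theta_2:\mathbb R^2\to\mathbb R$ be a compactly supported $C^2$ function and set $\Theta=(0,\Theta_2)$. Then there exists $C>0$ such that $$\limsup_{r\to0}\frac1r\,\mathbb W_p^{\rm ad}\big(\mu^{r\Theta},\Pi^{\rm M}(\mu_1,\mu_2)\big)\le C\,\|\mathcal L_{\rm M,m}(\Theta)\|,$$ where $\mathcal L_{\rm M,m}(\Theta)=\big(\mathbb E_1^\mu[\Theta_1],\mathbb E_2^\mu[\Theta_2],\mathbb E_1^\mu[\Theta_2-\Theta_1]\big)\in\mathbb L^p(\mu_1)\times\mathbb L^p(\mu_2)\times\mathbb L^p(\mu_1)$ (here with $\Theta_1=0$), equipped with the product norm given by the sum of the $\mathbb L^p$ norms.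
   Context: $p>1$; $\mathbb R^2=\mathbb R\times\mathbb R$ with Euclidean norm, points $x=(x_1,x_2)$. $\mathcal P_p(\mathbb R^2)$: probability measures with finite $p$-th moment. $X=(X_1,X_2)$ is the canonical variable, $(X,X')$ the coordinate projections on $\mathbb R^2\times\mathbb R^2$. $\mu_i=\mu\circ X_i^{-1}$; $\mathbb E_i^\mu[\cdot]=\mathbb E^\mu[\cdot|X_i]$; $\mu^T=\mu\circ(X+T(X))^{-1}$. $\Pi^{\rm M}(\mu_1,\mu_2)$ is the set of probability measures $\mu'$ on $\mathbb R^2$ with marginals $\mu_1,\mu_2$ that are martingale measures: $\mathbb E^{\mu'}[X_2|X_1]=X_1$ a.s. A probability $\pi$ on $\mathbb R^2\times\mathbb R^2$ is causal if for all bounded Borel $f:\mathbb R^2\to\mathbb R$, $g:\mathbb R\to\mathbb R$, $\mathbb E^\pi[f(X_1,X_2)g(X_1')|X_1]=\mathbb E^\pi[f(X_1,X_2)|X_1]\mathbb E^\pi[g(X_1')|X_1]$; bi-causal if $\pi$ and $\pi\circ(X',X)^{-1}$ are causal. $\mathbb W_p^{\rm ad}(\mu,\mu')=\inf_\pi\mathbb E^\pi[|X-X'|^p]^{1/p}$ over bi-causal couplings of $\mu,\mu'$; $\mathbb W_p^{\rm ad}(\nu,U)=\inf_{u\in U}\mathbb W_p^{\rm ad}(\nu,u)$. Condition $\mathbf C$: $\mu\in\mathcal P_p(\mathbb R^2)$ is a martingale measure ($\mathbb E_1^\mu[X_2]=X_1$) such that (i) $\mu(dx)=\kappa(x_1,x_2)\,dx_2\,\mu_1(dx_1)$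 with $\kappa\in\mathbb L^\infty(\mathbb R^2)$ and $\kappa(X)\ge c>0$ $\mu$-a.s. for some constant $c$; (ii) $\mu_2(dx_2)=q_2(x_2)\mathbf 1_{\{x_2\in I_2\}}dx_2$ for some bounded interval $I_2=[a,b]$ and some strictly positive continuous $q_2$; (iii) $\mathbb L^1(\mu_1)\cap\mathbb L^1(\mu_2)=\mathbb R$, where $\mathbb L^1(\mu_i)$ is canonically embedded in $\mathbb L^1(\mu)$ via $f\mapsto f(X_i)$ and $\mathbb R$ denotes the $\mu$-a.s. constant functions; i.e. if $f\in\mathbb L^1(\mu_1)$, $g\in\mathbb L^1(\mu_2)$ and $f(X_1)=g(X_2)$ $\mu$-a.s., then both are a.s. equal to a constant. *)

theory Defs
  imports "HOL-Probability.Probability"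
begin

type_synonym plane = "real \<times> real"

text \<open>The sigma-algebra generated by the random variable \<open>Y\<close> on \<open>M\<close>, and the conditional
  expectation given \<open>Y\<close>. The latter is a \<open>\<sigma>(Y)\<close>-measurable function on the space of \<open>M\<close> itself,
  i.e. the space \<open>L^1\<close> of the law of \<open>Y\<close> is embedded in \<open>L^1(M)\<close> through \<open>h \<mapsto> h(Y)\<close>.\<close>

definition sigma_gen_by :: "'a measure \<Rightarrow> ('a \<Rightarrow> real) \<Rightarrow> 'a measure" where
  "sigma_gen_by M Y = vimage_algebra (space M) Y borel"

definition cexp :: "'a measure \<Rightarrow> ('a \<Rightarrow> real) \<Rightarrow> ('a \<Rightarrow> real) \<Rightarrow> 'a \<Rightarrow> real" where
  "cexp M Y f = real_cond_exp M (sigma_gen_by M Y) f"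

text \<open>\<open>x^(1/p)\<close> on \<open>[0, \<infinity>]\<close>, for \<open>p > 0\<close>.\<close>

definition eroot :: "real \<Rightarrow> ennreal \<Rightarrow> ennreal" where
  "eroot p x = (if x = \<infinity> then \<infinity> else ennreal (enn2real x powr (1 / p)))"

definition Lp_norm :: "real \<Rightarrow> 'a measure \<Rightarrow> ('a \<Rightarrow> real) \<Rightarrow> ennreal" where
  "Lp_norm p M f = eroot p (\<integral>\<^sup>+ x. ennreal (\<bar>f x\<bar> powr p) \<partial>M)"

definition P_p :: "real \<Rightarrow> plane measure set" where
  "P_p p = {\<mu>. prob_space \<mu> \<and> sets \<mu> = sets borel \<and>
               integrable \<mu> (\<lambda>x. norm x powr p)}"

definition marg1 :: "plane measure \<Rightarrow> real measure" where
  "marg1 \<mu> = distr \<mu> borel fst"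

definition marg2 :: "plane measure \<Rightarrow> real measure" where
  "marg2 \<mu> = distr \<mu> borel snd"

definition martingale_measure :: "plane measure \<Rightarrow> bool" where
  "martingale_measure \<mu> \<longleftrightarrow>
     prob_space \<mu> \<and> sets \<mu> = sets borel \<and> integrable \<mu> fst \<and> integrable \<mu> snd \<and>
     (AE x in \<mu>. cexp \<mu> fst snd x = fst x)"

definition Pi_M :: "real measure \<Rightarrow> real measure \<Rightarrow> plane measure set" where
  "Pi_M m1 m2 = {\<mu>'. martingale_measure \<mu>' \<and> marg1 \<mu>' = m1 \<and> marg2 \<mu>' = m2}"

text \<open>In \<open>((x1, x2), (x1', x2'))\<close>, \<open>fst \<circ> fst\<close> is \<open>X_1\<close> and \<open>fst \<circ> snd\<close> is \<open>X_1'\<close>.\<close>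

definition causal :: "(plane \<times> plane) measure \<Rightarrow> bool" where
  "causal \<pi> \<longleftrightarrow>
     (\<forall>f\<in>borel_measurable borel. \<forall>g\<in>borel_measurable borel.
        bounded (range f) \<longrightarrow> bounded (range g) \<longrightarrow>
        (AE z in \<pi>. cexp \<pi> (fst \<circ> fst) (\<lambda>(x, x'). f x * g (fst x')) z =
                     cexp \<pi> (fst \<circ> fst) (\<lambda>(x, x'). f x) z *
                     cexp \<pi> (fst \<circ> fst) (\<lambda>(x, x'). g (fst x')) z))"

definition bicausal :: "(plane \<times> plane) measure \<Rightarrow> bool" where
  "bicausal \<pi> \<longleftrightarrow> causal \<pi> \<and> causal (distr \<pi> borel prod.swap)"

definition bicausal_couplings :: "plane measure \<Rightarrow> plane measure \<Rightarrow> (plane \<times> plane) measure set" where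
  "bicausal_couplings \<mu> \<mu>' =
     {\<pi>. prob_space \<pi> \<and> sets \<pi> = sets borel \<and>
         distr \<pi> borel fst = \<mu> \<and> distr \<pi> borel snd = \<mu>' \<and> bicausal \<pi>}"

definition W_ad :: "real \<Rightarrow> plane measure \<Rightarrow> plane measure \<Rightarrow> ennreal" where
  "W_ad p \<mu> \<mu>' =
     (INF \<pi>\<in>bicausal_couplings \<mu> \<mu>'.
        eroot p (\<integral>\<^sup>+ (x, x'). ennreal (norm (x - x') powr p) \<partial>\<pi>))"

definition W_ad_set :: "real \<Rightarrow> plane measure \<Rightarrow> plane measure set \<Rightarrow> ennreal" where
  "W_ad_set p \<nu> U = (INF u\<in>U. W_ad p \<nu> u)"

text \<open>The law of \<open>X + T(X)\<close> under \<open>\<mu>\<close>.\<close>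

definition perturb :: "plane measure \<Rightarrow> (plane \<Rightarrow> plane) \<Rightarrow> plane measure" where
  "perturb \<mu> T = distr \<mu> borel (\<lambda>x. x + T x)"

text \<open>In (i), \<open>\<kappa>\<close> matters only up to null sets of the reference measure \<open>\<mu>_1(dx_1) dx_2\<close>; this is
  the measure with respect to which \<open>\<kappa>\<close> is essentially bounded.\<close>

definition condition_C :: "real \<Rightarrow> plane measure \<Rightarrow> bool" where
  "condition_C p \<mu> \<longleftrightarrow>
     \<mu> \<in> P_p p \<and> martingale_measure \<mu> \<and>
     (\<exists>\<kappa>\<in>borel_measurable borel. \<exists>K c :: real.
        0 < c \<and>
        (AE x in marg1 \<mu> \<Otimes>\<^sub>M lborel. 0 \<le> \<kappa> x \<and> \<kappa> x \<le> K) \<and>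
        \<mu> = density (marg1 \<mu> \<Otimes>\<^sub>M lborel) (\<lambda>x. ennreal (\<kappa> x)) \<and>
        (AE x in \<mu>. c \<le> \<kappa> x)) \<and>
     (\<exists>a b :: real. \<exists>q. continuous_on {a..b} q \<and> (\<forall>y\<in>{a..b}. 0 < q y) \<and>
        marg2 \<mu> = density lborel (\<lambda>y. ennreal (q y) * indicator {a..b} y)) \<and>
     (\<forall>f g. integrable (marg1 \<mu>) f \<longrightarrow> integrable (marg2 \<mu>) g \<longrightarrow>
        (AE x in \<mu>. f (fst x) = g (snd x)) \<longrightarrow>
        (\<exists>k :: real. (AE x in \<mu>. f (fst x) = k) \<and> (AE x in \<mu>. g (snd x) = k)))"

definition C2_function :: "('a::real_normed_vector \<Rightarrow> real) \<Rightarrow> bool" where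
  "C2_function f \<longleftrightarrow>
     (\<exists>(D :: 'a \<Rightarrow> 'a \<Rightarrow>\<^sub>L real) (D2 :: 'a \<Rightarrow> 'a \<Rightarrow>\<^sub>L 'a \<Rightarrow>\<^sub>L real).
        (\<forall>x. (f has_derivative blinfun_apply (D x)) (at x)) \<and>
        (\<forall>x. (D has_derivative blinfun_apply (D2 x)) (at x)) \<and>
        continuous_on UNIV D2)"

definition compactly_supported :: "('a::topological_space \<Rightarrow> real) \<Rightarrow> bool" where
  "compactly_supported f \<longleftrightarrow> compact (closure (support_on UNIV f))"

definition L_Mm :: "plane measure \<Rightarrow> (plane \<Rightarrow> plane) \<Rightarrow>
    (plane \<Rightarrow> real) \<times> (plane \<Rightarrow> real) \<times> (plane \<Rightarrow> real)" where
  "L_Mm \<mu> T =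
     (cexp \<mu> fst (\<lambda>x. fst (T x)),
      cexp \<mu> snd (\<lambda>x. snd (T x)),
      cexp \<mu> fst (\<lambda>x. snd (T x) - fst (T x)))"

text \<open>The embedding \<open>h \<mapsto> h(X_i)\<close> of \<open>L^p(\<mu>_i)\<close> in \<open>L^p(\<mu>)\<close> is isometric, so that the norms of the
  components can be computed in \<open>L^p(\<mu>)\<close>.\<close>

definition product_norm :: "real \<Rightarrow> plane measure \<Rightarrow>
    (plane \<Rightarrow> real) \<times> (plane \<Rightarrow> real) \<times> (plane \<Rightarrow> real) \<Rightarrow> ennreal" where
  "product_norm p \<mu> = (\<lambda>(u, v, w). Lp_norm p \<mu> u + Lp_norm p \<mu> v + Lp_norm p \<mu> w)"

end

theory Submission
  imports Defs
begin

text \<open>If the norm on the right is positive, then \<open>C\<close>, which may depend on \<open>\<Theta>\<close>, absorbs the crude bound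
  given by the coupling \<open>(X + r\<Theta>(X), X)\<close>; it is bi-causal because both sides have the same first
  coordinate. So let \<open>\<theta> = \<Theta>\<^sub>2\<close> have vanishing conditional expectations given \<open>X\<^sub>1\<close> and given
  \<open>X\<^sub>2\<close>; the distance must then be shown to be \<open>o(r)\<close>.

  A competitor in \<open>\<Pi>\<^sup>M(\<mu>\<^sub>1, \<mu>\<^sub>2)\<close> is obtained by keeping \<open>X\<^sub>1\<close> and letting \<open>X\<^sub>2\<close> jump by
  \<open>\<plusminus>s\<close>, \<open>s = Lr\<close>, with probabilities that are a tilt by \<open>\<Psi> = \<theta>/L + D\<close> of probabilities reversible
  for \<open>q\<^sub>2\<close>. The law of \<open>X\<^sub>2\<close> is preserved if \<open>\<Psi>\<close> has no mean given \<open>X\<^sub>2\<close>, and the martingale property holds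
  if the mean of \<open>D\<close> given \<open>X\<^sub>1\<close> cancels the drift of the untilted walk, which is uniformly small. Such a
  uniformly small \<open>D = \<alpha>(X\<^sub>1) - E[\<alpha>(X\<^sub>1) | X\<^sub>2]\<close> solves a Poisson equation for the Markov operator
  \<open>E\<^sub>1 E\<^sub>2\<close>. This operator satisfies Doeblin's condition: its kernel is bounded, it is irreducible by (iii), and the
  \<open>L\<^sup>1\<close>-approximation of \<open>\<kappa>\<close> by step functions splits the line, up to a small set, into finitely many cells on
  which the kernel is bounded below.

  Finally, given \<open>X\<^sub>1\<close>, the quantile coupling of \<open>X\<^sub>2 + r\<theta>\<close> with the walk moves points by \<open>O(r)\<close>, and its
  \<open>L\<^sup>1\<close>-cost is the \<open>L\<^sup>1\<close>-distance of the conditional distribution functions. Both differ from that of \<open>X\<^sub>2\<close>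
  by \<open>r\<kappa>\<theta> + o(r)\<close> in \<open>L\<^sup>1\<close>, so the \<open>p\<close>-th power of the cost is at most \<open>O(r)\<^sup>p\<^sup>-\<^sup>1 o(r)\<close>.\<close>

subsection \<open>Couplings with equal first coordinates\<close>

text \<open>Moving \<open>X_2\<close> by r \<theta> respects the second marginal and the martingale
  property only to first order in r, while a competitor has to satisfy both exactly. Randomising the
  displacement makes exactness possible: with jumps of a fixed size only probabilities remain to be
  adjusted, and both constraints are linear in them. The obstacle is that these probabilities must
  be nonnegative. This forces the corrector D to be small in sup norm and not merely in L^2, hence
  Doeblin's condition instead of a spectral gap; it forces L to be large compared with sup
  |\<theta>|; and near a and b, where an outward jump has probability zero, it forces the tilt onto
  inward jumps. The mean displacement of the tilted walk is about s \<Psi>, that is L r times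
  \<theta> / L, which is why the two laws agree to first order. As \<kappa> is only bounded and
  measurable, this agreement is sought in L^1, by approximation with densities for which it is
  explicit.\<close>

lemma subalgebra_sigma_gen_by:
  assumes "Y \<in> borel_measurable M"
  shows "subalgebra M (sigma_gen_by M Y)"
  unfolding subalgebra_def sigma_gen_by_def
  using assms by (auto simp: sets_vimage_algebra2 measurable_def)

lemma sigma_finite_subalgebra_gen_by:
  assumes "prob_space M" "Y \<in> borel_measurable M"
  shows "sigma_finite_subalgebra M (sigma_gen_by M Y)"
proof -
  interpret prob_space M by fact
  interpret finite_measure_subalgebra M "sigma_gen_by M Y"
    by unfold_locales (rule subalgebra_sigma_gen_by[OF assms(2)])
  show ?thesis by (rule sigma_finite_subalgebra_axioms)
qed

lemma measurable_sigma_gen_by: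
  assumes "h \<in> borel_measurable borel"
  shows "(\<lambda>x. h (Y x)) \<in> borel_measurable (sigma_gen_by M Y)"
proof -
  have "Y \<in> measurable (sigma_gen_by M Y) borel"
    unfolding sigma_gen_by_def by (rule measurable_vimage_algebra1) auto
  then show ?thesis using assms by measurable
qed

lemma sets_sigma_gen_by_iff:
  assumes "A \<in> sets (sigma_gen_by M Y)"
  obtains B where "B \<in> sets borel" "A = Y -` B \<inter> space M"
  using assms unfolding sigma_gen_by_def by (auto simp: sets_vimage_algebra2)

text \<open>The martingale property and the vanishing of conditional expectations are used only in
  this tested form, in which conditional expectations give way to integrals that depend on the law
  alone.\<close>

lemma cexp_set_integral:
  assumes "prob_space M" "Y \<in> borel_measurable M" "integrable M f"
    and "AE x in M. cexp M Y f x = h (Y x)" "h \<in> borel_measurable borel" "B \<in> sets borel"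
  shows "(\<integral>x. indicator B (Y x) * f x \<partial>M) = (\<integral>x. indicator B (Y x) * h (Y x) \<partial>M)"
proof -
  interpret sigma_finite_subalgebra M "sigma_gen_by M Y"
    by (rule sigma_finite_subalgebra_gen_by[OF assms(1,2)])
  note [measurable] = assms(2,5,6)
  have F: "(\<lambda>x. indicator B (Y x) :: real) \<in> borel_measurable (sigma_gen_by M Y)"
    by (rule measurable_sigma_gen_by[where h="indicator B"]) simp
  have I: "integrable M (\<lambda>x. indicator B (Y x) * f x)"
    by (rule Bochner_Integration.integrable_bound[OF assms(3)])
       (use assms(3) in \<open>auto simp: indicator_def\<close>)
  have "(\<integral>x. indicator B (Y x) * f x \<partial>M)
      = (\<integral>x. indicator B (Y x) * real_cond_exp M (sigma_gen_by M Y) f x \<partial>M)"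
    using real_cond_exp_intg(2)[OF I F] assms(3) by simp
  also have "\<dots> = (\<integral>x. indicator B (Y x) * h (Y x) \<partial>M)"
    by (rule integral_cong_AE) (use assms(4) in \<open>auto simp: cexp_def\<close>)
  finally show ?thesis .
qed

text \<open>Every event of the conditioning sigma-algebra is the preimage of some B under
  \<open>fst\<close>, and \<open>fst\<close> is measurable for it, so the tested identities
  characterise the conditional expectation.\<close>

lemma martingale_measureI:
  assumes "prob_space \<mu>" and S: "sets \<mu> = sets borel"
    and I1: "integrable \<mu> fst" and I2: "integrable \<mu> snd"
    and E: "\<And>B. B \<in> sets borel \<Longrightarrow>
      (\<integral>x. indicator B (fst x) * snd x \<partial>\<mu>) = (\<integral>x. indicator B (fst x) * fst x \<partial>\<mu>)"
  shows "martingale_measure \<mu>"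
proof -
  have fst_m: "fst \<in> borel_measurable \<mu>"
    using I1 by auto
  interpret sigma_finite_subalgebra \<mu> "sigma_gen_by \<mu> fst"
    by (rule sigma_finite_subalgebra_gen_by[OF assms(1) fst_m])
  have "AE x in \<mu>. real_cond_exp \<mu> (sigma_gen_by \<mu> fst) snd x = fst x"
  proof (rule real_cond_exp_charact)
    fix A assume "A \<in> sets (sigma_gen_by \<mu> fst)"
    then obtain B where B: "B \<in> sets borel" "A = fst -` B \<inter> space \<mu>"
      by (rule sets_sigma_gen_by_iff)
    have *: "(LINT x:A|\<mu>. g x) = (\<integral>x. indicator B (fst x) * g x \<partial>\<mu>)" for g :: "plane \<Rightarrow> real"
      unfolding set_lebesgue_integral_def
      by (rule Bochner_Integration.integral_cong) (auto simp: B indicator_def)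
    show "(LINT x:A|\<mu>. snd x) = (LINT x:A|\<mu>. fst x)"
      unfolding * by (rule E[OF B(1)])
  next
    show "fst \<in> borel_measurable (sigma_gen_by \<mu> fst)"
      using measurable_sigma_gen_by[of "\<lambda>x. x" fst \<mu>] by simp
  qed (use I1 I2 in auto)
  then show ?thesis
    using assms unfolding martingale_measure_def cexp_def by auto
qed

text \<open>Since \<open>X_1' = X_1\<close> almost surely, \<open>g (X_1')\<close> may be replaced
  by \<open>g (X_1)\<close>, which is measurable for the conditioning sigma-algebra and leaves the
  conditional expectation as a factor.\<close>

lemma causal_if_same_first:
  fixes \<pi> :: "(plane \<times> plane) measure"
  assumes "prob_space \<pi>" and S: "sets \<pi> = sets borel"
    and same: "AE z in \<pi>. fst (fst z) = fst (snd z)"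
  shows "causal \<pi>"
  unfolding causal_def
proof (intro ballI impI)
  fix f :: "plane \<Rightarrow> real" and g :: "real \<Rightarrow> real"
  assume [measurable]: "f \<in> borel_measurable borel" "g \<in> borel_measurable borel"
    and bf: "bounded (range f)" and bg: "bounded (range g)"
  note [measurable_cong] = S
  interpret prob_space \<pi> by fact
  have m0[measurable]: "fst \<in> borel_measurable \<pi>"
     "(\<lambda>z. fst (fst z)) \<in> borel_measurable \<pi>" "(\<lambda>z. fst (snd z)) \<in> borel_measurable \<pi>"
    unfolding measurable_cong_sets[OF S refl]
    by (auto intro!: borel_measurable_continuous_onI continuous_on_fst continuous_on_snd)
  let ?Y = "fst \<circ> fst :: plane \<times> plane \<Rightarrow> real"
  have Y: "?Y \<in> borel_measurable \<pi>" unfolding comp_def by (rule m0)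
  interpret sigma_finite_subalgebra \<pi> "sigma_gen_by \<pi> ?Y"
    by (rule sigma_finite_subalgebra_gen_by[OF assms(1) Y])
  obtain Bf Bg where Bf: "\<And>x. norm (f x) \<le> Bf" and Bg: "\<And>x. norm (g x) \<le> Bg"
    using bf bg unfolding bounded_iff by auto
  have m: "(\<lambda>z. g (fst (fst z))) \<in> borel_measurable (sigma_gen_by \<pi> ?Y)"
    using measurable_sigma_gen_by[of g ?Y \<pi>] by (simp add: comp_def)
  have m1[measurable]: "(\<lambda>z. f (fst z)) \<in> borel_measurable \<pi>" "(\<lambda>z. g (fst (fst z))) \<in> borel_measurable \<pi>"
     "(\<lambda>z. g (fst (snd z))) \<in> borel_measurable \<pi>"
    by (auto intro: measurable_compose[OF m0(1)] measurable_compose[OF m0(2)] measurable_compose[OF m0(3)])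
  have if1: "integrable \<pi> (\<lambda>z. f (fst z))"
    by (rule integrable_const_bound[where B=Bf]) (use Bf in auto)
  have ig: "integrable \<pi> (\<lambda>z. g (fst (fst z)))"
    by (rule integrable_const_bound[where B=Bg]) (use Bg in auto)
  have Bfg: "norm (g (fst (fst z)) * f (fst z)) \<le> Bg * Bf" for z
    unfolding norm_mult by (intro mult_mono Bf Bg) (auto intro: order_trans[OF norm_ge_zero Bg])
  have ifg: "integrable \<pi> (\<lambda>z. g (fst (fst z)) * f (fst z))"
    by (rule integrable_const_bound[where B="Bg * Bf"]) (use Bfg in auto)
  have 1: "AE z in \<pi>. real_cond_exp \<pi> (sigma_gen_by \<pi> ?Y) (\<lambda>z. f (fst z) * g (fst (snd z))) z
      = real_cond_exp \<pi> (sigma_gen_by \<pi> ?Y) (\<lambda>z. g (fst (fst z)) * f (fst z)) z"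
    by (rule real_cond_exp_cong) (use same in auto)
  have 2: "AE z in \<pi>. real_cond_exp \<pi> (sigma_gen_by \<pi> ?Y) (\<lambda>z. g (fst (fst z)) * f (fst z)) z
      = g (fst (fst z)) * real_cond_exp \<pi> (sigma_gen_by \<pi> ?Y) (\<lambda>z. f (fst z)) z"
    by (rule real_cond_exp_mult[OF m _ ifg]) simp
  have 3: "AE z in \<pi>. real_cond_exp \<pi> (sigma_gen_by \<pi> ?Y) (\<lambda>z. g (fst (snd z))) z
      = real_cond_exp \<pi> (sigma_gen_by \<pi> ?Y) (\<lambda>z. g (fst (fst z))) z"
    by (rule real_cond_exp_cong) (use same in auto)
  have 4: "AE z in \<pi>. real_cond_exp \<pi> (sigma_gen_by \<pi> ?Y) (\<lambda>z. g (fst (fst z))) z = g (fst (fst z))"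
    by (rule real_cond_exp_F_meas[OF ig m])
  show "AE z in \<pi>. cexp \<pi> ?Y (\<lambda>(x, x'). f x * g (fst x')) z =
                     cexp \<pi> ?Y (\<lambda>(x, x'). f x) z * cexp \<pi> ?Y (\<lambda>(x, x'). g (fst x')) z"
    unfolding cexp_def split_beta using 1 2 3 4 by eventually_elim simp
qed

lemma bicausal_if_same_first:
  fixes \<pi> :: "(plane \<times> plane) measure"
  assumes "prob_space \<pi>" and S: "sets \<pi> = sets borel"
    and same: "AE z in \<pi>. fst (fst z) = fst (snd z)"
  shows "bicausal \<pi>"
proof -
  interpret prob_space \<pi> by fact
  have [measurable]: "prod.swap \<in> measurable \<pi> (borel :: (plane \<times> plane) measure)"
    unfolding measurable_cong_sets[OF S refl] prod.swap_def
    by (intro borel_measurable_continuous_onI continuous_intros)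
  have "AE z in distr \<pi> borel prod.swap. fst (fst z) = fst (snd z)"
  proof (subst AE_distr_iff)
    have "closed {z :: plane \<times> plane. fst (fst z) = fst (snd z)}"
      by (intro closed_Collect_eq continuous_intros)
    then show "{z \<in> space borel. fst (fst z) = fst (snd z)} \<in> sets (borel :: (plane \<times> plane) measure)"
      by simp
  qed (use same in auto)
  then have "causal (distr \<pi> borel prod.swap)"
    by (intro causal_if_same_first prob_space_distr) auto
  with causal_if_same_first[OF assms] show ?thesis
    by (simp add: bicausal_def)
qed

text \<open>The joint law of X and Y competes in the infimum. Any common source of randomness M will
  do, in particular a law on the line times an independent uniform variable, as in quantile
  couplings.\<close>

lemma W_ad_distr_le:
  fixes X Y :: "'a \<Rightarrow> plane"
  assumes "prob_space M" and [measurable]: "X \<in> borel_measurable M" "Y \<in> borel_measurable M"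
    and same: "AE w in M. fst (X w) = fst (Y w)"
  shows "W_ad p (distr M borel X) (distr M borel Y)
    \<le> eroot p (\<integral>\<^sup>+ w. ennreal (norm (X w - Y w) powr p) \<partial>M)"
proof -
  interpret prob_space M by fact
  define \<pi> where "\<pi> = distr M borel (\<lambda>w. (X w, Y w))"
  have [measurable]: "(\<lambda>w. (X w, Y w)) \<in> borel_measurable M"
    by (rule borel_measurable_Pair) auto
  have [measurable]: "(fst :: plane \<times> plane \<Rightarrow> plane) \<in> borel_measurable borel"
     "(snd :: plane \<times> plane \<Rightarrow> plane) \<in> borel_measurable borel"
    by (intro borel_measurable_continuous_onI continuous_intros)+
  have "closed {z :: plane \<times> plane. fst (fst z) = fst (snd z)}"
    by (intro closed_Collect_eq continuous_intros)
  then have "AE z in \<pi>. fst (fst z) = fst (snd z)"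
    unfolding \<pi>_def by (subst AE_distr_iff) (use same in auto)
  then have "bicausal \<pi>"
    by (intro bicausal_if_same_first) (auto simp: \<pi>_def intro: prob_space_distr)
  then have "\<pi> \<in> bicausal_couplings (distr M borel X) (distr M borel Y)"
    by (auto simp: bicausal_couplings_def \<pi>_def distr_distr comp_def intro!: prob_space_distr)
  then have "W_ad p (distr M borel X) (distr M borel Y)
    \<le> eroot p (\<integral>\<^sup>+ (x, x'). ennreal (norm (x - x') powr p) \<partial>\<pi>)"
    unfolding W_ad_def by (rule INF_lower)
  also have "(\<integral>\<^sup>+ (x, x'). ennreal (norm (x - x') powr p) \<partial>\<pi>)
    = (\<integral>\<^sup>+ w. ennreal (norm (X w - Y w) powr p) \<partial>M)"
    unfolding \<pi>_def split_beta by (subst nn_integral_distr) auto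
  finally show ?thesis .
qed

lemma eroot_le_ennreal:
  assumes "p > 0" "c \<ge> 0" "x \<le> ennreal (c powr p)"
  shows "eroot p x \<le> ennreal c"
proof -
  have "x < \<infinity>" using assms(3) by (simp add: le_less_trans)
  then have "enn2real x \<le> c powr p"
    using assms(3) by (simp add: enn2real_leI)
  then have "enn2real x powr (1 / p) \<le> (c powr p) powr (1 / p)"
    using assms by (intro powr_mono2) auto
  also have "\<dots> = c"
    using assms by (simp add: powr_powr)
  finally show ?thesis
    using \<open>x < \<infinity>\<close> by (auto simp: eroot_def intro: ennreal_leI)
qed

lemma eroot_mono:
  assumes "p > 0" "x \<le> y"
  shows "eroot p x \<le> eroot p y"
proof (cases "y = \<infinity>")
  case False
  then have "x \<noteq> \<infinity>" "enn2real x \<le> enn2real y"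
    using assms by (auto simp: top_unique less_top intro: enn2real_mono)
  with False show ?thesis
    using assms by (auto simp: eroot_def intro!: ennreal_leI powr_mono2)
qed (simp add: eroot_def)

lemma eroot_eq_0_iff: "p > 0 \<Longrightarrow> eroot p x = 0 \<longleftrightarrow> x = 0"
  by (cases x) (auto simp: eroot_def enn2real_eq_0_iff)

subsection \<open>Approximation by finite sums of strips\<close>

text \<open>The second factor is a half-line cut at a: the sets \<open>B \<times> {..t}\<close>
  generate and are stable under intersection, and the distribution function of a displaced strip is
  explicit. Arbitrary Borel sets are kept in the first coordinate, which is never displaced.\<close>

inductive strip_step :: "real \<Rightarrow> real \<Rightarrow> (real \<times> real \<Rightarrow> real) \<Rightarrow> bool" for a b where
  strip: "B \<in> sets borel \<Longrightarrow> t \<le> b \<Longrightarrow>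
    strip_step a b (\<lambda>z. c * (indicator B (fst z) * indicator {a..t} (snd z)))"
| add: "strip_step a b f \<Longrightarrow> strip_step a b g \<Longrightarrow> strip_step a b (\<lambda>z. f z + g z)"

lemma strip_step_scale:
  assumes "strip_step a b f"
  shows "strip_step a b (\<lambda>z. d * f z)"
  using assms
proof induction
  case (strip B t c)
  from strip_step.strip[OF this, where c="d * c"] show ?case
    by (simp add: mult.assoc)
next
  case (add f g)
  from strip_step.add[OF add(3,4)] show ?case by (simp add: distrib_left)
qed

lemma strip_step_measurable:
  "strip_step a b f \<Longrightarrow> f \<in> borel_measurable (borel \<Otimes>\<^sub>M borel)"
  by (induction rule: strip_step.induct) auto

lemma strip_step_bounded:
  assumes "strip_step a b f"
  shows "\<exists>K\<ge>0. (\<forall>z. \<bar>f z\<bar> \<le> K) \<and> (\<forall>z. snd z \<notin> {a..b} \<longrightarrow> f z = 0)"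
  using assms
proof induction
  case (strip B t c)
  then show ?case by (intro exI[of _ "\<bar>c\<bar>"]) (auto simp: indicator_def)
next
  case (add f g)
  then obtain K1 K2 where "K1 \<ge> 0" "\<forall>z. \<bar>f z\<bar> \<le> K1" "K2 \<ge> 0" "\<forall>z. \<bar>g z\<bar> \<le> K2" by auto
  with add show ?case
    by (intro exI[of _ "K1 + K2"]) (auto intro: order_trans[OF abs_triangle_ineq add_mono])
qed

text \<open>A finite label for the first coordinate; for a sum the labels of the summands are
  paired. The level sets of the label, up to removal of bad points, become the cells in Doeblin's
  condition.\<close>

lemma strip_step_atoms:
  assumes "strip_step a b f"
  shows "\<exists>(\<iota>::real \<Rightarrow> nat) n. \<iota> \<in> measurable borel (count_space UNIV) \<and> (\<forall>x. \<iota> x < n) \<and>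
    (\<forall>x x' y. \<iota> x = \<iota> x' \<longrightarrow> f (x, y) = f (x', y))"
  using assms
proof induction
  case (strip B t c)
  then show ?case
    by (intro exI[of _ "\<lambda>x. if x \<in> B then 1 else 0"] exI[of _ 2])
       (auto simp: indicator_def split: if_splits)
next
  case (add f g)
  from add.IH(1) obtain \<iota>1 :: "real \<Rightarrow> nat" and n1 where
    [measurable]: "\<iota>1 \<in> measurable borel (count_space UNIV)" and n1: "\<forall>x. \<iota>1 x < n1"
    and f: "\<forall>x x' y. \<iota>1 x = \<iota>1 x' \<longrightarrow> f (x, y) = f (x', y)"
    by blast
  from add.IH(2) obtain \<iota>2 :: "real \<Rightarrow> nat" and n2 where
    [measurable]: "\<iota>2 \<in> measurable borel (count_space UNIV)" and n2: "\<forall>x. \<iota>2 x < n2"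
    and g: "\<forall>x x' y. \<iota>2 x = \<iota>2 x' \<longrightarrow> g (x, y) = g (x', y)"
    by blast
  note n = n1 n2
  have "finite (prod_encode ` ({..<n1} \<times> {..<n2}))" by simp
  then obtain n where n': "\<forall>k\<in>prod_encode ` ({..<n1} \<times> {..<n2}). k < n"
    by (meson finite_nat_set_iff_bounded)
  show ?case
  proof (intro exI conjI allI impI)
    show "(\<lambda>x. prod_encode (\<iota>1 x, \<iota>2 x)) \<in> measurable borel (count_space UNIV)" by measurable
    show "prod_encode (\<iota>1 x, \<iota>2 x) < n" for x using n n' by auto
    show "f (x, y) + g (x, y) = f (x', y) + g (x', y)"
      if "prod_encode (\<iota>1 x, \<iota>2 x) = prod_encode (\<iota>1 x', \<iota>2 x')" for x x' y
      using that f g by (metis prod.inject prod_encode_eq)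
  qed
qed

text \<open>The generator serves twice: to approximate indicators of measurable sets, and to
  identify a law on the plane by its conditional distribution functions.\<close>

lemma sets_strips:
  "sets (borel \<Otimes>\<^sub>M borel :: (real \<times> real) measure)
    = sigma_sets UNIV {B \<times> {..t} | B t. B \<in> sets borel}"
proof -
  have "sets (borel \<Otimes>\<^sub>M borel :: (real \<times> real) measure)
      = sets (sigma (space borel \<times> space borel)
          {A \<times> B | A B. A \<in> sets (borel :: real measure) \<and> B \<in> range (\<lambda>t::real. {..t})})"
  proof (rule sets_pair_eq[where Ca="{UNIV}" and Cb="range (\<lambda>n::nat. {..real n})"])
    show "\<Union>(range (\<lambda>n::nat. {..real n})) = space borel"
      by (auto intro: real_arch_simple)
    show "sets borel = sigma_sets (space borel) (range (\<lambda>t::real. {..t}))"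
      by (metis borel_eq_atMost sets_measure_of space_borel subset_UNIV Pow_UNIV)
    show "sets borel = sigma_sets (space borel) (sets (borel :: real measure))"
      by (rule sets.sigma_sets_eq[symmetric])
  qed auto
  also have "{A \<times> B | A B. A \<in> sets (borel :: real measure) \<and> B \<in> range (\<lambda>t::real. {..t})}
      = {B \<times> {..t} | B t. B \<in> sets borel}" by auto
  finally show ?thesis by simp
qed

lemma Int_stable_strips: "Int_stable {B \<times> {..t::real} | B t. B \<in> sets (borel :: real measure)}"
  unfolding Int_stable_def
proof safe
  fix B B' :: "real set" and t t' :: real
  assume "B \<in> sets borel" "B' \<in> sets borel"
  then show "\<exists>B'' t''. B \<times> {..t} \<inter> B' \<times> {..t'} = B'' \<times> {..t''} \<and> B'' \<in> sets borel"
    by (intro exI[of _ "B \<inter> B'"] exI[of _ "min t t'"]) auto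
qed

section \<open>L^1 approximation for the product of a law on the line with Lebesgue measure\<close>

locale real_distr = prob_space \<mu>1 for \<mu>1 :: "real measure" +
  assumes sets_\<mu>1[measurable_cong, simp]: "sets \<mu>1 = sets borel"
begin

sublocale P: pair_sigma_finite \<mu>1 lborel ..

lemma space_\<mu>1[simp]: "space \<mu>1 = UNIV"
  using sets_eq_imp_space_eq[OF sets_\<mu>1] by simp

abbreviation "M \<equiv> \<mu>1 \<Otimes>\<^sub>M lborel"

lemma sets_M: "sets M = sets (borel \<Otimes>\<^sub>M borel)"
  by (intro sets_pair_measure_cong) auto

lemma space_M[simp]: "space M = UNIV"
  by (simp add: space_pair_measure)

text \<open>Extended-valued, so that the triangle inequality needs measurability only and no
  integrability.\<close>

definition L1 :: "(real \<times> real \<Rightarrow> real) \<Rightarrow> ennreal" where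
  "L1 f = (\<integral>\<^sup>+ z. ennreal \<bar>f z\<bar> \<partial>M)"

lemma L1_mono: "(\<And>z. \<bar>f z\<bar> \<le> \<bar>g z\<bar>) \<Longrightarrow> L1 f \<le> L1 g"
  unfolding L1_def by (intro nn_integral_mono ennreal_leI) auto

lemma L1_add_le:
  assumes [measurable]: "f \<in> borel_measurable (borel \<Otimes>\<^sub>M borel)" "g \<in> borel_measurable (borel \<Otimes>\<^sub>M borel)"
    and "\<And>z. \<bar>h z\<bar> \<le> \<bar>f z\<bar> + \<bar>g z\<bar>"
  shows "L1 h \<le> L1 f + L1 g"
proof -
  have "L1 h \<le> (\<integral>\<^sup>+ z. ennreal \<bar>f z\<bar> + ennreal \<bar>g z\<bar> \<partial>M)"
    unfolding L1_def using assms(3)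
    by (intro nn_integral_mono) (auto simp: ennreal_plus[symmetric] simp del: ennreal_plus intro: ennreal_leI)
  also have "\<dots> = L1 f + L1 g"
    unfolding L1_def by (rule nn_integral_add) auto
  finally show ?thesis .
qed

lemma L1_cmult:
  assumes [measurable]: "f \<in> borel_measurable (borel \<Otimes>\<^sub>M borel)"
  shows "L1 (\<lambda>z. c * f z) = ennreal \<bar>c\<bar> * L1 f"
  unfolding L1_def by (simp add: abs_mult ennreal_mult' nn_integral_cmult)

lemma L1_indicator:
  assumes "A \<in> sets (borel \<Otimes>\<^sub>M borel)"
  shows "L1 (indicator A) = emeasure M A"
proof -
  have "L1 (indicator A) = (\<integral>\<^sup>+ z. indicator A z \<partial>M)"
    unfolding L1_def by (intro nn_integral_cong) (auto simp: indicator_def)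
  also have "\<dots> = emeasure M A"
    using assms sets_M by (intro nn_integral_indicator) auto
  finally show ?thesis .
qed

lemma emeasure_strip:
  assumes "a \<le> b"
  shows "emeasure M (UNIV \<times> {a..b}) = ennreal (b - a)"
  using emeasure_space_1 assms by (simp add: lborel.emeasure_pair_measure_Times)

definition approx :: "real \<Rightarrow> real \<Rightarrow> (real \<times> real \<Rightarrow> real) \<Rightarrow> bool" where
  "approx a b f \<longleftrightarrow> (\<forall>e>0. \<exists>g. strip_step a b g \<and> L1 (\<lambda>z. f z - g z) \<le> ennreal e)"

lemma approxD: "approx a b f \<Longrightarrow> e > 0 \<Longrightarrow> \<exists>g. strip_step a b g \<and> L1 (\<lambda>z. f z - g z) \<le> ennreal e"
  by (auto simp: approx_def)

lemma approx_step: "strip_step a b f \<Longrightarrow> approx a b f"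
  unfolding approx_def by (auto intro!: exI[of _ f] simp: L1_def)

lemma approx_add:
  assumes [measurable]: "f \<in> borel_measurable (borel \<Otimes>\<^sub>M borel)" "g \<in> borel_measurable (borel \<Otimes>\<^sub>M borel)"
    and "approx a b f" "approx a b g"
  shows "approx a b (\<lambda>z. f z + g z)"
  unfolding approx_def
proof (intro allI impI)
  fix e :: real assume "e > 0"
  then obtain f' g' where *: "strip_step a b f'" "L1 (\<lambda>z. f z - f' z) \<le> ennreal (e/2)"
     "strip_step a b g'" "L1 (\<lambda>z. g z - g' z) \<le> ennreal (e/2)"
    using assms(3,4)[THEN approxD, of "e/2"] by auto
  have [measurable]: "f' \<in> borel_measurable (borel \<Otimes>\<^sub>M borel)" "g' \<in> borel_measurable (borel \<Otimes>\<^sub>M borel)"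
    using * by (auto intro: strip_step_measurable)
  have "L1 (\<lambda>z. f z + g z - (f' z + g' z)) \<le> L1 (\<lambda>z. f z - f' z) + L1 (\<lambda>z. g z - g' z)"
    by (rule L1_add_le) auto
  also have "\<dots> \<le> ennreal (e/2) + ennreal (e/2)" by (intro add_mono *)
  also have "\<dots> = ennreal e" using \<open>e > 0\<close> by (simp flip: ennreal_plus)
  finally show "\<exists>h. strip_step a b h \<and> L1 (\<lambda>z. f z + g z - h z) \<le> ennreal e"
    using strip_step.add[OF *(1,3)] by blast
qed

lemma approx_scale:
  assumes [measurable]: "f \<in> borel_measurable (borel \<Otimes>\<^sub>M borel)" and "approx a b f"
  shows "approx a b (\<lambda>z. c * f z)"
  unfolding approx_def
proof (intro allI impI)
  fix e :: real assume "e > 0"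
  then have "e / (\<bar>c\<bar> + 1) > 0" by (auto intro: divide_pos_pos)
  then obtain f' where *: "strip_step a b f'" "L1 (\<lambda>z. f z - f' z) \<le> ennreal (e / (\<bar>c\<bar> + 1))"
    using assms(2)[THEN approxD] by blast
  have [measurable]: "f' \<in> borel_measurable (borel \<Otimes>\<^sub>M borel)"
    using * by (auto intro: strip_step_measurable)
  have "L1 (\<lambda>z. c * f z - c * f' z) = ennreal \<bar>c\<bar> * L1 (\<lambda>z. f z - f' z)"
    by (subst L1_cmult[symmetric]) (auto simp: algebra_simps)
  also have "\<dots> \<le> ennreal \<bar>c\<bar> * ennreal (e / (\<bar>c\<bar> + 1))" by (intro mult_left_mono *) auto
  also have "\<dots> = ennreal (\<bar>c\<bar> * (e / (\<bar>c\<bar> + 1)))" using \<open>e > 0\<close> by (subst ennreal_mult) auto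
  also have "\<dots> \<le> ennreal e" using \<open>e > 0\<close> by (intro ennreal_leI) (auto simp: field_simps)
  finally show "\<exists>h. strip_step a b h \<and> L1 (\<lambda>z. c * f z - h z) \<le> ennreal e"
    using strip_step_scale[OF *(1)] by blast
qed

lemma approx_sum:
  assumes "finite I" "\<And>i. i \<in> I \<Longrightarrow> f i \<in> borel_measurable (borel \<Otimes>\<^sub>M borel)"
    "\<And>i. i \<in> I \<Longrightarrow> approx a b (f i)"
  shows "approx a b (\<lambda>z. \<Sum>i\<in>I. f i z)"
  using assms
proof (induction rule: finite_induct)
  case empty
  have "strip_step a b (\<lambda>z. 0 * (indicator {} (fst z) * indicator {a..b} (snd z)))"
    by (rule strip_step.strip) auto
  then show ?case using approx_step by simp
next
  case (insert i I)
  then have "approx a b (\<lambda>z. f i z + (\<Sum>i\<in>I. f i z))"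
    by (intro approx_add borel_measurable_sum) auto
  then show ?case using insert by simp
qed

lemma approx_limit:
  assumes [measurable]: "f \<in> borel_measurable (borel \<Otimes>\<^sub>M borel)"
    and "\<And>e. e > 0 \<Longrightarrow> \<exists>g\<in>borel_measurable (borel \<Otimes>\<^sub>M borel). approx a b g \<and> L1 (\<lambda>z. f z - g z) \<le> ennreal e"
  shows "approx a b f"
  unfolding approx_def
proof (intro allI impI)
  fix e :: real assume "e > 0"
  then obtain g where g[measurable]: "g \<in> borel_measurable (borel \<Otimes>\<^sub>M borel)"
     and *: "approx a b g" "L1 (\<lambda>z. f z - g z) \<le> ennreal (e/2)"
    using assms(2)[of "e/2"] by auto
  then obtain h where h: "strip_step a b h" "L1 (\<lambda>z. g z - h z) \<le> ennreal (e/2)"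
    using \<open>e > 0\<close> approxD[of a b g "e/2"] by auto
  have [measurable]: "h \<in> borel_measurable (borel \<Otimes>\<^sub>M borel)"
    using h by (auto intro: strip_step_measurable)
  have "L1 (\<lambda>z. f z - h z) \<le> L1 (\<lambda>z. f z - g z) + L1 (\<lambda>z. g z - h z)"
    by (rule L1_add_le) auto
  also have "\<dots> \<le> ennreal (e/2) + ennreal (e/2)" by (intro add_mono * h)
  also have "\<dots> = ennreal e" using \<open>e > 0\<close> by (simp flip: ennreal_plus)
  finally show "\<exists>h. strip_step a b h \<and> L1 (\<lambda>z. f z - h z) \<le> ennreal e" using h by blast
qed

text \<open>Dynkin's argument on the intersection-stable generator: complements by linearity,
  disjoint unions by continuity of a finite measure. The sets are truncated to the strip because
  \<open>M\<close> itself is infinite.\<close>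

lemma approx_indicator:
  assumes "a \<le> b" "A \<in> sets (borel \<Otimes>\<^sub>M borel)"
  shows "approx a b (indicator (A \<inter> UNIV \<times> {a..b}))"
proof -
  let ?S = "UNIV \<times> {a..b} :: (real \<times> real) set"
  have S[measurable]: "?S \<in> sets (borel \<Otimes>\<^sub>M borel)" by measurable
  define N where "N = density M (indicator ?S)"
  have SM: "?S \<in> sets M" using S sets_M by simp
  have setsN: "sets N = sets (borel \<Otimes>\<^sub>M borel)" unfolding N_def by (simp add: sets_M)
  have emN: "emeasure N A = emeasure M (A \<inter> ?S)" if "A \<in> sets (borel \<Otimes>\<^sub>M borel)" for A
    unfolding N_def using that sets_M SM
    by (subst emeasure_density) (auto simp: Int_commute simp flip: indicator_inter_arith)
  interpret N: finite_measure N
  proof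
    have "space N = UNIV" unfolding N_def by simp
    then show "emeasure N (space N) \<noteq> \<infinity>"
      using emN[of UNIV] emeasure_strip[OF assms(1)] sets.top[of "borel \<Otimes>\<^sub>M borel :: (real \<times> real) measure"]
      by (simp add: space_pair_measure)
  qed
  have A: "A \<in> sigma_sets UNIV {B \<times> {..t} | B t. B \<in> sets borel}" using assms(2) sets_strips by simp
  have "{B \<times> {..t} | B t. B \<in> sets borel} \<subseteq> Pow (UNIV :: (real \<times> real) set)" by auto
  from Int_stable_strips this A show ?thesis
  proof (induction rule: sigma_sets_induct_disjoint)
    case (basic A)
    then obtain B t where A: "A = B \<times> {..t}" "B \<in> sets borel" by auto
    have "indicator (A \<inter> ?S) = (\<lambda>z. 1 * (indicator B (fst z) * indicator {a..min b t} (snd z)) :: real)"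
      unfolding A by (auto simp: indicator_def fun_eq_iff)
    then show ?case
      using approx_step[OF strip_step.strip[of B "min b t" b a 1]] A(2) by simp
  next
    case empty
    then show ?case using approx_sum[of "{}"] by (simp add: indicator_def)
  next
    case (compl A)
    then have [measurable]: "A \<in> sets (borel \<Otimes>\<^sub>M borel)" using sets_strips by simp
    have "indicator ?S = (\<lambda>z. 1 * (indicator UNIV (fst z) * indicator {a..b} (snd z)) :: real)"
      by (auto simp: indicator_def fun_eq_iff)
    then have 1: "approx a b (indicator ?S)"
      using approx_step[OF strip_step.strip[of UNIV b b a 1]] by simp
    have "approx a b (\<lambda>z. indicator ?S z + (-1) * indicator (A \<inter> ?S) z)"
      by (intro approx_add approx_scale compl 1) auto
    moreover have "(\<lambda>z. indicator ?S z + (-1) * indicator (A \<inter> ?S) z) = (indicator ((UNIV - A) \<inter> ?S) :: _ \<Rightarrow> real)"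
      by (auto simp: indicator_def fun_eq_iff)
    ultimately show ?case by simp
  next
    case (union A)
    then have Am[measurable]: "\<And>i. A i \<in> sets (borel \<Otimes>\<^sub>M borel)" using sets_strips by auto
    show ?case
    proof (rule approx_limit)
      fix e :: real assume e: "e > 0"
      let ?U = "\<lambda>n. \<Union>i<n. A i"
      have Um: "?U n \<in> sets (borel \<Otimes>\<^sub>M borel)" "(\<Union>i. A i) \<in> sets (borel \<Otimes>\<^sub>M borel)" for n by auto
      \<comment> \<open>Continuity from below of the finite measure \<open>N\<close> leaves a
        remainder of measure less than e after finitely many sets.\<close>
      have "(\<lambda>n. measure N (?U n)) \<longlonglongrightarrow> measure N (\<Union>n. ?U n)"
        by (rule N.finite_Lim_measure_incseq) (auto simp: setsN incseq_def Bex_def intro: less_le_trans)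
      also have "(\<Union>n. ?U n) = (\<Union>i. A i)" by auto
      finally obtain n where n: "\<bar>measure N (?U n) - measure N (\<Union>i. A i)\<bar> < e"
        using e by (fastforce dest!: LIMSEQ_D)
      let ?g = "\<lambda>z. indicator (?U n \<inter> ?S) z :: real"
      have "?g = (\<lambda>z. \<Sum>i<n. indicator (A i \<inter> ?S) z)"
      proof
        fix z
        have "(\<Union>i<n. A i) \<inter> ?S = (\<Union>i<n. A i \<inter> ?S)" by auto
        then show "?g z = (\<Sum>i<n. indicator (A i \<inter> ?S) z)"
          using union(1) indicator_UN_disjoint[of "{..<n}" "\<lambda>i. A i \<inter> ?S" z]
          by (auto simp: disjoint_family_on_def simp flip: of_nat_sum)
      qed
      moreover have "approx a b (\<lambda>z. \<Sum>i<n. indicator (A i \<inter> ?S) z)"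
        by (intro approx_sum union) auto
      moreover have "L1 (\<lambda>z. indicator ((\<Union>i. A i) \<inter> ?S) z - ?g z) \<le> ennreal e"
      proof -
        have "L1 (\<lambda>z. indicator ((\<Union>i. A i) \<inter> ?S) z - ?g z) \<le> L1 (indicator (((\<Union>i. A i) - ?U n) \<inter> ?S))"
          by (rule L1_mono) (auto simp: indicator_def)
        also have "\<dots> = emeasure N ((\<Union>i. A i) - ?U n)"
          using Um by (subst L1_indicator) (auto intro!: emN[symmetric])
        also have "\<dots> = ennreal (measure N ((\<Union>i. A i) - ?U n))"
          by (rule N.emeasure_eq_measure)
        also have "measure N ((\<Union>i. A i) - ?U n) = measure N (\<Union>i. A i) - measure N (?U n)"
          using Um by (intro N.finite_measure_Diff) (auto simp: setsN)
        also have "ennreal \<dots> \<le> ennreal e" using n by (intro ennreal_leI) linarith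
        finally show ?thesis .
      qed
      ultimately show "\<exists>g\<in>borel_measurable (borel \<Otimes>\<^sub>M borel). approx a b g \<and>
         L1 (\<lambda>z. indicator ((\<Union>i. A i) \<inter> ?S) z - g z) \<le> ennreal e"
        by (intro bexI[of _ ?g]) auto
    qed auto
  qed
qed

end

text \<open>Rounding down to multiples of 1/n gives finitely many values on a bounded function. This
  discretises densities in the next approximation and displacements later.\<close>

lemma floor_level:
  fixes f :: real and n :: nat
  assumes "\<bar>f\<bar> \<le> K" "n > 0"
  shows "\<bar>f - of_int \<lfloor>real n * f\<rfloor> / real n\<bar> \<le> 1 / real n"
    "\<lfloor>real n * f\<rfloor> \<in> {\<lfloor>- real n * K\<rfloor>..\<lfloor>real n * K\<rfloor>}"
proof -
  have "f - of_int \<lfloor>real n * f\<rfloor> / real n = (real n * f - of_int \<lfloor>real n * f\<rfloor>) / real n"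
    using assms by (simp add: field_simps)
  moreover have "\<bar>real n * f - of_int \<lfloor>real n * f\<rfloor>\<bar> \<le> 1" by linarith
  ultimately show "\<bar>f - of_int \<lfloor>real n * f\<rfloor> / real n\<bar> \<le> 1 / real n"
    using assms(2) by (simp add: divide_right_mono)
  have "real n * f \<le> real n * K" "- real n * K \<le> real n * f"
    using assms mult_left_mono[of f K "real n"] mult_left_mono[of "-K" f "real n"] by auto
  then show "\<lfloor>real n * f\<rfloor> \<in> {\<lfloor>- real n * K\<rfloor>..\<lfloor>real n * K\<rfloor>}"
    by (auto intro: floor_mono)
qed

context real_distr
begin

text \<open>The conditions hold at every point, not almost everywhere: all sections are then
  integrable, and conditional integrals make sense for every x.\<close>

definition strip_bounded :: "real \<Rightarrow> real \<Rightarrow> (real \<times> real \<Rightarrow> real) \<Rightarrow> bool" where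
  "strip_bounded a b f \<longleftrightarrow> f \<in> borel_measurable (borel \<Otimes>\<^sub>M borel) \<and>
     (\<exists>K. \<forall>z. \<bar>f z\<bar> \<le> K) \<and> (\<forall>z. snd z \<notin> {a..b} \<longrightarrow> f z = 0)"

lemma L1_strip_le:
  assumes "a \<le> b" "\<And>z. \<bar>f z\<bar> \<le> K" "\<And>z. snd z \<notin> {a..b} \<Longrightarrow> f z = 0"
  shows "L1 f \<le> ennreal (K * (b - a))"
proof -
  have K: "K \<ge> 0" using assms(2)[of "(0,0)"] by linarith
  have "L1 f \<le> (\<integral>\<^sup>+ z. ennreal K * indicator (UNIV \<times> {a..b}) z \<partial>M)"
    unfolding L1_def
    by (intro nn_integral_mono) (use assms in \<open>auto simp: indicator_def mem_Times_iff intro!: ennreal_leI\<close>)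
  also have "\<dots> = ennreal K * ennreal (b - a)"
    by (subst nn_integral_cmult_indicator) (auto simp: emeasure_strip[OF assms(1)])
  finally show ?thesis using K assms(1) by (simp add: ennreal_mult)
qed

lemma approx_strip_bounded:
  assumes "a < b" "strip_bounded a b f"
  shows "approx a b f"
proof -
  from assms obtain K where [measurable]: "f \<in> borel_measurable (borel \<Otimes>\<^sub>M borel)" and K: "\<And>z. \<bar>f z\<bar> \<le> K"
    and s: "\<And>z. snd z \<notin> {a..b} \<Longrightarrow> f z = 0"
    unfolding strip_bounded_def by metis
  let ?S = "UNIV \<times> {a..b} :: (real \<times> real) set"
  show ?thesis
  proof (rule approx_limit)
    fix e :: real assume e: "e > 0"
    obtain n0 :: nat where "(b - a) / e \<le> real n0"
      using real_arch_simple by blast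
    then obtain n :: nat where n: "n > 0" "(b - a) / e \<le> real n"
      by (intro that[of "Suc n0"]) auto
    let ?I = "{\<lfloor>- real n * K\<rfloor>..\<lfloor>real n * K\<rfloor>}"
    define A where "A k = {z. \<lfloor>real n * f z\<rfloor> = k}" for k
    have "{z \<in> space (borel \<Otimes>\<^sub>M borel). \<lfloor>real n * f z\<rfloor> = k} \<in> sets (borel \<Otimes>\<^sub>M borel)" for k
      by measurable
    then have A[measurable]: "A k \<in> sets (borel \<Otimes>\<^sub>M borel)" for k
      by (simp add: A_def space_pair_measure)
    let ?g = "\<lambda>z. \<Sum>k\<in>?I. (of_int k / real n) * indicator (A k \<inter> ?S) z"
    have g: "?g z = of_int \<lfloor>real n * f z\<rfloor> / real n * indicator ?S z" for z
    proof -
      have "?g z = (\<Sum>k\<in>?I. if k = \<lfloor>real n * f z\<rfloor> then (of_int k / real n) * indicator ?S z else 0)"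
        by (intro sum.cong) (auto simp: A_def indicator_def)
      also have "\<dots> = of_int \<lfloor>real n * f z\<rfloor> / real n * indicator ?S z"
        using floor_level(2)[OF K n(1), of z] by (subst sum.delta) auto
      finally show ?thesis .
    qed
    have "approx a b ?g"
      by (intro approx_sum approx_scale approx_indicator) (use assms(1) in auto)
    moreover have "L1 (\<lambda>z. f z - ?g z) \<le> ennreal e"
    proof -
      have *: "\<bar>f z - ?g z\<bar> \<le> 1 / real n" "snd z \<notin> {a..b} \<Longrightarrow> f z - ?g z = 0" for z
        using floor_level(1)[OF K n(1), of z] s[of z] unfolding g by (auto simp: indicator_def mem_Times_iff)
      have "L1 (\<lambda>z. f z - ?g z) \<le> ennreal (1 / real n * (b - a))"
        by (rule L1_strip_le) (use assms(1) * in auto)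
      also have "\<dots> \<le> ennreal e"
        using n e by (intro ennreal_leI) (simp add: field_simps)
      finally show ?thesis .
    qed
    ultimately show "\<exists>g\<in>borel_measurable (borel \<Otimes>\<^sub>M borel). approx a b g \<and> L1 (\<lambda>z. f z - g z) \<le> ennreal e"
      by (intro bexI[of _ ?g]) auto
  qed simp
qed

end

subsection \<open>Distribution functions of displaced densities\<close>

context real_distr
begin

lemma strip_boundedD:
  assumes "strip_bounded a b g"
  shows "g \<in> borel_measurable (borel \<Otimes>\<^sub>M borel)"
    and "\<exists>K\<ge>0. \<forall>z. \<bar>g z\<bar> \<le> K"
    and "snd z \<notin> {a..b} \<Longrightarrow> g z = 0"
proof -
  show "g \<in> borel_measurable (borel \<Otimes>\<^sub>M borel)" "snd z \<notin> {a..b} \<Longrightarrow> g z = 0"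
    using assms unfolding strip_bounded_def by blast+
  show "\<exists>K\<ge>0. \<forall>z. \<bar>g z\<bar> \<le> K"
    using assms unfolding strip_bounded_def by (meson abs_ge_zero order_trans)
qed

lemma strip_bounded_integrable:
  assumes "strip_bounded a b g"
  shows "integrable lborel (\<lambda>y. g (x, y))"
proof -
  from strip_boundedD(2)[OF assms] obtain K where K: "K \<ge> 0" "\<And>z. \<bar>g z\<bar> \<le> K" by auto
  have [measurable]: "g \<in> borel_measurable (borel \<Otimes>\<^sub>M borel)" by (rule strip_boundedD[OF assms])
  show ?thesis
  proof (rule Bochner_Integration.integrable_bound)
    show "integrable lborel (\<lambda>y. K * indicator {a..b} y)"
      by (intro integrable_mult_right) (simp add: integrable_indicator_iff emeasure_lborel_Icc_eq)
    show "AE y in lborel. norm (g (x, y)) \<le> norm (K * indicator {a..b} y)"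
      using K strip_boundedD(3)[OF assms, of "(x, _)"] by (auto simp: indicator_def)
  qed measurable
qed

lemma strip_bounded_mult:
  assumes "strip_bounded a b g" "h \<in> borel_measurable (borel \<Otimes>\<^sub>M borel)" "\<And>z. \<bar>h z\<bar> \<le> K"
  shows "strip_bounded a b (\<lambda>z. g z * h z)"
proof -
  from strip_boundedD(2)[OF assms(1)] obtain K' where K: "K' \<ge> 0" "\<And>z. \<bar>g z\<bar> \<le> K'" by auto
  have "\<bar>g z * h z\<bar> \<le> K' * K" for z
    unfolding abs_mult using K assms(3) by (intro mult_mono) auto
  then show ?thesis
    using strip_boundedD[OF assms(1)] assms(2) unfolding strip_bounded_def by auto
qed

lemma strip_bounded_add:
  assumes "strip_bounded a b g" "strip_bounded a b h"
  shows "strip_bounded a b (\<lambda>z. g z + h z)"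
proof -
  obtain K K' where "\<And>z. \<bar>g z\<bar> \<le> K" "\<And>z. \<bar>h z\<bar> \<le> K'"
    using strip_boundedD(2)[OF assms(1)] strip_boundedD(2)[OF assms(2)] by auto
  then have "\<bar>g z + h z\<bar> \<le> K + K'" for z
    by (rule order_trans[OF abs_triangle_ineq add_mono])
  then show ?thesis
    using strip_boundedD[OF assms(1)] strip_boundedD[OF assms(2)] unfolding strip_bounded_def by auto
qed

lemma strip_bounded_cmult:
  "strip_bounded a b g \<Longrightarrow> strip_bounded a b (\<lambda>z. c * g z)"
  using strip_bounded_mult[of a b g "\<lambda>_. c" "\<bar>c\<bar>"] by (simp add: mult.commute)

lemma strip_bounded_diff:
  "strip_bounded a b g \<Longrightarrow> strip_bounded a b h \<Longrightarrow> strip_bounded a b (\<lambda>z. g z - h z)"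
  using strip_bounded_add[of a b g "\<lambda>z. (-1) * h z"] strip_bounded_cmult[of a b h "-1"] by simp

lemma strip_step_strip_bounded: "strip_step a b f \<Longrightarrow> strip_bounded a b f"
  unfolding strip_bounded_def using strip_step_measurable strip_step_bounded by blast

text \<open>The value at \<open>(x, t)\<close> is the mass in \<open>{..t}\<close> of the image of \<open>g(x, y) dy\<close> under
  \<open>y \<mapsto> y + D(x, y)\<close>.\<close>

definition shifted_cdf :: "(real \<times> real \<Rightarrow> real) \<Rightarrow> (real \<times> real \<Rightarrow> real) \<Rightarrow> real \<times> real \<Rightarrow> real" where
  "shifted_cdf g D z = (\<integral>y. (if y + D (fst z, y) \<le> snd z then g (fst z, y) else 0) \<partial>lborel)"

lemma shifted_cdf_measurable[measurable]:
  assumes [measurable]: "g \<in> borel_measurable (borel \<Otimes>\<^sub>M borel)" "D \<in> borel_measurable (borel \<Otimes>\<^sub>M borel)"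
  shows "shifted_cdf g D \<in> borel_measurable (borel \<Otimes>\<^sub>M borel)"
  unfolding shifted_cdf_def[abs_def] by measurable

lemma shifted_cdf_integrable:
  assumes g: "strip_bounded a b g" and [measurable]: "D \<in> borel_measurable (borel \<Otimes>\<^sub>M borel)"
  shows "integrable lborel (\<lambda>y. if y + D (x, y) \<le> t then g (x, y) else 0)"
proof -
  have [measurable]: "g \<in> borel_measurable (borel \<Otimes>\<^sub>M borel)" by (rule strip_boundedD[OF g])
  show ?thesis
    by (rule Bochner_Integration.integrable_bound[OF strip_bounded_integrable[OF g, of x]]) auto
qed

lemma shifted_cdf_add:
  assumes "strip_bounded a b g" "strip_bounded a b h" "D \<in> borel_measurable (borel \<Otimes>\<^sub>M borel)"
  shows "shifted_cdf (\<lambda>z. g z + h z) D z = shifted_cdf g D z + shifted_cdf h D z"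
  unfolding shifted_cdf_def
  by (subst Bochner_Integration.integral_add[symmetric])
     (auto intro!: shifted_cdf_integrable assms Bochner_Integration.integral_cong)

lemma shifted_cdf_diff:
  assumes "strip_bounded a b g" "strip_bounded a b h" "D \<in> borel_measurable (borel \<Otimes>\<^sub>M borel)"
  shows "shifted_cdf (\<lambda>z. g z - h z) D z = shifted_cdf g D z - shifted_cdf h D z"
  unfolding shifted_cdf_def
  by (subst Bochner_Integration.integral_diff[symmetric])
     (auto intro!: shifted_cdf_integrable assms Bochner_Integration.integral_cong)

text \<open>The two thresholds disagree exactly for t between u and v, so mass k moved from u to v
  contributes mass times distance to the L^1 distance of distribution functions.\<close>

lemma nn_integral_threshold:
  "(\<integral>\<^sup>+ t. ennreal \<bar>(if u \<le> t then k else 0) - (if v \<le> t then k else 0)\<bar> \<partial>lborel)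
    = ennreal (\<bar>k\<bar> * \<bar>u - v\<bar>)" for u v k :: real
proof -
  have "(\<integral>\<^sup>+ t. ennreal \<bar>(if u \<le> t then k else 0) - (if v \<le> t then k else 0)\<bar> \<partial>lborel)
    = (\<integral>\<^sup>+ t. ennreal \<bar>k\<bar> * indicator {min u v..<max u v} t \<partial>lborel)"
    by (intro nn_integral_cong) (auto simp: indicator_def)
  also have "\<dots> = ennreal \<bar>k\<bar> * ennreal (max u v - min u v)"
    by (subst nn_integral_cmult_indicator) auto
  also have "\<dots> = ennreal (\<bar>k\<bar> * \<bar>u - v\<bar>)"
    by (subst ennreal_mult[symmetric]) (auto simp: max_def min_def)
  finally show ?thesis .
qed

text \<open>After exchanging the integrals over t and y, each mass element is charged its own change
  of displacement. Mass is labelled by its starting point, so measurability of D and D' is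
  enough.\<close>

lemma L1_shifted_cdf_diff:
  assumes g: "strip_bounded a b g"
    and [measurable]: "D \<in> borel_measurable (borel \<Otimes>\<^sub>M borel)" "D' \<in> borel_measurable (borel \<Otimes>\<^sub>M borel)"
  shows "L1 (\<lambda>z. shifted_cdf g D z - shifted_cdf g D' z) \<le> L1 (\<lambda>z. g z * (D z - D' z))"
proof -
  have [measurable]: "g \<in> borel_measurable (borel \<Otimes>\<^sub>M borel)" by (rule strip_boundedD[OF g])
  let ?f = "\<lambda>x y t. (if y + D (x, y) \<le> t then g (x, y) else 0) - (if y + D' (x, y) \<le> t then g (x, y) else 0)"
  have "L1 (\<lambda>z. shifted_cdf g D z - shifted_cdf g D' z)
    = (\<integral>\<^sup>+ x. \<integral>\<^sup>+ t. ennreal \<bar>shifted_cdf g D (x, t) - shifted_cdf g D' (x, t)\<bar> \<partial>lborel \<partial>\<mu>1)"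
    unfolding L1_def by (subst lborel.nn_integral_fst[symmetric]) auto
  also have "\<dots> \<le> (\<integral>\<^sup>+ x. \<integral>\<^sup>+ t. \<integral>\<^sup>+ y. ennreal \<bar>?f x y t\<bar> \<partial>lborel \<partial>lborel \<partial>\<mu>1)"
  proof (intro nn_integral_mono)
    fix x t :: real
    have "shifted_cdf g D (x, t) - shifted_cdf g D' (x, t) = (\<integral>y. ?f x y t \<partial>lborel)"
      unfolding shifted_cdf_def fst_conv snd_conv
      by (rule Bochner_Integration.integral_diff[symmetric]) (auto intro!: shifted_cdf_integrable[OF g])
    moreover have "ennreal (norm (\<integral>y. ?f x y t \<partial>lborel)) \<le> (\<integral>\<^sup>+ y. ennreal (norm (?f x y t)) \<partial>lborel)"
      by (intro integral_norm_bound_ennreal Bochner_Integration.integrable_diff shifted_cdf_integrable[OF g]) auto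
    ultimately show "ennreal \<bar>shifted_cdf g D (x, t) - shifted_cdf g D' (x, t)\<bar>
        \<le> (\<integral>\<^sup>+ y. ennreal \<bar>?f x y t\<bar> \<partial>lborel)" by simp
  qed
  also have "\<dots> = (\<integral>\<^sup>+ x. \<integral>\<^sup>+ y. \<integral>\<^sup>+ t. ennreal \<bar>?f x y t\<bar> \<partial>lborel \<partial>lborel \<partial>\<mu>1)"
  proof (rule nn_integral_cong)
    fix x
    show "(\<integral>\<^sup>+ t. \<integral>\<^sup>+ y. ennreal \<bar>?f x y t\<bar> \<partial>lborel \<partial>lborel) = (\<integral>\<^sup>+ y. \<integral>\<^sup>+ t. ennreal \<bar>?f x y t\<bar> \<partial>lborel \<partial>lborel)"
      by (rule lborel_pair.Fubini') measurable
  qed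
  also have "\<dots> = (\<integral>\<^sup>+ x. \<integral>\<^sup>+ y. ennreal \<bar>g (x, y) * (D (x, y) - D' (x, y))\<bar> \<partial>lborel \<partial>\<mu>1)"
    by (intro nn_integral_cong) (simp add: nn_integral_threshold abs_mult)
  also have "\<dots> = L1 (\<lambda>z. g z * (D z - D' z))"
    unfolding L1_def by (subst lborel.nn_integral_fst[symmetric]) auto
  finally show ?thesis .
qed

text \<open>Net mass per unit of r that crosses the level \<open>snd z\<close> to the right when the
  density g is displaced by r d. To first order it should be the current g d.\<close>

definition flux :: "(real \<times> real \<Rightarrow> real) \<Rightarrow> (real \<times> real \<Rightarrow> real) \<Rightarrow> real \<Rightarrow> real \<times> real \<Rightarrow> real" where
  "flux g d r z = (shifted_cdf g (\<lambda>_. 0) z - shifted_cdf g (\<lambda>z. r * d z) z) / r"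

definition fluxlim :: "(real \<times> real \<Rightarrow> real) \<Rightarrow> (real \<times> real \<Rightarrow> real) \<Rightarrow> bool" where
  "fluxlim g d \<longleftrightarrow>
    (\<forall>e>0. \<forall>\<^sub>F r in at_right 0. L1 (\<lambda>z. flux g d r z - g z * d z) \<le> ennreal e)"

lemma flux_measurable[measurable]:
  assumes [measurable]: "g \<in> borel_measurable (borel \<Otimes>\<^sub>M borel)" "d \<in> borel_measurable (borel \<Otimes>\<^sub>M borel)"
  shows "flux g d r \<in> borel_measurable (borel \<Otimes>\<^sub>M borel)"
  unfolding flux_def[abs_def] by measurable

lemma flux_add:
  assumes "strip_bounded a b g" "strip_bounded a b h" "d \<in> borel_measurable (borel \<Otimes>\<^sub>M borel)"
  shows "flux (\<lambda>z. g z + h z) d r z = flux g d r z + flux h d r z"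
  unfolding flux_def using assms by (simp add: shifted_cdf_add add_divide_distrib diff_divide_distrib)

lemma flux_diff:
  assumes "strip_bounded a b g" "strip_bounded a b h" "d \<in> borel_measurable (borel \<Otimes>\<^sub>M borel)"
  shows "flux (\<lambda>z. g z - h z) d r z = flux g d r z - flux h d r z"
  unfolding flux_def using assms by (simp add: shifted_cdf_diff add_divide_distrib diff_divide_distrib)

text \<open>The factor 1/r cancels against the factor r of the displacement: the flux is Lipschitz
  in d and, being linear in g, is controlled by g as well, uniformly in r. The approximation
  arguments below rest on this uniformity.\<close>

lemma L1_flux_diff:
  assumes g: "strip_bounded a b g" and "r > 0"
    and [measurable]: "d \<in> borel_measurable (borel \<Otimes>\<^sub>M borel)" "d' \<in> borel_measurable (borel \<Otimes>\<^sub>M borel)"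
  shows "L1 (\<lambda>z. flux g d r z - flux g d' r z) \<le> L1 (\<lambda>z. g z * (d z - d' z))"
proof -
  have [measurable]: "g \<in> borel_measurable (borel \<Otimes>\<^sub>M borel)" by (rule strip_boundedD[OF g])
  have "L1 (\<lambda>z. flux g d r z - flux g d' r z)
     = L1 (\<lambda>z. (1 / r) * (shifted_cdf g (\<lambda>z. r * d' z) z - shifted_cdf g (\<lambda>z. r * d z) z))"
    by (intro arg_cong[where f=L1] ext) (simp add: flux_def diff_divide_distrib)
  also have "\<dots> = ennreal \<bar>1 / r\<bar> * L1 (\<lambda>z. shifted_cdf g (\<lambda>z. r * d' z) z - shifted_cdf g (\<lambda>z. r * d z) z)"
    by (rule L1_cmult) measurable
  also have "\<dots> \<le> ennreal \<bar>1 / r\<bar> * L1 (\<lambda>z. g z * (r * d' z - r * d z))"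
    by (intro mult_left_mono L1_shifted_cdf_diff[OF g]) auto
  also have "\<dots> = L1 (\<lambda>z. (1 / r) * (g z * (r * d' z - r * d z)))"
    by (rule L1_cmult[symmetric]) measurable
  also have "\<dots> = L1 (\<lambda>z. g z * (d z - d' z))"
  proof -
    have "(1 / r) * (g z * (r * d' z - r * d z)) = - (g z * (d z - d' z))" for z
      using \<open>r > 0\<close> by (simp add: field_simps)
    then show ?thesis unfolding L1_def by (simp only: abs_minus_cancel)
  qed
  finally show ?thesis .
qed

lemma L1_flux:
  assumes g: "strip_bounded a b g" and "r > 0" and [measurable]: "d \<in> borel_measurable (borel \<Otimes>\<^sub>M borel)"
  shows "L1 (flux g d r) \<le> L1 (\<lambda>z. g z * d z)"
  using L1_flux_diff[OF g \<open>r > 0\<close>, of d "\<lambda>_. 0"] by (simp add: flux_def[abs_def])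

lemma fluxlim_add:
  assumes g: "strip_bounded a b g" "strip_bounded a b h" and [measurable]: "d \<in> borel_measurable (borel \<Otimes>\<^sub>M borel)"
    and "fluxlim g d" "fluxlim h d"
  shows "fluxlim (\<lambda>z. g z + h z) d"
  unfolding fluxlim_def
proof (intro allI impI)
  fix e :: real assume "e > 0"
  have [measurable]: "g \<in> borel_measurable (borel \<Otimes>\<^sub>M borel)" "h \<in> borel_measurable (borel \<Otimes>\<^sub>M borel)"
    using g[THEN strip_boundedD(1)] by auto
  have "\<forall>\<^sub>F r in at_right 0. L1 (\<lambda>z. flux g d r z - g z * d z) \<le> ennreal (e/2)"
     "\<forall>\<^sub>F r in at_right 0. L1 (\<lambda>z. flux h d r z - h z * d z) \<le> ennreal (e/2)"
    using assms(4,5) \<open>e > 0\<close> unfolding fluxlim_def by auto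
  then show "\<forall>\<^sub>F r in at_right 0. L1 (\<lambda>z. flux (\<lambda>z. g z + h z) d r z - (g z + h z) * d z) \<le> ennreal e"
  proof eventually_elim
    case (elim r)
    have "L1 (\<lambda>z. flux (\<lambda>z. g z + h z) d r z - (g z + h z) * d z)
        \<le> L1 (\<lambda>z. flux g d r z - g z * d z) + L1 (\<lambda>z. flux h d r z - h z * d z)"
      by (rule L1_add_le) (auto simp: flux_add[OF g] algebra_simps)
    also have "\<dots> \<le> ennreal (e/2) + ennreal (e/2)" by (intro add_mono elim)
    also have "\<dots> = ennreal e" using \<open>e > 0\<close> by (simp flip: ennreal_plus)
    finally show ?case .
  qed
qed

lemma clamp_lipschitz:
  "\<bar>max 0 (min c t - a) - max 0 (min c (t - d) - a)\<bar> \<le> \<bar>d\<bar>" for a c t d :: real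
  by linarith

text \<open>The function t \<mapsto> max 0 (min c t - a) is a primitive of the indicator of [a, c];
  its increments are exact as soon as t is further than |d| from both kinks.\<close>

lemma clamp_shift:
  fixes a c t d :: real
  assumes "t \<notin> {a - \<bar>d\<bar>..a + \<bar>d\<bar>}" "t \<notin> {c - \<bar>d\<bar>..c + \<bar>d\<bar>}"
  shows "max 0 (min c t - a) - max 0 (min c (t - d) - a) = d * indicator {a..c} t"
proof (cases "t \<in> {a..c}")
  case True
  with assms have "max 0 (min c t - a) - max 0 (min c (t - d) - a) = d" by auto
  moreover have "indicator {a..c} t = (1::real)" using True by simp
  ultimately show ?thesis by (simp only: mult_1_right)
next
  case False
  with assms have "max 0 (min c t - a) - max 0 (min c (t - d) - a) = 0" by auto
  moreover have "indicator {a..c} t = (0::real)" using False by simp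
  ultimately show ?thesis by (simp only: mult_zero_right)
qed

lemma fluxlim_strip:
  assumes "B \<in> sets borel" "t0 \<le> b"
  shows "fluxlim (\<lambda>z. c * (indicator B (fst z) * indicator {a..t0} (snd z))) (\<lambda>_. d)"
  unfolding fluxlim_def
proof (intro allI impI)
  fix e :: real assume e: "e > 0"
  let ?g = "\<lambda>z. c * (indicator B (fst z) * indicator {a..t0} (snd z)) :: real"
  let ?m = "\<lambda>u. max 0 (min t0 u - a)"
  have F: "shifted_cdf ?g (\<lambda>_. D) z = c * indicator B (fst z) * ?m (snd z - D)" for D z
  proof -
    have "shifted_cdf ?g (\<lambda>_. D) z = (\<integral>y. c * indicator B (fst z) * indicator {a..min t0 (snd z - D)} y \<partial>lborel)"
      unfolding shifted_cdf_def by (intro Bochner_Integration.integral_cong) (auto simp: indicator_def)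
    then show ?thesis by (auto simp: max_def)
  qed
  \<comment> \<open>The error is at most 2 |c| |d| on each of two windows of length 2 r |d|, around
    a and t0, which adds up to 8 |c| |d|^2 r.\<close>
  have ev: "\<forall>\<^sub>F r in at_right 0. 8 * \<bar>c\<bar> * \<bar>d\<bar> * \<bar>d\<bar> * r < e"
    by (rule order_tendstoD(2)[OF _ e]) (auto intro!: tendsto_eq_intros)
  show "\<forall>\<^sub>F r in at_right 0. L1 (\<lambda>z. flux ?g (\<lambda>_. d) r z - ?g z * d) \<le> ennreal e"
    using ev eventually_at_right_less[of 0]
  proof eventually_elim
    case (elim r)
    let ?N = "{a - r * \<bar>d\<bar>..a + r * \<bar>d\<bar>}" and ?N' = "{t0 - r * \<bar>d\<bar>..t0 + r * \<bar>d\<bar>}"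
    have *: "\<bar>flux ?g (\<lambda>_. d) r z - ?g z * d\<bar>
        \<le> 2 * \<bar>c\<bar> * \<bar>d\<bar> * indicator ?N (snd z) + 2 * \<bar>c\<bar> * \<bar>d\<bar> * indicator ?N' (snd z)" for z
    proof -
      let ?t = "snd z" and ?i = "indicator {a..t0} (snd z) :: real"
      have eq: "flux ?g (\<lambda>_. d) r z - ?g z * d
        = c * indicator B (fst z) * ((?m ?t - ?m (?t - r * d)) / r - d * ?i)"
        unfolding flux_def F by (simp add: algebra_simps diff_divide_distrib)
      define X where "X = (?m ?t - ?m (?t - r * d)) / r - d * ?i"
      have rd: "\<bar>r * d\<bar> = r * \<bar>d\<bar>" using elim by (simp add: abs_mult)
      have "\<bar>?m ?t - ?m (?t - r * d)\<bar> \<le> \<bar>r * d\<bar>" by (rule clamp_lipschitz)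
      then have "\<bar>(?m ?t - ?m (?t - r * d)) / r\<bar> \<le> \<bar>d\<bar>"
        using elim unfolding rd by (simp add: field_simps)
      moreover have "\<bar>d * ?i\<bar> \<le> \<bar>d\<bar>" by (auto simp: indicator_def)
      moreover have "\<And>A B :: real. \<bar>A\<bar> \<le> \<bar>d\<bar> \<Longrightarrow> \<bar>B\<bar> \<le> \<bar>d\<bar> \<Longrightarrow> \<bar>A - B\<bar> \<le> 2 * \<bar>d\<bar>" by linarith
      ultimately have le2: "\<bar>X\<bar> \<le> 2 * \<bar>d\<bar>" unfolding X_def by blast
      have zero: "X = 0" if "?t \<notin> ?N" "?t \<notin> ?N'"
      proof -
        have "?m ?t - ?m (?t - r * d) = r * d * ?i"
          by (rule clamp_shift) (use that rd in auto)
        then show ?thesis unfolding X_def using elim by simp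
      qed
      have "\<bar>X\<bar> \<le> 2 * \<bar>d\<bar> * (indicator ?N ?t + indicator ?N' ?t)"
      proof (cases "?t \<in> ?N \<or> ?t \<in> ?N'")
        case True
        then have "1 \<le> (indicator ?N ?t + indicator ?N' ?t :: real)" by (auto simp: indicator_def)
        then have "2 * \<bar>d\<bar> * 1 \<le> 2 * \<bar>d\<bar> * (indicator ?N ?t + indicator ?N' ?t)"
          by (intro mult_left_mono) auto
        with le2 show ?thesis by linarith
      qed (use zero in auto)
      then have "\<bar>c\<bar> * \<bar>X\<bar> \<le> \<bar>c\<bar> * (2 * \<bar>d\<bar> * (indicator ?N ?t + indicator ?N' ?t))"
        by (rule mult_left_mono) simp
      moreover have "\<bar>flux ?g (\<lambda>_. d) r z - ?g z * d\<bar> \<le> \<bar>c\<bar> * \<bar>X\<bar>"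
        unfolding eq X_def[symmetric] abs_mult by (auto simp: indicator_def)
      ultimately show ?thesis by (simp only: ring_distribs mult_ac)
    qed
    have L: "L1 (\<lambda>z. k * indicator {u - s..u + s} (snd z)) \<le> ennreal (k * (2 * s))" if "k \<ge> 0" "s \<ge> 0" for k u s
      using L1_strip_le[of "u - s" "u + s" "\<lambda>z. k * indicator {u - s..u + s} (snd z)" k] that
      by (auto simp: indicator_def)
    have "L1 (\<lambda>z. flux ?g (\<lambda>_. d) r z - ?g z * d)
        \<le> L1 (\<lambda>z. 2 * \<bar>c\<bar> * \<bar>d\<bar> * indicator ?N (snd z)) + L1 (\<lambda>z. 2 * \<bar>c\<bar> * \<bar>d\<bar> * indicator ?N' (snd z))"
      by (rule L1_add_le) (use * in \<open>auto intro: order_trans\<close>)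
    also have "\<dots> \<le> ennreal (2 * \<bar>c\<bar> * \<bar>d\<bar> * (2 * (r * \<bar>d\<bar>))) + ennreal (2 * \<bar>c\<bar> * \<bar>d\<bar> * (2 * (r * \<bar>d\<bar>)))"
      by (intro add_mono L) (use elim in auto)
    also have "\<dots> = ennreal (8 * \<bar>c\<bar> * \<bar>d\<bar> * \<bar>d\<bar> * r)"
    proof -
      have "2 * C * D * (2 * (r * D)) + 2 * C * D * (2 * (r * D)) = 8 * C * D * D * r" for C D :: real
        by (simp add: algebra_simps)
      then show ?thesis using elim by (subst ennreal_plus[symmetric]) auto
    qed
    also have "\<dots> \<le> ennreal e" using elim by (intro ennreal_leI) simp
    finally show ?case .
  qed
qed

lemma fluxlim_step: "strip_step a b g \<Longrightarrow> fluxlim g (\<lambda>_. d)"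
proof (induction rule: strip_step.induct)
  case (strip B t c)
  then show ?case by (rule fluxlim_strip)
next
  case (add f g)
  then show ?case by (intro fluxlim_add[of a b]) (auto intro: strip_step_strip_bounded)
qed

text \<open>Approximation of the density by steps h: the remainder g - h costs |d| times its L^1
  norm once in the flux and once in the limit, uniformly in r.\<close>

lemma fluxlim_const:
  assumes "a < b" and g: "strip_bounded a b g"
  shows "fluxlim g (\<lambda>_. d)"
  unfolding fluxlim_def
proof (intro allI impI)
  fix e :: real assume e: "e > 0"
  have gm[measurable]: "g \<in> borel_measurable (borel \<Otimes>\<^sub>M borel)" by (rule strip_boundedD[OF g])
  define e' where "e' = e / (3 * (\<bar>d\<bar> + 1))"
  have e': "e' > 0" "\<bar>d\<bar> * e' \<le> e / 3" using e by (auto simp: e'_def field_simps add_pos_nonneg)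
  obtain h where h: "strip_step a b h" "L1 (\<lambda>z. g z - h z) \<le> ennreal e'"
    using approxD[OF approx_strip_bounded[OF assms] e'(1)] by blast
  have hs: "strip_bounded a b h" using h(1) by (rule strip_step_strip_bounded)
  have hm[measurable]: "h \<in> borel_measurable (borel \<Otimes>\<^sub>M borel)" by (rule strip_boundedD[OF hs])
  have diff: "L1 (\<lambda>z. (g z - h z) * d) \<le> ennreal (e/3)"
  proof -
    have "L1 (\<lambda>z. (g z - h z) * d) = ennreal \<bar>d\<bar> * L1 (\<lambda>z. g z - h z)"
      by (subst L1_cmult[symmetric]) (auto simp: mult.commute)
    also have "\<dots> \<le> ennreal \<bar>d\<bar> * ennreal e'" by (intro mult_left_mono h) auto
    also have "\<dots> = ennreal (\<bar>d\<bar> * e')" using e' by (subst ennreal_mult) auto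
    finally show ?thesis using e'(2) by (meson ennreal_leI order_trans)
  qed
  have "\<forall>\<^sub>F r in at_right 0. L1 (\<lambda>z. flux h (\<lambda>_. d) r z - h z * d) \<le> ennreal (e/3)"
    using fluxlim_step[OF h(1), of d] e unfolding fluxlim_def by auto
  then show "\<forall>\<^sub>F r in at_right 0. L1 (\<lambda>z. flux g (\<lambda>_. d) r z - g z * d) \<le> ennreal e"
    using eventually_at_right_less[of 0]
  proof eventually_elim
    case (elim r)
    have "L1 (\<lambda>z. flux g (\<lambda>_. d) r z - g z * d)
      \<le> L1 (flux (\<lambda>z. g z - h z) (\<lambda>_. d) r) + L1 (\<lambda>z. (flux h (\<lambda>_. d) r z - h z * d) + (h z - g z) * d)"
      by (rule L1_add_le) (auto simp: flux_diff[OF g hs] algebra_simps)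
    also have "\<dots> \<le> ennreal (e/3) + (ennreal (e/3) + ennreal (e/3))"
    proof (rule add_mono)
      show "L1 (flux (\<lambda>z. g z - h z) (\<lambda>_. d) r) \<le> ennreal (e/3)"
        by (rule order_trans[OF L1_flux[OF strip_bounded_diff[OF g hs] elim(2)] diff]) simp
      have "L1 (\<lambda>z. (flux h (\<lambda>_. d) r z - h z * d) + (h z - g z) * d)
         \<le> L1 (\<lambda>z. flux h (\<lambda>_. d) r z - h z * d) + L1 (\<lambda>z. (g z - h z) * d)"
        by (rule L1_add_le) (auto simp: algebra_simps)
      also have "\<dots> \<le> ennreal (e/3) + ennreal (e/3)" by (rule add_mono[OF elim(1) diff])
      finally show "L1 (\<lambda>z. (flux h (\<lambda>_. d) r z - h z * d) + (h z - g z) * d)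
         \<le> ennreal (e/3) + ennreal (e/3)" .
    qed
    also have "\<dots> = ennreal e" using e by (simp flip: ennreal_plus)
    finally show ?case .
  qed
qed

text \<open>Mass is labelled by where it starts, so cutting the density along the level sets of a
  rounded displacement turns the displaced law into a finite sum of laws with constant
  displacements.\<close>

lemma fluxlim_bounded:
  assumes ab: "a < b" and g: "strip_bounded a b g"
    and dm[measurable]: "d \<in> borel_measurable (borel \<Otimes>\<^sub>M borel)" and dK: "\<And>z. \<bar>d z\<bar> \<le> Kd"
  shows "fluxlim g d"
  unfolding fluxlim_def
proof (intro allI impI)
  fix e :: real assume e: "e > 0"
  have gm[measurable]: "g \<in> borel_measurable (borel \<Otimes>\<^sub>M borel)" by (rule strip_boundedD[OF g])
  obtain Kg where Kg: "Kg \<ge> 0" "\<And>z. \<bar>g z\<bar> \<le> Kg" using strip_boundedD(2)[OF g] by auto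
  obtain n0 :: nat where "3 * Kg * (b - a) / e \<le> real n0"
    using real_arch_simple by blast
  \<comment> \<open>Rounding d by at most 1/n changes g d by at most Kg/n on a strip of width b - a;
    with this n the total is at most e/3.\<close>
  then obtain n :: nat where n: "n > 0" "3 * Kg * (b - a) / e \<le> real n"
    by (intro that[of "Suc n0"]) auto
  let ?I = "{\<lfloor>- real n * Kd\<rfloor>..\<lfloor>real n * Kd\<rfloor>}"
  define A where "A k = {z. \<lfloor>real n * d z\<rfloor> = k}" for k
  have "{z \<in> space (borel \<Otimes>\<^sub>M borel). \<lfloor>real n * d z\<rfloor> = k} \<in> sets (borel \<Otimes>\<^sub>M borel)" for k
    by measurable
  then have A[measurable]: "A k \<in> sets (borel \<Otimes>\<^sub>M borel)" for k
    by (simp add: A_def space_pair_measure)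
  define d' where "d' z = of_int \<lfloor>real n * d z\<rfloor> / real n" for z
  have d'm[measurable]: "d' \<in> borel_measurable (borel \<Otimes>\<^sub>M borel)" unfolding d'_def[abs_def] by measurable
  have dd: "\<bar>d z - d' z\<bar> \<le> 1 / real n" for z
    unfolding d'_def by (rule floor_level(1)[OF dK n(1)])
  define gk where "gk k z = g z * indicator (A k) z" for k z
  have gk: "strip_bounded a b (gk k)" for k
    unfolding gk_def[abs_def] by (rule strip_bounded_mult[OF g, of _ 1]) (auto simp: indicator_def)
  have gk_sum: "(\<Sum>k\<in>?I. gk k z * f k) = g z * f \<lfloor>real n * d z\<rfloor>" for z f
  proof -
    have "(\<Sum>k\<in>?I. gk k z * f k) = (\<Sum>k\<in>?I. if k = \<lfloor>real n * d z\<rfloor> then g z * f k else 0)"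
      by (intro sum.cong) (auto simp: gk_def A_def indicator_def)
    then show ?thesis using floor_level(2)[OF dK n(1), of z] by (simp add: sum.delta)
  qed
  have F: "shifted_cdf g (\<lambda>z. r * d' z) z = (\<Sum>k\<in>?I. shifted_cdf (gk k) (\<lambda>_. r * (of_int k / real n)) z)"
    and F0: "shifted_cdf g (\<lambda>_. 0) z = (\<Sum>k\<in>?I. shifted_cdf (gk k) (\<lambda>_. 0) z)" for r z
  proof -
    show "shifted_cdf g (\<lambda>z. r * d' z) z = (\<Sum>k\<in>?I. shifted_cdf (gk k) (\<lambda>_. r * (of_int k / real n)) z)"
      unfolding shifted_cdf_def
    proof (subst Bochner_Integration.integral_sum[symmetric])
      have "(if y + r * d' (fst z, y) \<le> snd z then g (fst z, y) else 0)
        = (\<Sum>k\<in>?I. if y + r * (of_int k / real n) \<le> snd z then gk k (fst z, y) else 0)" for y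
        using gk_sum[of "(fst z, y)" "\<lambda>k. if y + r * (of_int k / real n) \<le> snd z then 1 else 0"]
        by (simp add: d'_def if_distrib cong: if_cong)
      then show "(\<integral>y. (if y + r * d' (fst z, y) \<le> snd z then g (fst z, y) else 0) \<partial>lborel)
        = (\<integral>y. (\<Sum>k\<in>?I. if y + r * (of_int k / real n) \<le> snd z then gk k (fst z, y) else 0) \<partial>lborel)"
        by simp
    qed (rule shifted_cdf_integrable[OF gk], simp)
    show "shifted_cdf g (\<lambda>_. 0) z = (\<Sum>k\<in>?I. shifted_cdf (gk k) (\<lambda>_. 0) z)"
      unfolding shifted_cdf_def
    proof (subst Bochner_Integration.integral_sum[symmetric])
      have "(if y + 0 \<le> snd z then g (fst z, y) else 0)
        = (\<Sum>k\<in>?I. if y + 0 \<le> snd z then gk k (fst z, y) else 0)" for y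
        using gk_sum[of "(fst z, y)" "\<lambda>k. if y + 0 \<le> snd z then 1 else 0"]
        by (simp add: if_distrib cong: if_cong)
      then show "(\<integral>y. (if y + 0 \<le> snd z then g (fst z, y) else 0) \<partial>lborel)
        = (\<integral>y. (\<Sum>k\<in>?I. if y + 0 \<le> snd z then gk k (fst z, y) else 0) \<partial>lborel)"
        by simp
    qed (rule shifted_cdf_integrable[OF gk], simp)
  qed
  have flux_sum: "flux g d' r z = (\<Sum>k\<in>?I. flux (gk k) (\<lambda>_. of_int k / real n) r z)" for r z
    unfolding flux_def F F0 by (simp add: sum_subtractf sum_divide_distrib diff_divide_distrib)
  have L1_sum: "L1 (\<lambda>z. \<Sum>k\<in>J. h k z) \<le> (\<Sum>k\<in>J. L1 (h k))"
    if "\<And>k. h k \<in> borel_measurable (borel \<Otimes>\<^sub>M borel)" "finite J" for h and J :: "int set"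
    using that(2)
  proof (induction J rule: finite_induct)
    case (insert k J)
    note [measurable] = that(1)
    have "L1 (\<lambda>z. \<Sum>k\<in>insert k J. h k z) \<le> L1 (h k) + L1 (\<lambda>z. \<Sum>k\<in>J. h k z)"
      using insert(1,2) by (intro L1_add_le) auto
    also have "\<dots> \<le> L1 (h k) + (\<Sum>k\<in>J. L1 (h k))" by (intro add_left_mono insert)
    finally show ?case using insert by simp
  qed (simp add: L1_def)
  have dg: "L1 (\<lambda>z. g z * (d z - d' z)) \<le> ennreal (e/3)"
  proof -
    have "L1 (\<lambda>z. g z * (d z - d' z)) \<le> ennreal ((Kg * (1 / real n)) * (b - a))"
    proof (rule L1_strip_le)
      show "\<bar>g z * (d z - d' z)\<bar> \<le> Kg * (1 / real n)" for z
        unfolding abs_mult by (intro mult_mono Kg dd) (use Kg in auto)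
    qed (use ab strip_boundedD(3)[OF g] in auto)
    also have "\<dots> \<le> ennreal (e/3)"
      using n e by (intro ennreal_leI) (simp add: field_simps)
    finally show ?thesis .
  qed
  \<comment> \<open>A third of e is shared among the levels; adding 1 keeps the denominator
    positive.\<close>
  define N where "N = card ?I + 1"
  have "\<forall>\<^sub>F r in at_right 0. \<forall>k\<in>?I. L1 (\<lambda>z. flux (gk k) (\<lambda>_. of_int k / real n) r z - gk k z * (of_int k / real n)) \<le> ennreal (e/3/real N)"
  proof (rule eventually_ball_finite, goal_cases)
    case 2
    have "e / 3 / real N > 0" using e by (simp add: N_def del: card_atLeastAtMost_int)
    then show ?case
      using fluxlim_const[OF ab gk, unfolded fluxlim_def] by blast
  qed simp
  then show "\<forall>\<^sub>F r in at_right 0. L1 (\<lambda>z. flux g d r z - g z * d z) \<le> ennreal e"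
    using eventually_at_right_less[of 0]
  proof eventually_elim
    case (elim r)
    have "L1 (\<lambda>z. flux g d' r z - g z * d' z)
       = L1 (\<lambda>z. \<Sum>k\<in>?I. (flux (gk k) (\<lambda>_. of_int k / real n) r z - gk k z * (of_int k / real n)))"
      unfolding flux_sum sum_subtractf gk_sum d'_def ..
    also have "\<dots> \<le> (\<Sum>k\<in>?I. L1 (\<lambda>z. flux (gk k) (\<lambda>_. of_int k / real n) r z - gk k z * (of_int k / real n)))"
      by (rule L1_sum) (auto simp: gk_def[abs_def])
    also have "\<dots> \<le> (\<Sum>k\<in>?I. ennreal (e/3/real N))" using elim by (intro sum_mono) auto
    also have "\<dots> = ennreal (real (card ?I) * (e/3/real N))"
      unfolding sum_constant using e
      by (subst ennreal_mult) (auto simp: ennreal_of_nat_eq_real_of_nat simp del: card_atLeastAtMost_int)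
    also have "\<dots> \<le> ennreal (e/3)"
      using e by (intro ennreal_leI) (simp add: N_def field_simps del: card_atLeastAtMost_int)
    finally have 1: "L1 (\<lambda>z. flux g d' r z - g z * d' z) \<le> ennreal (e/3)" .
    have "L1 (\<lambda>z. flux g d r z - g z * d z)
      \<le> L1 (\<lambda>z. flux g d r z - flux g d' r z) + L1 (\<lambda>z. (flux g d' r z - g z * d' z) - g z * (d z - d' z))"
      by (rule L1_add_le) (auto simp: algebra_simps)
    also have "\<dots> \<le> ennreal (e/3) + (ennreal (e/3) + ennreal (e/3))"
    proof (rule add_mono)
      show "L1 (\<lambda>z. flux g d r z - flux g d' r z) \<le> ennreal (e/3)"
        by (rule order_trans[OF L1_flux_diff[OF g elim(2)] dg]) auto
      have "L1 (\<lambda>z. (flux g d' r z - g z * d' z) - g z * (d z - d' z))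
         \<le> L1 (\<lambda>z. flux g d' r z - g z * d' z) + L1 (\<lambda>z. g z * (d z - d' z))"
        by (rule L1_add_le) (auto simp: algebra_simps)
      also have "\<dots> \<le> ennreal (e/3) + ennreal (e/3)" by (rule add_mono[OF 1 dg])
      finally show "L1 (\<lambda>z. (flux g d' r z - g z * d' z) - g z * (d z - d' z))
         \<le> ennreal (e/3) + ennreal (e/3)" .
    qed
    also have "\<dots> = ennreal e" using e by (simp flip: ennreal_plus)
    finally show ?case .
  qed
qed

end

subsection \<open>The Poisson equation of an irreducible symmetric kernel\<close>

text \<open>A Markov kernel with bounded density, reversible for M. The assumptions hold at every
  point, so that \<open>T\<close> obeys pointwise bounds on bounded functions and series of iterates
  can be summed pointwise.\<close>

locale symmetric_kernel = prob_space M for M :: "'a measure" +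
  fixes k :: "'a \<Rightarrow> 'a \<Rightarrow> real" and K :: real
  assumes space_UNIV[simp]: "space M = UNIV"
    and k_measurable[measurable]: "(\<lambda>(x, y). k x y) \<in> borel_measurable (M \<Otimes>\<^sub>M M)"
    and k_nonneg: "\<And>x y. 0 \<le> k x y" and k_le: "\<And>x y. k x y \<le> K"
    and k_mass: "\<And>x. (\<integral>y. k x y \<partial>M) = 1"
    and k_sym: "\<And>x y. k x y = k y x"
begin

lemma K_ge_1: "1 \<le> K"
proof -
  have "(\<integral>y. k undefined y \<partial>M) \<le> (\<integral>y. K \<partial>M)"
    using k_mass[of undefined] k_le by (intro integral_mono) (auto intro: integrable_const_bound[where B=K] simp: k_nonneg)
  then show ?thesis using k_mass[of undefined] prob_space by simp
qed

definition bm :: "('a \<Rightarrow> real) \<Rightarrow> bool" where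
  "bm f \<longleftrightarrow> f \<in> borel_measurable M \<and> (\<exists>B. \<forall>x. \<bar>f x\<bar> \<le> B)"

definition T :: "('a \<Rightarrow> real) \<Rightarrow> 'a \<Rightarrow> real" where
  "T f x = (\<integral>y. k x y * f y \<partial>M)"

lemma bm_measurable[measurable_dest]: "bm f \<Longrightarrow> f \<in> borel_measurable M"
  by (simp add: bm_def)

lemma bmI: "f \<in> borel_measurable M \<Longrightarrow> (\<And>x. \<bar>f x\<bar> \<le> B) \<Longrightarrow> bm f"
  by (auto simp: bm_def)

lemma k_measurable'[measurable]: "k x \<in> borel_measurable M"
  using k_measurable measurable_compose[OF measurable_Pair1'[of x M M] k_measurable] by simp

lemma bm_integrable:
  assumes "bm f"
  shows "integrable M f"
proof -
  obtain B where "\<And>x. \<bar>f x\<bar> \<le> B" using assms by (auto simp: bm_def)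
  then show ?thesis
    using bm_measurable[OF assms] by (intro integrable_const_bound[where B=B]) auto
qed

lemma bm_integrable_ind: "bm f \<Longrightarrow> A \<in> sets M \<Longrightarrow> integrable M (\<lambda>x. indicator A x * f x)"
  by (rule Bochner_Integration.integrable_bound[OF bm_integrable[of f]]) (auto simp: indicator_def bm_def)

lemma bm_k_integrable:
  assumes "bm f"
  shows "integrable M (\<lambda>y. k x y * f y)"
proof -
  note [measurable] = bm_measurable[OF assms]
  obtain B where B: "\<And>x. \<bar>f x\<bar> \<le> B" using assms by (auto simp: bm_def)
  show ?thesis
  proof (rule integrable_const_bound[where B="K * B"])
    have "\<bar>k x y * f y\<bar> \<le> K * B" for y
      unfolding abs_mult using B k_le k_nonneg K_ge_1 by (intro mult_mono) auto
    then show "AE y in M. norm (k x y * f y) \<le> K * B" by simp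
  qed measurable
qed

lemma k_integrable: "integrable M (k x)"
  using bm_k_integrable[of "\<lambda>_. 1" x] by (simp add: bm_def) (metis abs_one order_refl)

lemma T_mono:
  assumes "bm f" "bm g" "\<And>x. f x \<le> g x"
  shows "T f x \<le> T g x"
  unfolding T_def
  by (intro integral_mono bm_k_integrable assms mult_left_mono k_nonneg)

lemma T_const: "T (\<lambda>_. c) x = c"
  unfolding T_def using k_mass by simp

lemma T_cmult: "T (\<lambda>x. c * f x) x = c * T f x"
  unfolding T_def by (simp add: mult.left_commute)

lemma T_diff: "bm f \<Longrightarrow> bm g \<Longrightarrow> T (\<lambda>x. f x - g x) x = T f x - T g x"
  unfolding T_def by (simp add: right_diff_distrib bm_k_integrable)

lemma bm_const: "bm (\<lambda>_. c)"
  by (rule bmI[of _ "\<bar>c\<bar>"]) auto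

lemma bm_diff: "bm f \<Longrightarrow> bm g \<Longrightarrow> bm (\<lambda>x. f x - g x)"
  unfolding bm_def by (auto intro!: borel_measurable_diff, meson abs_triangle_ineq4 add_mono order_trans)

lemma bm_cmult:
  assumes "bm f"
  shows "bm (\<lambda>x. c * f x)"
proof -
  obtain B where "\<And>x. \<bar>f x\<bar> \<le> B" using assms by (auto simp: bm_def)
  then have "\<bar>c * f x\<bar> \<le> \<bar>c\<bar> * B" for x unfolding abs_mult by (intro mult_left_mono) auto
  then show ?thesis using assms by (intro bmI[of _ "\<bar>c\<bar> * B"]) (auto simp: bm_def)
qed

lemma bm_indicator: "A \<in> sets M \<Longrightarrow> bm (indicator A)"
  by (rule bmI[of _ 1]) (auto simp: indicator_def)

lemma T_measurable:
  assumes "bm f"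
  shows "T f \<in> borel_measurable M"
proof -
  note [measurable] = bm_measurable[OF assms]
  show ?thesis unfolding T_def[abs_def] by measurable
qed

lemma T_bounds:
  assumes "bm f" "\<And>x. l \<le> f x" "\<And>x. f x \<le> u"
  shows "l \<le> T f x" "T f x \<le> u"
  using T_mono[OF bm_const[of l] assms(1,2)] T_mono[OF assms(1) bm_const[of u] assms(3)]
  by (simp_all add: T_const)

lemma bm_T: "bm f \<Longrightarrow> bm (T f)"
proof -
  assume f: "bm f"
  then obtain B where B: "\<And>x. \<bar>f x\<bar> \<le> B" by (auto simp: bm_def)
  then have "\<And>x. -B \<le> f x" "\<And>x. f x \<le> B" by (auto simp: abs_le_iff minus_le_iff)
  from T_bounds[OF f this] show ?thesis
    by (intro bmI[of _ B] T_measurable f) (auto simp: abs_le_iff minus_le_iff)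
qed

text \<open>Symmetry makes M invariant. Hence the mean-zero condition on the right-hand side of the
  Poisson equation persists for all iterates.\<close>

lemma T_integral:
  assumes f: "bm f"
  shows "(\<integral>x. T f x \<partial>M) = (\<integral>x. f x \<partial>M)"
proof -
  note [measurable] = bm_measurable[OF f]
  interpret PP: pair_prob_space M M ..
  obtain B where B: "\<And>x. \<bar>f x\<bar> \<le> B" using f by (auto simp: bm_def)
  have int: "integrable (M \<Otimes>\<^sub>M M) (\<lambda>(x, y). k x y * f y)"
  proof (rule PP.P.integrable_const_bound[where B="K * B"])
    have "\<bar>k x y * f y\<bar> \<le> K * B" for x y
      unfolding abs_mult using B k_le k_nonneg K_ge_1 by (intro mult_mono) auto
    then have "norm (case z of (x, y) \<Rightarrow> k x y * f y) \<le> K * B" for z by (cases z) simp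
    then show "AE z in M \<Otimes>\<^sub>M M. norm (case z of (x, y) \<Rightarrow> k x y * f y) \<le> K * B" by (intro AE_I2)
  qed measurable
  have "(\<integral>x. T f x \<partial>M) = (\<integral>y. \<integral>x. k x y * f y \<partial>M \<partial>M)"
    unfolding T_def using PP.Fubini_integral[OF int] by simp
  also have "\<dots> = (\<integral>y. f y \<partial>M)"
  proof (rule Bochner_Integration.integral_cong[OF refl])
    fix y
    have "(\<integral>x. k x y * f y \<partial>M) = f y * (\<integral>x. k y x \<partial>M)"
      by (subst k_sym) (simp add: mult.commute)
    then show "(\<integral>x. k x y * f y \<partial>M) = f y" by (simp add: k_mass)
  qed
  finally show ?thesis .
qed

lemma bm_Tn: "bm f \<Longrightarrow> bm ((T ^^ n) f)"
  by (induction n) (auto intro: bm_T)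

lemma Tn_mono:
  assumes "bm f" "bm g" "\<And>x. f x \<le> g x"
  shows "(T ^^ n) f x \<le> (T ^^ n) g x"
  by (induction n arbitrary: x) (auto intro!: assms T_mono bm_Tn)

lemma Tn_const: "(T ^^ n) (\<lambda>_. c) = (\<lambda>_. c)"
  by (induction n) (auto simp: T_const)

lemma Tn_cmult: "(T ^^ n) (\<lambda>x. c * f x) = (\<lambda>x. c * (T ^^ n) f x)"
  by (induction n) (auto simp: T_cmult)

lemma Tn_diff: "bm f \<Longrightarrow> bm g \<Longrightarrow> (T ^^ n) (\<lambda>x. f x - g x) = (\<lambda>x. (T ^^ n) f x - (T ^^ n) g x)"
  by (induction n) (auto simp: T_diff bm_Tn)

lemma Tn_bounds:
  assumes "bm f" "\<And>x. l \<le> f x" "\<And>x. f x \<le> u"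
  shows "l \<le> (T ^^ n) f x" "(T ^^ n) f x \<le> u"
  using Tn_mono[OF bm_const[of l] assms(1,2), of n x] Tn_mono[OF assms(1) bm_const[of u] assms(3), of n x]
  by (simp_all add: Tn_const)

lemma Tn_integral: "bm f \<Longrightarrow> (\<integral>x. (T ^^ n) f x \<partial>M) = (\<integral>x. f x \<partial>M)"
  by (induction n) (auto simp: T_integral bm_Tn)

end

text \<open>Cells may overlap or be null. As k is at most K, the bound in \<open>rest\<close> lets
  the complement of the cells be reached with probability at most 1/2 from any point. The hypothesis
  in \<open>irreducible\<close> says that the complement of R cannot be left.\<close>

locale irreducible_kernel = symmetric_kernel +
  fixes E :: "nat \<Rightarrow> 'a set" and n :: nat and \<gamma> :: real
  assumes E[measurable]: "\<And>i. E i \<in> sets M"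
    and \<gamma>: "0 < \<gamma>" "\<And>i x y. i < n \<Longrightarrow> x \<in> E i \<Longrightarrow> y \<in> E i \<Longrightarrow> \<gamma> \<le> k x y"
    and rest: "prob (UNIV - (\<Union>i<n. E i)) \<le> 1 / (2 * K)"
    and irreducible: "\<And>R. R \<in> sets M \<Longrightarrow> (\<And>x. x \<notin> R \<Longrightarrow> AE y in M. y \<in> R \<longrightarrow> k x y = 0) \<Longrightarrow>
      prob R = 0 \<or> prob R = 1"
begin

lemma T_ge_on_cell:
  assumes "i < n" "x \<in> E i" "bm f" "\<And>y. 0 \<le> f y"
  shows "\<gamma> * (\<integral>y. indicator (E i) y * f y \<partial>M) \<le> T f x"
proof -
  have "\<gamma> * (\<integral>y. indicator (E i) y * f y \<partial>M) = (\<integral>y. \<gamma> * (indicator (E i) y * f y) \<partial>M)" by simp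
  also have "\<dots> \<le> T f x"
    unfolding T_def using assms \<gamma>(2)[OF assms(1,2)] k_nonneg
    by (intro integral_mono integrable_mult_right bm_integrable_ind bm_k_integrable)
       (auto simp: indicator_def intro: mult_right_mono)
  finally show ?thesis .
qed

lemma cell_exists: "\<exists>i<n. 0 < prob (E i)"
proof (rule ccontr)
  assume "\<not> (\<exists>i<n. 0 < prob (E i))"
  then have "\<And>i. i < n \<Longrightarrow> prob (E i) = 0" by (auto simp: zero_less_measure_iff)
  then have "prob (\<Union>i<n. E i) \<le> 0"
    using finite_measure_subadditive_finite[of "{..<n}" E] by (auto simp: image_subset_iff)
  moreover have "prob (UNIV - (\<Union>i<n. E i)) = 1 - prob (\<Union>i<n. E i)"
    using prob_compl[of "\<Union>i<n. E i"] by simp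
  moreover have "1 / (2 * K) < 1" using K_ge_1 by simp
  ultimately show False using rest by linarith
qed

text \<open>Fix a charged cell \<open>E i0\<close> and let \<open>g m x\<close> be the probability
  of being in it after m steps from x. Irreducibility makes every charged cell lead to
  \<open>E i0\<close>, and the bound inside a cell allows waiting there, so one m serves all of the
  finitely many cells. One more step before reaches the cells from anywhere, and one more after
  spreads the mass over \<open>E i0\<close>: these are the two extra steps.\<close>

lemma doeblin:
  "\<exists>N \<beta> A. N > 0 \<and> \<beta> > 0 \<and> A \<in> sets M \<and> prob A > 0 \<and>
    (\<forall>f x. bm f \<longrightarrow> (\<forall>y. 0 \<le> f y) \<longrightarrow> \<beta> * (\<integral>y. indicator A y * f y \<partial>M) \<le> (T ^^ N) f x)"
proof -
  obtain i0 where i0: "i0 < n" "0 < prob (E i0)" using cell_exists by auto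
  define g where "g m = (T ^^ m) (indicator (E i0))" for m
  have bm0: "bm (indicator (E i0))" by (rule bm_indicator) simp
  have bmg: "bm (g m)" for m unfolding g_def by (rule bm_Tn[OF bm0])
  note [measurable] = bm_measurable[OF bmg]
  have g_nonneg: "0 \<le> g m x" for m x
    unfolding g_def by (rule Tn_bounds(1)[OF bm0, where u=1]) (auto simp: indicator_def)
  have gSuc: "g (Suc m) x = T (g m) x" for m x by (simp add: g_def)
  \<comment> \<open>Points from which \<open>E i0\<close> is reached. From outside \<open>R\<close>
    the chain cannot enter \<open>R\<close>, so its probability is 0 or 1, and it contains
    \<open>E i0\<close> through m = 0.\<close>
  define R where "R = {x. \<exists>m. 0 < g m x}"
  have "{x \<in> space M. \<exists>m. 0 < g m x} \<in> sets M" by measurable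
  then have R: "R \<in> sets M" unfolding R_def by simp
  have "prob R = 0 \<or> prob R = 1"
  proof (rule irreducible[OF R])
    fix x assume x: "x \<notin> R"
    have "AE y in M. k x y * g m y = 0" for m
    proof -
      have "g (Suc m) x = 0" using x g_nonneg[of "Suc m" x] by (auto simp: R_def not_less intro: antisym)
      then have "(\<integral>y. k x y * g m y \<partial>M) = 0" unfolding gSuc T_def .
      then show ?thesis
        using integral_nonneg_eq_0_iff_AE[OF bm_k_integrable[OF bmg[of m], of x]] k_nonneg g_nonneg
        by auto
    qed
    then have "AE y in M. \<forall>m. k x y * g m y = 0" unfolding AE_all_countable by blast
    then show "AE y in M. y \<in> R \<longrightarrow> k x y = 0" by eventually_elim (auto simp: R_def)
  qed
  moreover have "prob (E i0) \<le> prob R"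
    by (rule finite_measure_mono) (auto simp: R_def g_def intro!: exI[of _ 0] R[unfolded R_def g_def])
  ultimately have R1: "prob R = 1" using i0 by auto
  define I where "I = {i. i < n \<and> 0 < prob (E i)}"
  have "eventually (\<lambda>m. \<exists>\<delta>>0. \<forall>x\<in>E i. \<delta> \<le> g m x) sequentially" if i: "i \<in> I" for i
  proof -
    have "\<exists>m. (\<integral>y. indicator (E i) y * g m y \<partial>M) \<noteq> 0"
    proof (rule ccontr)
      assume "\<not> ?thesis"
      then have "AE y in M. indicator (E i) y * g m y = 0" for m
        using integral_nonneg_eq_0_iff_AE[OF bm_integrable_ind[OF bmg[of m], of "E i"]] g_nonneg by auto
      then have "AE y in M. \<forall>m. indicator (E i) y * g m y = 0" unfolding AE_all_countable by blast
      moreover have "AE y in M. y \<in> R" using R1 R by (simp add: prob_eq_1)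
      ultimately have "AE y in M. y \<notin> E i" by eventually_elim (auto simp: R_def)
      then have "prob (E i) = 0" by (simp add: prob_eq_0)
      then show False using i by (simp add: I_def)
    qed
    then obtain m where m: "(\<integral>y. indicator (E i) y * g m y \<partial>M) \<noteq> 0" by auto
    have m': "(\<integral>y. indicator (E i) y * g m y \<partial>M) > 0"
      using m g_nonneg by (intro order_le_neq_trans integral_nonneg_AE) auto
    \<comment> \<open>A positive mean of \<open>g m\<close> over the cell yields a pointwise bound
      on the cell one step later, and waiting in the cell renews it at every further time, with a
      smaller constant. This is what makes a common time available.\<close>
    have "\<exists>\<delta>>0. \<forall>x\<in>E i. \<delta> \<le> g m' x" if "Suc m \<le> m'" for m'
      using that
    proof (induction rule: dec_induct)
      case base
      show ?case
        using T_ge_on_cell[OF _ _ bmg g_nonneg, of i _ m] i m' \<gamma>(1) unfolding gSuc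
        by (intro exI[of _ "\<gamma> * (\<integral>y. indicator (E i) y * g m y \<partial>M)"]) (auto simp: I_def)
    next
      case (step m')
      then obtain \<delta> where \<delta>: "\<delta> > 0" "\<forall>x\<in>E i. \<delta> \<le> g m' x" by auto
      have "\<delta> * prob (E i) = (\<integral>y. indicator (E i) y * \<delta> \<partial>M)" by simp
      also have "\<dots> \<le> (\<integral>y. indicator (E i) y * g m' y \<partial>M)"
        using \<delta> by (intro integral_mono bm_integrable_ind bmg bm_const) (auto simp: indicator_def)
      finally have "\<gamma> * (\<delta> * prob (E i)) \<le> \<gamma> * (\<integral>y. indicator (E i) y * g m' y \<partial>M)"
        using \<gamma>(1) by simp
      then have "\<forall>x\<in>E i. \<gamma> * (\<delta> * prob (E i)) \<le> g (Suc m') x"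
        using T_ge_on_cell[OF _ _ bmg g_nonneg, of i _ m'] i unfolding gSuc I_def
        by (auto intro: order_trans)
      moreover have "0 < \<gamma> * (\<delta> * prob (E i))" using \<gamma>(1) \<delta>(1) i by (simp add: I_def)
      ultimately show ?case by blast
    qed
    then show ?thesis by (auto simp: eventually_sequentially)
  qed
  moreover have finI: "finite I" unfolding I_def by auto
  ultimately have "eventually (\<lambda>m. \<forall>i\<in>I. \<exists>\<delta>>0. \<forall>x\<in>E i. \<delta> \<le> g m x) sequentially"
    by (intro eventually_ball_finite) auto
  then obtain m where "\<forall>i\<in>I. \<exists>\<delta>>0. \<forall>x\<in>E i. \<delta> \<le> g m x"
    by (auto simp: eventually_sequentially)
  then obtain \<delta>' where \<delta>': "\<And>i. i \<in> I \<Longrightarrow> 0 < \<delta>' i" "\<And>i x. i \<in> I \<Longrightarrow> x \<in> E i \<Longrightarrow> \<delta>' i \<le> g m x"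
    by metis
  define \<delta> where "\<delta> = Min (insert 1 (\<delta>' ` I))"
  have \<delta>: "\<delta> > 0" "\<And>i x. i \<in> I \<Longrightarrow> x \<in> E i \<Longrightarrow> \<delta> \<le> g m x"
  proof -
    show "\<delta> > 0" unfolding \<delta>_def using finI \<delta>'(1) by (subst Min_gr_iff) auto
    show "\<delta> \<le> g m x" if "i \<in> I" "x \<in> E i" for i x
    proof -
      have "\<delta> \<le> \<delta>' i" unfolding \<delta>_def using finI that by (intro Min_le) auto
      then show ?thesis using \<delta>'(2)[OF that] by linarith
    qed
  qed
  define U where "U = (\<Union>i\<in>I. E i)"
  have U[measurable]: "U \<in> sets M" unfolding U_def using finI by auto
  have "prob (UNIV - U) \<le> 1 / (2 * K)"
  proof -
    have "AE y in M. y \<notin> E i" if "i < n" "i \<notin> I" for i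
    proof -
      have "prob (E i) = 0" using that unfolding I_def by (auto simp: not_less intro: antisym)
      then show ?thesis by (simp add: prob_eq_0)
    qed
    then have "AE y in M. \<forall>i\<in>{..<n}. i \<notin> I \<longrightarrow> y \<notin> E i" by (auto intro!: AE_finite_allI)
    then have "prob (UNIV - U) \<le> prob (UNIV - (\<Union>i<n. E i))"
    proof (intro finite_measure_mono_AE)
      show "UNIV - (\<Union>i<n. E i) \<in> events" using sets.compl_sets[of "\<Union>i<n. E i" M] by auto
      assume "AE y in M. \<forall>i\<in>{..<n}. i \<notin> I \<longrightarrow> y \<notin> E i"
      then show "AE y in M. y \<in> UNIV - U \<longrightarrow> y \<in> UNIV - (\<Union>i<n. E i)"
        by eventually_elim (auto simp: U_def)
    qed
    with rest show ?thesis by linarith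
  qed
  then have UK: "K * prob (UNIV - U) \<le> 1 / 2" using K_ge_1 by (simp add: field_simps)
  \<comment> \<open>From any x the kernel puts mass at least 1/2 on the charged cells, where
    \<open>g m\<close> is at least \<delta>.\<close>
  have low: "\<delta> / 2 \<le> g (Suc m) x" for x
  proof -
    have "(\<integral>y. indicator (UNIV - U) y * k x y \<partial>M) \<le> (\<integral>y. indicator (UNIV - U) y * K \<partial>M)"
      using sets.compl_sets[OF U] k_le k_nonneg
      by (intro integral_mono Bochner_Integration.integrable_bound[OF k_integrable[of x]] bm_integrable_ind bm_const)
         (auto simp: indicator_def)
    also have "\<dots> = K * prob (UNIV - U)" using sets.compl_sets[OF U] by simp
    finally have "(\<integral>y. indicator (UNIV - U) y * k x y \<partial>M) \<le> 1 / 2" using UK by simp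
    moreover have "(\<integral>y. indicator U y * k x y \<partial>M) + (\<integral>y. indicator (UNIV - U) y * k x y \<partial>M) = (\<integral>y. k x y \<partial>M)"
      using sets.compl_sets[OF U]
      by (subst Bochner_Integration.integral_add[symmetric])
         (auto simp: indicator_def intro!: Bochner_Integration.integral_cong Bochner_Integration.integrable_bound[OF k_integrable[of x]])
    ultimately have "1 / 2 \<le> (\<integral>y. indicator U y * k x y \<partial>M)" using k_mass[of x] by linarith
    then have "\<delta> / 2 \<le> (\<integral>y. \<delta> * (indicator U y * k x y) \<partial>M)" using \<delta>(1) by simp
    also have "\<dots> \<le> T (g m) x"
      unfolding T_def
    proof (rule integral_mono)
      show "integrable M (\<lambda>y. \<delta> * (indicator U y * k x y))"
        by (intro integrable_mult_right Bochner_Integration.integrable_bound[OF k_integrable[of x]])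
           (auto simp: indicator_def)
      show "\<delta> * (indicator U y * k x y) \<le> k x y * g m y" for y
        using \<delta>(2) k_nonneg[of x y] g_nonneg[of m y]
        by (auto simp: indicator_def U_def mult.commute[of "k x y"] intro!: mult_right_mono)
    qed (rule bm_k_integrable[OF bmg])
    finally show ?thesis unfolding gSuc .
  qed
  have "\<gamma> * \<delta> / 2 * (\<integral>y. indicator (E i0) y * f y \<partial>M) \<le> (T ^^ Suc (Suc m)) f x"
    if f: "bm f" "\<And>y. 0 \<le> f y" for f x
  proof -
    let ?J = "\<integral>y. indicator (E i0) y * f y \<partial>M"
    have J: "0 \<le> ?J" using f by (intro integral_nonneg_AE) auto
    have "\<gamma> * \<delta> / 2 * ?J = (\<gamma> * ?J) * (\<delta> / 2)" by simp
    also have "\<dots> \<le> (\<gamma> * ?J) * g (Suc m) x"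
      using \<gamma>(1) J by (intro mult_left_mono low) auto
    also have "\<dots> = (T ^^ Suc m) (\<lambda>x. (\<gamma> * ?J) * indicator (E i0) x) x"
      unfolding Tn_cmult g_def ..
    \<comment> \<open>The bound inside a cell is used on f first, as a multiple of the indicator of
      \<open>E i0\<close> below T f, and is then propagated by the iterates.\<close>
    also have "\<dots> \<le> (T ^^ Suc m) (T f) x"
    proof (rule Tn_mono)
      show "\<gamma> * ?J * indicator (E i0) y \<le> T f y" for y
        using T_ge_on_cell[OF i0(1) _ f, of y] T_bounds(1)[OF f(1), of 0] f
        by (cases "y \<in> E i0") (auto simp: T_def intro!: integral_nonneg_AE mult_nonneg_nonneg k_nonneg)
    qed (intro bm_cmult bm0 bm_T f)+
    finally show ?thesis by (simp add: funpow_swap1)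
  qed
  then show ?thesis
    using i0 \<gamma>(1) \<delta>(1)
    by (intro exI[of _ "Suc (Suc m)"] exI[of _ "\<gamma> * \<delta> / 2"] exI[of _ "E i0"]) auto
qed

text \<open>The solution is the Neumann series of the iterates of T on \<epsilon>. Doeblin's
  condition contracts the oscillation by a factor \<rho> every N steps, and a function of mean zero
  is bounded by its oscillation, so the series converges in sup norm with a constant independent of
  \<epsilon>.\<close>

theorem poisson_equation:
  "\<exists>C\<ge>0. \<forall>\<epsilon> e. \<epsilon> \<in> borel_measurable M \<longrightarrow> (\<forall>x. \<bar>\<epsilon> x\<bar> \<le> e) \<longrightarrow> (\<integral>x. \<epsilon> x \<partial>M) = 0 \<longrightarrow>
    (\<exists>\<alpha>\<in>borel_measurable M. (\<forall>x. \<bar>\<alpha> x\<bar> \<le> C * e) \<and> (\<forall>x. \<alpha> x - T \<alpha> x = \<epsilon> x))"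
proof -
  obtain N \<beta> A where N: "N > 0" and \<beta>: "\<beta> > 0" and A: "A \<in> sets M" "prob A > 0"
    and doeb: "\<And>f x. bm f \<Longrightarrow> (\<And>y. 0 \<le> f y) \<Longrightarrow> \<beta> * (\<integral>y. indicator A y * f y \<partial>M) \<le> (T ^^ N) f x"
    using doeblin by blast
  define \<rho> where "\<rho> = 1 - \<beta> * prob A"
  \<comment> \<open>Tested on the constant 1, the minorisation shows that \<beta> prob A is at most
    1.\<close>
  have "\<beta> * (\<integral>y. indicator A y * 1 \<partial>M) \<le> (T ^^ N) (\<lambda>_. 1) undefined"
    by (rule doeb) (auto intro: bm_const)
  then have \<rho>: "0 \<le> \<rho>" "\<rho> < 1" using A \<beta> by (auto simp: \<rho>_def Tn_const)
  \<comment> \<open>The minorisation is applied to the nonnegative functions f - l and u - f; the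
    two improvements add up to \<beta> prob A (u - l), whatever the mean of f over A.\<close>
  have contract: "\<exists>l' u'. (\<forall>x. l' \<le> (T ^^ N) f x \<and> (T ^^ N) f x \<le> u') \<and> u' - l' = \<rho> * (u - l)"
    if f: "bm f" "\<And>x. l \<le> f x" "\<And>x. f x \<le> u" for f l u
  proof -
    let ?J = "\<integral>y. indicator A y * f y \<partial>M"
    have iA: "integrable M (indicator A :: _ \<Rightarrow> real)" using bm_integrable[OF bm_indicator[OF A(1)]] .
    have i1: "(\<integral>y. indicator A y * (f y - l) \<partial>M) = ?J - l * prob A"
      unfolding right_diff_distrib using A
      by (subst Bochner_Integration.integral_diff) (auto intro: bm_integrable_ind[OF f(1)] simp: mult.commute[of _ l] iA)
    have i2: "(\<integral>y. indicator A y * (u - f y) \<partial>M) = u * prob A - ?J"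
      unfolding right_diff_distrib using A
      by (subst Bochner_Integration.integral_diff) (auto intro: bm_integrable_ind[OF f(1)] simp: mult.commute[of _ u] iA)
    have 1: "l + \<beta> * (?J - l * prob A) \<le> (T ^^ N) f x" for x
      using doeb[OF bm_diff[OF f(1) bm_const[of l]], of x] f(2) Tn_diff[OF f(1) bm_const[of l], of N]
      unfolding i1 by (simp add: Tn_const)
    have 2: "(T ^^ N) f x \<le> u - \<beta> * (u * prob A - ?J)" for x
      using doeb[OF bm_diff[OF bm_const[of u] f(1)], of x] f(3) Tn_diff[OF bm_const[of u] f(1), of N]
      unfolding i2 by (simp add: Tn_const)
    show ?thesis
      by (rule exI[of _ "l + \<beta> * (?J - l * prob A)"], rule exI[of _ "u - \<beta> * (u * prob A - ?J)"])
         (use 1 2 in \<open>auto simp: \<rho>_def algebra_simps\<close>)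
  qed
  have iter: "\<exists>l' u'. (\<forall>x. l' \<le> (T ^^ (j * N)) f x \<and> (T ^^ (j * N)) f x \<le> u') \<and> u' - l' = \<rho> ^ j * (u - l)"
    if f: "bm f" "\<And>x. l \<le> f x" "\<And>x. f x \<le> u" for f l u j
  proof (induction j)
    case 0
    then show ?case using f by (intro exI[of _ l] exI[of _ u]) auto
  next
    case (Suc j)
    then obtain l1 u1 where "\<forall>x. l1 \<le> (T ^^ (j * N)) f x \<and> (T ^^ (j * N)) f x \<le> u1" and *: "u1 - l1 = \<rho> ^ j * (u - l)"
      by auto
    then obtain l2 u2 where "\<forall>x. l2 \<le> (T ^^ N) ((T ^^ (j * N)) f) x \<and> (T ^^ N) ((T ^^ (j * N)) f) x \<le> u2" "u2 - l2 = \<rho> * (u1 - l1)"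
      using contract[OF bm_Tn[OF f(1), of "j * N"], of l1 u1] by auto
    then show ?case using * by (intro exI[of _ l2] exI[of _ u2]) (auto simp: funpow_add)
  qed
  \<comment> \<open>The oscillation does not grow within a block of N steps, so only complete blocks
    are counted.\<close>
  define c where "c m = \<rho> ^ (m div N)" for m
  have c_nonneg: "0 \<le> c m" for m using \<rho> by (simp add: c_def)
  have c_sum: "summable c"
  proof (rule summableI_nonneg_bounded[OF c_nonneg])
    fix m
    have "sum c {..<m} \<le> sum c {..<m * N}"
      using N c_nonneg by (intro sum_mono2) auto
    also have "\<dots> = (\<Sum>j<m. sum c {j * N..<j * N + N})" by (rule sum.nat_group[symmetric])
    also have "\<dots> = (\<Sum>j<m. real N * \<rho> ^ j)"
    proof (rule sum.cong[OF refl])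
      fix j
      have "c i = \<rho> ^ j" if "i \<in> {j * N..<j * N + N}" for i
      proof -
        have "i div N = j" using that N by (auto intro!: div_nat_eqI simp: mult.commute)
        then show ?thesis by (simp add: c_def)
      qed
      then show "sum c {j * N..<j * N + N} = real N * \<rho> ^ j" by simp
    qed
    also have "\<dots> = real N * (\<Sum>j<m. \<rho> ^ j)" by (simp add: sum_distrib_left)
    also have "\<dots> \<le> real N * (\<Sum>j. \<rho> ^ j)"
      using \<rho> by (intro mult_left_mono sum_le_suminf summable_geometric) auto
    finally show "sum c {..<m} \<le> real N * (\<Sum>j. \<rho> ^ j)" .
  qed
  define C where "C = 2 * suminf c"
  have "\<exists>\<alpha>\<in>borel_measurable M. (\<forall>x. \<bar>\<alpha> x\<bar> \<le> C * e) \<and> (\<forall>x. \<alpha> x - T \<alpha> x = \<epsilon> x)"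
    if \<epsilon>: "\<epsilon> \<in> borel_measurable M" "\<forall>x. \<bar>\<epsilon> x\<bar> \<le> e" "(\<integral>x. \<epsilon> x \<partial>M) = 0" for \<epsilon> e
  proof -
    have bme: "bm \<epsilon>" using \<epsilon> by (auto simp: bm_def)
    have e: "0 \<le> e" using \<epsilon>(2) abs_ge_zero order_trans by blast
    have bounds: "\<And>x. -e \<le> \<epsilon> x" "\<And>x. \<epsilon> x \<le> e" using \<epsilon>(2) by (auto simp: abs_le_iff minus_le_iff)
    note bmT = bm_Tn[OF bme]
    note [measurable] = bm_measurable[OF bmT]
    have dec: "\<bar>(T ^^ m) \<epsilon> x\<bar> \<le> c m * (2 * e)" for m x
    proof -
      define j i where "j = m div N" and "i = m mod N"
      have m: "m = i + j * N" unfolding i_def j_def by simp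
      obtain l u where lu: "\<And>x. l \<le> (T ^^ (j * N)) \<epsilon> x" "\<And>x. (T ^^ (j * N)) \<epsilon> x \<le> u"
        and ul: "u - l = \<rho> ^ j * (e - - e)" using iter[OF bme bounds, of j] by auto
      have *: "l \<le> (T ^^ m) \<epsilon> x" "(T ^^ m) \<epsilon> x \<le> u" for x
        unfolding m funpow_add o_def using Tn_bounds[OF bmT lu] by auto
      \<comment> \<open>Invariance keeps the mean of the iterate at zero, so 0 lies between l and u
        and the oscillation bounds the absolute value.\<close>
      have "(\<integral>x. l \<partial>M) \<le> (\<integral>x. (T ^^ m) \<epsilon> x \<partial>M)" "(\<integral>x. (T ^^ m) \<epsilon> x \<partial>M) \<le> (\<integral>x. u \<partial>M)"
        using * by (intro integral_mono bm_integrable[OF bmT] bm_integrable[OF bm_const]; simp)+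
      then have "l \<le> 0" "0 \<le> u"
        unfolding Tn_integral[OF bme] \<epsilon>(3) using prob_space by auto
      with *[of x] have "\<bar>(T ^^ m) \<epsilon> x\<bar> \<le> u - l" by auto
      then show ?thesis unfolding ul by (simp add: c_def j_def)
    qed
    have sumc: "summable (\<lambda>m. c m * (2 * e))" by (intro summable_mult2 c_sum)
    have summ: "summable (\<lambda>m. (T ^^ m) \<epsilon> x)" for x
      by (rule summable_comparison_test'[OF sumc]) (use dec in auto)
    define \<alpha> where "\<alpha> x = (\<Sum>m. (T ^^ m) \<epsilon> x)" for x
    have [measurable]: "\<alpha> \<in> borel_measurable M" unfolding \<alpha>_def[abs_def] by measurable
    have bound: "\<bar>\<alpha> x\<bar> \<le> C * e" for x
    proof -
      have "norm (\<alpha> x) \<le> (\<Sum>m. c m * (2 * e))"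
        unfolding \<alpha>_def by (rule norm_suminf_le[OF _ sumc]) (use dec in auto)
      also have "\<dots> = suminf c * (2 * e)" by (rule suminf_mult2[OF c_sum, symmetric])
      finally show ?thesis by (simp add: C_def)
    qed
    have "\<alpha> x - T \<alpha> x = \<epsilon> x" for x
    proof -
      have dec': "\<bar>k x y * (T ^^ m) \<epsilon> y\<bar> \<le> K * (c m * (2 * e))" for m y
        unfolding abs_mult using dec k_le k_nonneg K_ge_1 by (intro mult_mono) auto
      have sK: "summable (\<lambda>m. K * (c m * (2 * e)))" by (intro summable_mult sumc)
      have "T \<alpha> x = (\<integral>y. (\<Sum>m. k x y * (T ^^ m) \<epsilon> y) \<partial>M)"
        unfolding T_def[of \<alpha>] \<alpha>_def by (simp add: suminf_mult[OF summ])
      also have "\<dots> = (\<Sum>m. \<integral>y. k x y * (T ^^ m) \<epsilon> y \<partial>M)"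
      proof (rule integral_suminf)
        show "AE y in M. summable (\<lambda>m. norm (k x y * (T ^^ m) \<epsilon> y))"
          by (intro AE_I2 summable_comparison_test'[OF sK]) (use dec' in auto)
        have "norm (\<integral>y. norm (k x y * (T ^^ m) \<epsilon> y) \<partial>M) \<le> K * (c m * (2 * e))" for m
        proof -
          have "(\<integral>y. norm (k x y * (T ^^ m) \<epsilon> y) \<partial>M) \<le> (\<integral>y. K * (c m * (2 * e)) \<partial>M)"
            using dec' by (intro integral_mono integrable_norm bm_k_integrable bmT) auto
          then show ?thesis using prob_space by simp
        qed
        then show "summable (\<lambda>m. \<integral>y. norm (k x y * (T ^^ m) \<epsilon> y) \<partial>M)"
          by (intro summable_comparison_test'[OF sK]) auto
      qed (rule bm_k_integrable[OF bmT])
      also have "\<dots> = (\<Sum>m. (T ^^ Suc m) \<epsilon> x)"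
        by (rule suminf_cong) (simp add: T_def[of "(T ^^ _) \<epsilon>" x])
      also have "\<dots> = \<alpha> x - \<epsilon> x" unfolding \<alpha>_def using suminf_split_head[OF summ[of x]] by simp
      finally show ?thesis by simp
    qed
    with bound show ?thesis by (intro bexI[of _ \<alpha>]) auto
  qed
  moreover have "0 \<le> C" using suminf_nonneg[OF c_sum c_nonneg] by (simp add: C_def)
  ultimately show ?thesis by blast
qed

end

subsection \<open>Quantile couplings\<close>

text \<open>The uniform law on (0, 1), taken as a measure on the whole line so that its product with
  a law on the line lives on pairs of reals.\<close>

definition unit_law :: "real measure" where
  "unit_law = density lborel (indicator {0<..<1})"

lemma sets_unit_law[simp, measurable_cong]: "sets unit_law = sets borel"
  by (simp add: unit_law_def)

lemma space_unit_law[simp]: "space unit_law = UNIV"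
  by (simp add: unit_law_def)

lemma nn_integral_unit_law:
  "f \<in> borel_measurable borel \<Longrightarrow> (\<integral>\<^sup>+ u. f u \<partial>unit_law) = (\<integral>\<^sup>+ u. indicator {0<..<1} u * f u \<partial>lborel)"
  unfolding unit_law_def by (subst nn_integral_density) auto

lemma prob_space_unit_law: "prob_space unit_law"
proof
  have "emeasure unit_law (space unit_law) = (\<integral>\<^sup>+ u. indicator {0<..<1::real} u \<partial>lborel)"
    unfolding unit_law_def by (subst emeasure_density) (auto intro!: nn_integral_cong)
  then show "emeasure unit_law (space unit_law) = 1" by simp
qed

interpretation unit_law: prob_space unit_law
  by (rule prob_space_unit_law)

lemma AE_unit_law: "AE u in unit_law. 0 < u \<and> u < 1"
  unfolding unit_law_def by (subst AE_density) (auto simp: indicator_def)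

text \<open>A kernel of probability laws encoded by distribution functions. The interval [a, b] is
  common to all x, which makes quantiles uniformly bounded and means finite.\<close>

definition cdf_family :: "real \<Rightarrow> real \<Rightarrow> (real \<times> real \<Rightarrow> real) \<Rightarrow> bool" where
  "cdf_family a b G \<longleftrightarrow> a \<le> b \<and> G \<in> borel_measurable (borel \<Otimes>\<^sub>M borel) \<and> (\<forall>x. mono (\<lambda>t. G (x, t))) \<and>
    (\<forall>x t. continuous (at_right t) (\<lambda>t. G (x, t))) \<and>
    (\<forall>x t. t < a \<longrightarrow> G (x, t) = 0) \<and> (\<forall>x t. b \<le> t \<longrightarrow> G (x, t) = 1)"

text \<open>Outside (0, 1), which \<open>unit_law\<close> does not charge, the value is a mere
  default; inside, right continuity lets the infimum be attained.\<close>

definition quantile :: "(real \<times> real \<Rightarrow> real) \<Rightarrow> real \<Rightarrow> real \<Rightarrow> real" where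
  "quantile G x u = (if 0 < u \<and> u < 1 then Inf {t. u \<le> G (x, t)} else 0)"

lemma cdf_family_range:
  assumes "cdf_family a b G"
  shows "0 \<le> G (x, t)" "G (x, t) \<le> 1"
proof -
  have m: "mono (\<lambda>t. G (x, t))" and l: "G (x, min t (a - 1)) = 0" and r: "G (x, max t b) = 1"
    using assms unfolding cdf_family_def by auto
  show "0 \<le> G (x, t)" using monoD[OF m, of "min t (a - 1)" t] l by simp
  show "G (x, t) \<le> 1" using monoD[OF m, of t "max t b"] r by simp
qed

lemma quantile_le_iff:
  assumes "cdf_family a b G" "0 < u" "u < 1"
  shows "quantile G x u \<le> t \<longleftrightarrow> u \<le> G (x, t)"
proof -
  have "right_continuous_mono (\<lambda>t. G (x, t)) 0 1"
  proof
    show "continuous (at_right t) (\<lambda>t. G (x, t))" "mono (\<lambda>t. G (x, t))" for t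
      using assms(1) unfolding cdf_family_def by auto
    show "((\<lambda>t. G (x, t)) \<longlongrightarrow> 0) at_bot"
      by (rule tendsto_eventually)
         (use assms(1) in \<open>auto simp: cdf_family_def eventually_at_bot_dense intro!: exI[of _ a]\<close>)
    show "((\<lambda>t. G (x, t)) \<longlongrightarrow> 1) at_top"
      by (rule tendsto_eventually)
         (use assms(1) in \<open>auto simp: cdf_family_def eventually_at_top_linorder intro!: exI[of _ b]\<close>)
  qed
  from right_continuous_mono.pseudoinverse[OF this assms(2,3), of t] show ?thesis
    using assms(2,3) by (simp add: quantile_def)
qed

lemma quantile_range:
  assumes "cdf_family a b G" "0 < u" "u < 1"
  shows "a \<le> quantile G x u" "quantile G x u \<le> b"
proof -
  have "\<not> quantile G x u \<le> t" if "t < a" for t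
    using assms that unfolding quantile_le_iff[OF assms] by (auto simp: cdf_family_def)
  then show "a \<le> quantile G x u" by (meson le_less_linear order_refl)
  show "quantile G x u \<le> b"
    using assms unfolding quantile_le_iff[OF assms] by (auto simp: cdf_family_def)
qed

text \<open>By \<open>quantile_le_iff\<close> a sublevel set of the quantile involves G at one fixed
  t only, whence measurability jointly in x and u.\<close>

lemma quantile_measurable[measurable]:
  assumes G: "cdf_family a b G"
  shows "(\<lambda>z. quantile G (fst z) (snd z)) \<in> borel_measurable (borel \<Otimes>\<^sub>M borel)"
  unfolding borel_measurable_iff_le
proof
  fix t
  have [measurable]: "G \<in> borel_measurable (borel \<Otimes>\<^sub>M borel)" using G by (simp add: cdf_family_def)
  have "{z \<in> space (borel \<Otimes>\<^sub>M borel). quantile G (fst z) (snd z) \<le> t}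
    = {z \<in> space (borel \<Otimes>\<^sub>M borel). if 0 < snd z \<and> snd z < 1 then snd z \<le> G (fst z, t) else 0 \<le> t}"
    using quantile_le_iff[OF G] by (auto simp: quantile_def)
  also have "\<dots> \<in> sets (borel \<Otimes>\<^sub>M borel)" by measurable
  finally show "{z \<in> space (borel \<Otimes>\<^sub>M borel). quantile G (fst z) (snd z) \<le> t} \<in> sets (borel \<Otimes>\<^sub>M borel)" .
qed

lemma quantile_measurable2:
  "cdf_family a b G \<Longrightarrow> quantile G x \<in> borel_measurable borel"
  using measurable_compose[OF _ quantile_measurable, of "\<lambda>u. (x, u)" borel a b G] by simp

text \<open>The region of pairs (u, t) between the two quantile functions is, up to a null set, the
  region between the two distribution functions; its area is computed in both orders.\<close>

lemma quantile_L1: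
  assumes G: "cdf_family a b G" and G': "cdf_family a' b' G'"
  shows "(\<integral>\<^sup>+ u. ennreal \<bar>quantile G x u - quantile G' x u\<bar> \<partial>unit_law)
    = (\<integral>\<^sup>+ t. ennreal \<bar>G (x, t) - G' (x, t)\<bar> \<partial>lborel)"
proof -
  note [measurable] = quantile_measurable2[OF G] quantile_measurable2[OF G']
  let ?q = "quantile G x" and ?q' = "quantile G' x"
  have "(\<integral>\<^sup>+ u. ennreal \<bar>?q u - ?q' u\<bar> \<partial>unit_law)
    = (\<integral>\<^sup>+ u. indicator {0<..<1} u * ennreal \<bar>?q u - ?q' u\<bar> \<partial>lborel)"
    by (rule nn_integral_unit_law) measurable
  also have "\<dots> = (\<integral>\<^sup>+ u. \<integral>\<^sup>+ t. indicator {0<..<1} u * indicator {min (?q u) (?q' u)..<max (?q u) (?q' u)} t \<partial>lborel \<partial>lborel)"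
    by (intro nn_integral_cong, subst nn_integral_cmult)
       (auto intro!: arg_cong2[where f="(*)"] arg_cong[where f=ennreal])
  also have "\<dots> = (\<integral>\<^sup>+ u. \<integral>\<^sup>+ t. (if 0 < u \<and> u < 1 \<and> min (?q u) (?q' u) \<le> t \<and> t < max (?q u) (?q' u) then 1 else 0) \<partial>lborel \<partial>lborel)"
    by (intro nn_integral_cong) (auto simp: indicator_def)
  also have "\<dots> = (\<integral>\<^sup>+ t. \<integral>\<^sup>+ u. (if 0 < u \<and> u < 1 \<and> min (?q u) (?q' u) \<le> t \<and> t < max (?q u) (?q' u) then 1 else 0) \<partial>lborel \<partial>lborel)"
    by (rule lborel_pair.Fubini') measurable
  also have "\<dots> = (\<integral>\<^sup>+ t. ennreal \<bar>G (x, t) - G' (x, t)\<bar> \<partial>lborel)"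
  proof (rule nn_integral_cong)
    fix t
    let ?g = "G (x, t)" and ?g' = "G' (x, t)"
    have *: "0 < u \<and> u < 1 \<and> min (?q u) (?q' u) \<le> t \<and> t < max (?q u) (?q' u)
        \<longleftrightarrow> 0 < u \<and> u < 1 \<and> u \<in> {min ?g ?g'<..max ?g ?g'}" for u
      using quantile_le_iff[OF G, of u x t] quantile_le_iff[OF G', of u x t]
      by (auto simp: min_def max_def)
    have "(\<integral>\<^sup>+ u. (if 0 < u \<and> u < 1 \<and> min (?q u) (?q' u) \<le> t \<and> t < max (?q u) (?q' u) then 1 else 0) \<partial>lborel)
      = (\<integral>\<^sup>+ u. indicator {min ?g ?g'<..max ?g ?g'} u \<partial>lborel)"
    proof (rule nn_integral_cong_AE)
      show "AE u in lborel. (if 0 < u \<and> u < 1 \<and> min (?q u) (?q' u) \<le> t \<and> t < max (?q u) (?q' u) then 1 else 0)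
        = (indicator {min ?g ?g'<..max ?g ?g'} u :: ennreal)"
        \<comment> \<open>The point u = 1 lies in the interval on the right if exactly one of the
          distribution functions equals 1 at t, but never in (0, 1).\<close>
        using AE_lborel_singleton[of 1]
      proof eventually_elim
        case (elim u)
        have "u \<in> {min ?g ?g'<..max ?g ?g'} \<Longrightarrow> 0 < u \<and> u < 1"
          using cdf_family_range[OF G, of x t] cdf_family_range[OF G', of x t] elim by auto
        then show ?case unfolding * by (auto simp: indicator_def)
      qed
    qed
    also have "\<dots> = ennreal \<bar>?g - ?g'\<bar>" by (auto intro!: arg_cong[where f=ennreal])
    finally show "(\<integral>\<^sup>+ u. (if 0 < u \<and> u < 1 \<and> min (?q u) (?q' u) \<le> t \<and> t < max (?q u) (?q' u) then 1 else 0) \<partial>lborel)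
      = ennreal \<bar>?g - ?g'\<bar>" .
  qed
  finally show ?thesis .
qed

text \<open>The Dirac mass at b. Every law on [a, b] lies to its left, so the L^1 distance to it is
  b minus the mean: areas under distribution functions thereby determine means.\<close>

lemma cdf_family_point: "cdf_family b b (\<lambda>z. if b \<le> snd z then 1 else 0)"
  unfolding cdf_family_def
proof (intro conjI allI)
  fix t :: real
  have "eventually (\<lambda>s. (if b \<le> t then 1 else 0::real) = (if b \<le> s then 1 else 0)) (at_right t)"
  proof (cases "b \<le> t")
    case True
    then show ?thesis using eventually_at_right_less[of t] by (auto elim: eventually_mono)
  next
    case False
    then show ?thesis using eventually_at_right_real[of t b] by (auto elim: eventually_mono)
  qed
  then show "continuous (at_right t) (\<lambda>t. if b \<le> snd (x, t) then 1 else 0 :: real)" for x :: real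
    unfolding continuous_within by (auto intro: tendsto_eventually elim: eventually_mono)
qed (auto intro!: monoI)

lemma quantile_mean:
  assumes G: "cdf_family a b G"
  shows "(\<integral>\<^sup>+ u. ennreal (b - quantile G x u) \<partial>unit_law) = (\<integral>\<^sup>+ t. ennreal (indicator {a..b} t * G (x, t)) \<partial>lborel)"
proof -
  let ?P = "\<lambda>z. if b \<le> snd z then 1 else 0 :: real"
  have qP: "quantile ?P x u = b" if "0 < u" "u < 1" for u
  proof -
    have "{t. u \<le> ?P (x, t)} = {b..}" using that by auto
    then show ?thesis using that by (simp add: quantile_def)
  qed
  have "(\<integral>\<^sup>+ u. ennreal (b - quantile G x u) \<partial>unit_law) = (\<integral>\<^sup>+ u. ennreal \<bar>quantile G x u - quantile ?P x u\<bar> \<partial>unit_law)"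
  proof (rule nn_integral_cong_AE)
    show "AE u in unit_law. ennreal (b - quantile G x u) = ennreal \<bar>quantile G x u - quantile ?P x u\<bar>"
      using AE_unit_law by eventually_elim (use qP quantile_range[OF G] in auto)
  qed
  also have "\<dots> = (\<integral>\<^sup>+ t. ennreal \<bar>G (x, t) - ?P (x, t)\<bar> \<partial>lborel)"
    by (rule quantile_L1[OF G cdf_family_point])
  also have "\<dots> = (\<integral>\<^sup>+ t. ennreal (indicator {a..b} t * G (x, t)) \<partial>lborel)"
  proof (rule nn_integral_cong_AE)
    show "AE t in lborel. ennreal \<bar>G (x, t) - ?P (x, t)\<bar> = ennreal (indicator {a..b} t * G (x, t))"
      using AE_lborel_singleton[of b]
    proof eventually_elim
      case (elim t)
      have "0 \<le> G (x, t)" "t < a \<Longrightarrow> G (x, t) = 0" "b \<le> t \<Longrightarrow> G (x, t) = 1"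
        using cdf_family_range[OF G] G by (auto simp: cdf_family_def)
      with elim show ?case by (auto simp: indicator_def)
    qed
  qed
  finally show ?thesis .
qed

text \<open>A horizontal shift by c between the two graphs, without any loss in height, bounds the
  quantiles uniformly in u. It supplies the bound O(r) on the displacements.\<close>

lemma quantile_near:
  assumes G: "cdf_family a b G" and G': "cdf_family a' b' G'"
    and "\<And>t. G (x, t) \<le> G' (x, t + c)" "\<And>t. G' (x, t) \<le> G (x, t + c)" "0 < u" "u < 1"
  shows "\<bar>quantile G x u - quantile G' x u\<bar> \<le> c"
proof -
  have "u \<le> G (x, quantile G x u)" "u \<le> G' (x, quantile G' x u)"
    using quantile_le_iff[OF G assms(5,6)] quantile_le_iff[OF G' assms(5,6)] by auto
  then have "u \<le> G' (x, quantile G x u + c)" "u \<le> G (x, quantile G' x u + c)"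
    using assms(3,4) order_trans by blast+
  then have "quantile G' x u \<le> quantile G x u + c" "quantile G x u \<le> quantile G' x u + c"
    using quantile_le_iff[OF G assms(5,6)] quantile_le_iff[OF G' assms(5,6)] by auto
  then show ?thesis by linarith
qed

section \<open>Laws on the plane with prescribed conditional distribution functions\<close>

context real_distr
begin

abbreviation "W \<equiv> \<mu>1 \<Otimes>\<^sub>M unit_law"

sublocale W: pair_prob_space \<mu>1 unit_law ..

definition qmap :: "(real \<times> real \<Rightarrow> real) \<Rightarrow> real \<times> real \<Rightarrow> real \<times> real" where
  "qmap G z = (fst z, quantile G (fst z) (snd z))"

text \<open>The law with first marginal \<open>\<mu>1\<close> whose second coordinate has, given x,
  the distribution function \<open>G (x, .)\<close>. All such laws are images of the same
  \<open>W\<close> with x kept, hence come already coupled.\<close>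

definition qlaw :: "(real \<times> real \<Rightarrow> real) \<Rightarrow> (real \<times> real) measure" where
  "qlaw G = distr W borel (qmap G)"

lemma qmap_measurable[measurable]:
  assumes G: "cdf_family a b G"
  shows "qmap G \<in> measurable W borel"
proof -
  note [measurable] = quantile_measurable[OF G]
  show ?thesis unfolding qmap_def[abs_def] borel_prod[symmetric] by measurable
qed

lemma sets_qlaw[simp]: "sets (qlaw G) = sets borel"
  by (simp add: qlaw_def)

lemma prob_space_qlaw: "cdf_family a b G \<Longrightarrow> prob_space (qlaw G)"
  unfolding qlaw_def by (intro W.P.prob_space_distr qmap_measurable)

lemma emeasure_unit_law_Iic:
  assumes "0 \<le> g" "g \<le> 1"
  shows "(\<integral>\<^sup>+ u. (if 0 < u \<and> u < 1 \<and> u \<le> g then 1 else 0) \<partial>unit_law) = ennreal g"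
proof -
  have "(\<integral>\<^sup>+ u. (if 0 < u \<and> u < 1 \<and> u \<le> g then 1 else 0) \<partial>unit_law) = (\<integral>\<^sup>+ u. indicator {0<..g} u \<partial>lborel)"
    by (subst nn_integral_unit_law, measurable, rule nn_integral_cong_AE)
       (use AE_lborel_singleton[of 1] assms in \<open>auto simp: indicator_def elim!: eventually_mono\<close>)
  then show ?thesis using assms by simp
qed

lemma emeasure_qlaw:
  assumes G: "cdf_family a b G" and B[measurable]: "B \<in> sets borel"
  shows "emeasure (qlaw G) (B \<times> {..t}) = (\<integral>\<^sup>+ x. indicator B x * ennreal (G (x, t)) \<partial>\<mu>1)"
proof -
  note [measurable] = qmap_measurable[OF G] quantile_measurable[OF G]
  have [measurable]: "B \<times> {..t} \<in> sets borel" unfolding borel_prod[symmetric] by measurable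
  have "emeasure (qlaw G) (B \<times> {..t}) = (\<integral>\<^sup>+ z. indicator (B \<times> {..t}) (qmap G z) \<partial>W)"
    unfolding qlaw_def by (subst nn_integral_indicator[symmetric], simp, subst nn_integral_distr) auto
  also have "\<dots> = (\<integral>\<^sup>+ z. (if fst z \<in> B \<and> quantile G (fst z) (snd z) \<le> t then 1 else 0) \<partial>W)"
    by (intro nn_integral_cong) (auto simp: qmap_def indicator_def)
  also have "\<dots> = (\<integral>\<^sup>+ x. \<integral>\<^sup>+ u. (if x \<in> B \<and> quantile G x u \<le> t then 1 else 0) \<partial>unit_law \<partial>\<mu>1)"
    by (subst unit_law.nn_integral_fst[symmetric]) auto
  also have "\<dots> = (\<integral>\<^sup>+ x. indicator B x * ennreal (G (x, t)) \<partial>\<mu>1)"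
  proof (rule nn_integral_cong)
    fix x
    have "(\<integral>\<^sup>+ u. (if x \<in> B \<and> quantile G x u \<le> t then 1 else 0) \<partial>unit_law)
      = (\<integral>\<^sup>+ u. indicator B x * (if 0 < u \<and> u < 1 \<and> u \<le> G (x, t) then 1 else 0) \<partial>unit_law)"
    proof (rule nn_integral_cong_AE)
      show "AE u in unit_law. (if x \<in> B \<and> quantile G x u \<le> t then 1 else 0 :: ennreal)
          = indicator B x * (if 0 < u \<and> u < 1 \<and> u \<le> G (x, t) then 1 else 0)"
        using AE_unit_law
        by eventually_elim (use quantile_le_iff[OF G, of _ x t] in \<open>auto simp: indicator_def\<close>)
    qed
    also have "\<dots> = indicator B x * ennreal (G (x, t))"
      by (subst nn_integral_cmult) (auto simp: emeasure_unit_law_Iic cdf_family_range[OF G])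
    finally show "(\<integral>\<^sup>+ u. (if x \<in> B \<and> quantile G x u \<le> t then 1 else 0) \<partial>unit_law) = indicator B x * ennreal (G (x, t))" .
  qed
  finally show ?thesis .
qed

lemma eq_qlawI:
  assumes G: "cdf_family a b G" and "prob_space \<nu>" and S: "sets \<nu> = sets borel"
    and E: "\<And>B t. B \<in> sets borel \<Longrightarrow> emeasure \<nu> (B \<times> {..t}) = (\<integral>\<^sup>+ x. indicator B x * ennreal (G (x, t)) \<partial>\<mu>1)"
  shows "\<nu> = qlaw G"
proof (rule measure_eqI_generator_eq[OF Int_stable_strips, of UNIV _ _ "\<lambda>n. UNIV \<times> {..real n}"])
  interpret \<nu>: prob_space \<nu> by fact
  show "sets \<nu> = sigma_sets UNIV {B \<times> {..t} |B t. B \<in> sets borel}"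
    unfolding S borel_prod[symmetric] by (rule sets_strips)
  show "sets (qlaw G) = sigma_sets UNIV {B \<times> {..t} |B t. B \<in> sets borel}"
    unfolding sets_qlaw borel_prod[symmetric] by (rule sets_strips)
  have "z \<in> (\<Union>n. UNIV \<times> {..real n})" for z :: "real \<times> real"
    using real_arch_simple[of "snd z"] by (auto simp: mem_Times_iff)
  then show "(\<Union>n. UNIV \<times> {..real n}) = (UNIV :: (real \<times> real) set)" by blast
  show "range (\<lambda>n. UNIV \<times> {..real n}) \<subseteq> {B \<times> {..t} |B t. B \<in> sets borel}"
    by (auto intro!: exI[of _ UNIV])
  show "emeasure \<nu> X = emeasure (qlaw G) X" if "X \<in> {B \<times> {..t} |B t. B \<in> sets borel}" for X
    using that by (auto simp: E emeasure_qlaw[OF G])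
  show "emeasure \<nu> (UNIV \<times> {..real n}) \<noteq> \<infinity>" for n by simp
qed auto

text \<open>In the quantile coupling the displacement d satisfies |d| \<le> c, so |d|^p \<le>
  c^(p-1) |d|, and the mean of |d| is the L^1 distance of the distribution functions.\<close>

lemma W_ad_qlaw_le:
  assumes G: "cdf_family a b G" and G': "cdf_family a' b' G'" and "c \<ge> 0" "p \<ge> 1"
    and "\<And>x t. G (x, t) \<le> G' (x, t + c)" "\<And>x t. G' (x, t) \<le> G (x, t + c)"
  shows "W_ad p (qlaw G) (qlaw G') \<le> eroot p (ennreal (c powr (p - 1)) * L1 (\<lambda>z. G z - G' z))"
proof -
  note [measurable] = qmap_measurable[OF G] qmap_measurable[OF G'] quantile_measurable[OF G] quantile_measurable[OF G']
    quantile_measurable2[OF G] quantile_measurable2[OF G']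
  have [measurable]: "G \<in> borel_measurable (borel \<Otimes>\<^sub>M borel)" "G' \<in> borel_measurable (borel \<Otimes>\<^sub>M borel)"
    using G G' by (auto simp: cdf_family_def)
  let ?d = "\<lambda>x u. \<bar>quantile G x u - quantile G' x u\<bar>"
  have "W_ad p (qlaw G) (qlaw G') \<le> eroot p (\<integral>\<^sup>+ z. ennreal (norm (qmap G z - qmap G' z) powr p) \<partial>W)"
    unfolding qlaw_def by (intro W_ad_distr_le W.P.prob_space_axioms) (auto simp: qmap_def)
  also have "\<dots> \<le> eroot p (ennreal (c powr (p - 1)) * L1 (\<lambda>z. G z - G' z))"
  proof (rule eroot_mono)
    have "(\<integral>\<^sup>+ z. ennreal (norm (qmap G z - qmap G' z) powr p) \<partial>W)
      = (\<integral>\<^sup>+ x. \<integral>\<^sup>+ u. ennreal (?d x u powr p) \<partial>unit_law \<partial>\<mu>1)"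
      by (subst unit_law.nn_integral_fst[symmetric]) (auto simp: qmap_def norm_Pair)
    also have "\<dots> \<le> (\<integral>\<^sup>+ x. \<integral>\<^sup>+ u. ennreal (c powr (p - 1)) * ennreal (?d x u) \<partial>unit_law \<partial>\<mu>1)"
    proof (rule nn_integral_mono, rule nn_integral_mono_AE)
      fix x
      show "AE u in unit_law. ennreal (?d x u powr p) \<le> ennreal (c powr (p - 1)) * ennreal (?d x u)"
        using AE_unit_law
      proof eventually_elim
        case (elim u)
        have "?d x u \<le> c" by (rule quantile_near[OF G G' assms(5,6)]) (use elim in auto)
        then have "?d x u powr (p - 1) * ?d x u \<le> c powr (p - 1) * ?d x u"
          using assms by (intro mult_right_mono powr_mono2) auto
        moreover have "?d x u powr p = ?d x u powr (p - 1) * ?d x u"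
          by (cases "?d x u = 0") (auto simp: powr_diff)
        ultimately show ?case
          by (subst ennreal_mult[symmetric]) (auto intro!: ennreal_leI)
      qed
    qed
    also have "\<dots> = ennreal (c powr (p - 1)) * (\<integral>\<^sup>+ x. \<integral>\<^sup>+ u. ennreal (?d x u) \<partial>unit_law \<partial>\<mu>1)"
      by (subst nn_integral_cmult[symmetric]) (auto intro!: nn_integral_cong nn_integral_cmult)
    also have "(\<integral>\<^sup>+ x. \<integral>\<^sup>+ u. ennreal (?d x u) \<partial>unit_law \<partial>\<mu>1) = L1 (\<lambda>z. G z - G' z)"
      unfolding quantile_L1[OF G G'] L1_def by (subst lborel.nn_integral_fst[symmetric]) auto
    finally show "(\<integral>\<^sup>+ z. ennreal (norm (qmap G z - qmap G' z) powr p) \<partial>W)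
      \<le> ennreal (c powr (p - 1)) * L1 (\<lambda>z. G z - G' z)" .
  qed (use assms in simp)
  finally show ?thesis .
qed

end

subsection \<open>Correcting a drift\<close>

context real_distr
begin

lemma integrable_strip_bounded:
  assumes "a \<le> b" "strip_bounded a b f"
  shows "integrable M f"
proof (rule integrableI_bounded)
  obtain B where "\<And>z. \<bar>f z\<bar> \<le> B" using strip_boundedD(2)[OF assms(2)] by auto
  from L1_strip_le[OF assms(1) this strip_boundedD(3)[OF assms(2)]]
  have "L1 f < \<infinity>" by (rule le_less_trans) simp_all
  then show "(\<integral>\<^sup>+ z. ennreal (norm (f z)) \<partial>M) < \<infinity>" by (simp add: L1_def)
  show "f \<in> borel_measurable M"
    unfolding measurable_cong_sets[OF sets_M refl] by (rule strip_boundedD(1)[OF assms(2)])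
qed

lemma strip_bounded_Fubini:
  assumes "a \<le> b" "strip_bounded a b f"
  shows "(\<integral>x. \<integral>y. f (x, y) \<partial>lborel \<partial>\<mu>1) = (\<integral>y. \<integral>x. f (x, y) \<partial>\<mu>1 \<partial>lborel)"
  using P.Fubini_integral[of "\<lambda>x y. f (x, y)"] integrable_strip_bounded[OF assms] by simp

end

text \<open>A density \<open>\<kappa>\<close> of conditional laws: given the first coordinate \<open>x\<close>, of law \<open>\<mu>1\<close>, the
  second has density \<open>\<kappa>(x, \<cdot>)\<close>, and \<open>q\<close> is the density of the second marginal.\<close>

locale disintegrated = real_distr +
  fixes \<kappa> :: "real \<times> real \<Rightarrow> real" and q :: "real \<Rightarrow> real" and a b K q0 q1 :: real
  assumes ab: "a < b"
    and \<kappa>_measurable[measurable]: "\<kappa> \<in> borel_measurable (borel \<Otimes>\<^sub>M borel)"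
    and \<kappa>_nonneg: "\<And>z. 0 \<le> \<kappa> z" and \<kappa>_le: "\<And>z. \<kappa> z \<le> K"
    and \<kappa>_supp: "\<And>z. snd z \<notin> {a..b} \<Longrightarrow> \<kappa> z = 0"
    and \<kappa>_mass: "\<And>x. (\<integral>y. \<kappa> (x, y) \<partial>lborel) = 1"
    and \<kappa>_marg: "\<And>y. (\<integral>x. \<kappa> (x, y) \<partial>\<mu>1) = q y"
    and q_measurable[measurable]: "q \<in> borel_measurable borel"
    and q_cont: "continuous_on {a..b} q"
    and q_bounds: "0 < q0" "\<And>y. y \<in> {a..b} \<Longrightarrow> q0 \<le> q y" "\<And>y. y \<in> {a..b} \<Longrightarrow> q y \<le> q1"
    and q_supp: "\<And>y. y \<notin> {a..b} \<Longrightarrow> q y = 0"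
    and irreducible: "\<And>R S. R \<in> sets borel \<Longrightarrow> S \<in> sets borel \<Longrightarrow>
      (AE z in M. 0 < \<kappa> z \<longrightarrow> (fst z \<in> R \<longleftrightarrow> snd z \<in> S)) \<Longrightarrow> prob R = 0 \<or> prob R = 1"
begin

lemma \<kappa>_strip: "strip_bounded a b \<kappa>"
  unfolding strip_bounded_def using \<kappa>_nonneg \<kappa>_le \<kappa>_supp by (auto intro!: exI[of _ K])

lemma q_nonneg: "0 \<le> q y"
  using q_bounds q_supp[of y] by (cases "y \<in> {a..b}") (auto intro: order_trans less_imp_le)

lemma q0_le_q1: "q0 \<le> q1"
  using q_bounds(2,3)[of a] ab by auto

lemma q_le: "q y \<le> q1"
  using q_bounds q0_le_q1 q_supp[of y] by (cases "y \<in> {a..b}") auto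

lemma \<kappa>_int_x: "integrable \<mu>1 (\<lambda>x. \<kappa> (x, y))"
  by (rule integrable_const_bound[where B=K]) (use \<kappa>_nonneg \<kappa>_le in auto)

lemma \<kappa>_int_y: "integrable lborel (\<lambda>y. \<kappa> (x, y))"
  by (rule strip_bounded_integrable[OF \<kappa>_strip])

lemma K_ge: "1 / (b - a) \<le> K"
proof -
  have i: "integrable lborel (\<lambda>y. K * indicator {a..b} y)"
    by (intro integrable_mult_right) (simp add: integrable_indicator_iff emeasure_lborel_Icc_eq)
  have "1 \<le> (\<integral>y. K * indicator {a..b} y \<partial>lborel)"
    unfolding \<kappa>_mass[symmetric, of 0]
    by (intro integral_mono \<kappa>_int_y i) (use \<kappa>_le \<kappa>_supp in \<open>auto simp: indicator_def\<close>)
  then show ?thesis using ab by (simp add: field_simps)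
qed

lemma K_pos: "0 < K"
  using K_ge ab by (smt (verit) divide_pos_pos)

lemma inv_q: "0 \<le> 1 / q y" "1 / q y \<le> 1 / q0"
proof -
  show "0 \<le> 1 / q y" using q_nonneg by simp
  show "1 / q y \<le> 1 / q0"
    using q_bounds q_supp[of y] by (cases "y \<in> {a..b}") (auto intro!: divide_left_mono mult_pos_pos intro: less_le_trans)
qed

text \<open>Density with respect to \<open>\<mu>1\<close> of the kernel of E_1 E_2: from x draw y by
  \<kappa>(x, .), then x' from the conditional law given y, which is \<kappa>(x', y) / q y times
  \<open>\<mu>1\<close>. Where q vanishes so does \<kappa>, and the convention 1 / 0 = 0 is
  harmless.\<close>

definition k2 :: "real \<Rightarrow> real \<Rightarrow> real" where
  "k2 x x' = (\<integral>y. \<kappa> (x, y) * (\<kappa> (x', y) * (1 / q y)) \<partial>lborel)"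

lemma strip_bounded_k2: "strip_bounded a b (\<lambda>z. \<kappa> (x, snd z) * (\<kappa> z * (1 / q (snd z))))"
proof -
  have "strip_bounded a b (\<lambda>z. \<kappa> z * (\<kappa> (x, snd z) * (1 / q (snd z))))"
  proof (rule strip_bounded_mult[OF \<kappa>_strip])
    show "\<bar>\<kappa> (x, snd z) * (1 / q (snd z))\<bar> \<le> K * (1 / q0)" for z
      unfolding abs_mult using \<kappa>_nonneg \<kappa>_le inv_q K_pos by (intro mult_mono) auto
  qed measurable
  then show ?thesis by (simp add: ac_simps)
qed

lemma k2_integrable: "integrable lborel (\<lambda>y. \<kappa> (x, y) * (\<kappa> (x', y) * (1 / q y)))"
  using strip_bounded_integrable[OF strip_bounded_k2[of x], of x'] by simp

lemma k2_kernel: "symmetric_kernel \<mu>1 k2 (K * (1 / q0))"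
proof
  show "(\<lambda>(x, y). k2 x y) \<in> borel_measurable (\<mu>1 \<Otimes>\<^sub>M \<mu>1)"
    unfolding k2_def by measurable
  show "0 \<le> k2 x y" for x y
    unfolding k2_def by (intro integral_nonneg_AE AE_I2 mult_nonneg_nonneg \<kappa>_nonneg inv_q)
  \<comment> \<open>One factor \<kappa> keeps its mass 1, the other is bounded by K.\<close>
  show "k2 x y \<le> K * (1 / q0)" for x y
  proof -
    have "k2 x y \<le> (\<integral>y. \<kappa> (x, y) * (K * (1 / q0)) \<partial>lborel)"
      unfolding k2_def using \<kappa>_nonneg \<kappa>_le inv_q K_pos
      by (intro integral_mono k2_integrable integrable_mult_left \<kappa>_int_y mult_left_mono mult_mono) auto
    then show ?thesis by (simp add: \<kappa>_mass)
  qed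
  show "(\<integral>x'. k2 x x' \<partial>\<mu>1) = 1" for x
  proof -
    have "(\<integral>x'. k2 x x' \<partial>\<mu>1) = (\<integral>y. \<integral>x'. \<kappa> (x, y) * (\<kappa> (x', y) * (1 / q y)) \<partial>\<mu>1 \<partial>lborel)"
      unfolding k2_def using strip_bounded_Fubini[OF _ strip_bounded_k2[of x]] ab by simp
    also have "\<dots> = (\<integral>y. \<kappa> (x, y) \<partial>lborel)"
    proof (rule Bochner_Integration.integral_cong[OF refl])
      fix y
      have "(\<integral>x'. \<kappa> (x, y) * (\<kappa> (x', y) * (1 / q y)) \<partial>\<mu>1) = \<kappa> (x, y) * (q y * (1 / q y))"
        by (simp only: integral_mult_right_zero integral_mult_left_zero \<kappa>_marg)
      also have "\<dots> = \<kappa> (x, y)"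
        using q_bounds(1) q_bounds(2)[of y] \<kappa>_supp[of "(x, y)"] by (cases "y \<in> {a..b}") auto
      finally show "(\<integral>x'. \<kappa> (x, y) * (\<kappa> (x', y) * (1 / q y)) \<partial>\<mu>1) = \<kappa> (x, y)" .
    qed
    finally show ?thesis by (simp add: \<kappa>_mass)
  qed
  show "k2 x y = k2 y x" for x y
    unfolding k2_def by (simp only: mult_ac)
qed (use space_\<mu>1 in auto)

text \<open>Let S be the set of y charged from R. Then \<kappa> joins R only to S, and the
  hypothesis says that it joins the complement of R only to the complement of S. So the events that
  x is in R and that y is in S agree, and common events are trivial.\<close>

lemma k2_irreducible:
  assumes R: "R \<in> sets \<mu>1" and zero: "\<And>x. x \<notin> R \<Longrightarrow> AE y in \<mu>1. y \<in> R \<longrightarrow> k2 x y = 0"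
  shows "prob R = 0 \<or> prob R = 1"
proof -
  have [measurable]: "R \<in> sets borel" using R by simp
  define m where "m y = (\<integral>x. indicator R x * \<kappa> (x, y) \<partial>\<mu>1)" for y
  have [measurable]: "m \<in> borel_measurable borel" unfolding m_def[abs_def] by measurable
  have m_nonneg: "0 \<le> m y" for y
    unfolding m_def by (intro integral_nonneg_AE) (auto simp: \<kappa>_nonneg)
  define S where "S = {y. 0 < m y}"
  have [measurable]: "S \<in> sets borel" unfolding S_def by measurable
  have 1: "AE y in lborel. 0 < \<kappa> (x, y) \<longrightarrow> y \<notin> S" if x: "x \<notin> R" for x
  proof -
    have sb: "strip_bounded a b (\<lambda>z. (\<kappa> (x, snd z) * (\<kappa> z * (1 / q (snd z)))) * indicator R (fst z))"
      by (rule strip_bounded_mult[OF strip_bounded_k2, of _ 1]) (auto simp: indicator_def)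
    have "0 = (\<integral>x'. indicator R x' * k2 x x' \<partial>\<mu>1)"
      using zero[OF x] by (intro integral_eq_zero_AE[symmetric]) (auto simp: indicator_def elim: eventually_mono)
    also have "\<dots> = (\<integral>x'. \<integral>y. (\<kappa> (x, y) * (\<kappa> (x', y) * (1 / q y))) * indicator R x' \<partial>lborel \<partial>\<mu>1)"
      unfolding k2_def by (simp only: integral_mult_left_zero mult.commute[of "indicator R _"])
    also have "\<dots> = (\<integral>y. \<integral>x'. (\<kappa> (x, y) * (\<kappa> (x', y) * (1 / q y))) * indicator R x' \<partial>\<mu>1 \<partial>lborel)"
      using strip_bounded_Fubini[OF _ sb] ab by simp
    also have "\<dots> = (\<integral>y. \<kappa> (x, y) * (1 / q y) * m y \<partial>lborel)"
      unfolding m_def integral_mult_right_zero[symmetric] by (simp only: mult_ac)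
    finally have 0: "(\<integral>y. \<kappa> (x, y) * (1 / q y) * m y \<partial>lborel) = 0" by simp
    have m_le: "\<bar>m y\<bar> \<le> K" for y
    proof -
      have "integrable \<mu>1 (\<lambda>x. indicator R x * \<kappa> (x, y))"
        by (rule Bochner_Integration.integrable_bound[OF \<kappa>_int_x[of y]]) (auto simp: indicator_def)
      then have "m y \<le> (\<integral>x. K \<partial>\<mu>1)"
        unfolding m_def using \<kappa>_nonneg \<kappa>_le K_pos by (intro integral_mono) (auto simp: indicator_def)
      then show ?thesis using m_nonneg prob_space by simp
    qed
    have "strip_bounded a b (\<lambda>z. \<kappa> (x, snd z) * (1 / q (snd z) * m (snd z)))"
    proof -
      have "strip_bounded a b (\<lambda>z. \<kappa> (x, snd z))"
        unfolding strip_bounded_def using \<kappa>_nonneg \<kappa>_le \<kappa>_supp by (auto intro!: exI[of _ K])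
      then show ?thesis
      proof (rule strip_bounded_mult)
        show "\<bar>1 / q (snd z) * m (snd z)\<bar> \<le> 1 / q0 * K" for z
          unfolding abs_mult using m_le inv_q q_bounds(1) by (intro mult_mono) auto
      qed measurable
    qed
    from strip_bounded_integrable[OF this] have "integrable lborel (\<lambda>y. \<kappa> (x, y) * (1 / q y) * m y)"
      by (simp add: mult.assoc)
    from integral_nonneg_eq_0_iff_AE[OF this] 0
    have "AE y in lborel. \<kappa> (x, y) * (1 / q y) * m y = 0"
      using \<kappa>_nonneg inv_q(1) m_nonneg by (auto intro!: mult_nonneg_nonneg)
    then show ?thesis
    proof eventually_elim
      case (elim y)
      then show ?case
        using q_bounds(1) q_bounds(2)[of y] \<kappa>_supp[of "(x, y)"]
        by (cases "y \<in> {a..b}") (auto simp: S_def)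
    qed
  qed
  have 2: "AE x in \<mu>1. x \<in> R \<longrightarrow> 0 < \<kappa> (x, y) \<longrightarrow> y \<in> S" for y
  proof (cases "y \<in> S")
    case False
    then have "m y = 0" using m_nonneg[of y] by (auto simp: S_def)
    moreover have "integrable \<mu>1 (\<lambda>x. indicator R x * \<kappa> (x, y))"
      by (rule Bochner_Integration.integrable_bound[OF \<kappa>_int_x[of y]]) (auto simp: indicator_def)
    ultimately have "AE x in \<mu>1. indicator R x * \<kappa> (x, y) = 0"
      unfolding m_def using integral_nonneg_eq_0_iff_AE[of \<mu>1 "\<lambda>x. indicator R x * \<kappa> (x, y)"] \<kappa>_nonneg by auto
    then show ?thesis by eventually_elim (auto simp: indicator_def split: if_splits)
  qed auto
  have "AE x in \<mu>1. AE y in lborel. x \<notin> R \<longrightarrow> 0 < \<kappa> (x, y) \<longrightarrow> y \<notin> S"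
    using 1 by auto
  then have A: "AE z in M. fst z \<notin> R \<longrightarrow> 0 < \<kappa> (fst z, snd z) \<longrightarrow> snd z \<notin> S"
    by (subst (asm) P.AE_pair_iff) measurable
  have "AE y in lborel. AE x in \<mu>1. x \<in> R \<longrightarrow> 0 < \<kappa> (x, y) \<longrightarrow> y \<in> S"
    using 2 by auto
  \<comment> \<open>The exceptional set of x in fact 2 depends on y, so the order of the two
    variables has to be exchanged.\<close>
  then have "AE x in \<mu>1. AE y in lborel. x \<in> R \<longrightarrow> 0 < \<kappa> (x, y) \<longrightarrow> y \<in> S"
    by (subst P.AE_commute) measurable
  then have B: "AE z in M. fst z \<in> R \<longrightarrow> 0 < \<kappa> (fst z, snd z) \<longrightarrow> snd z \<in> S"
    by (subst (asm) P.AE_pair_iff) measurable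
  from A B have "AE z in M. 0 < \<kappa> z \<longrightarrow> (fst z \<in> R \<longleftrightarrow> snd z \<in> S)"
    by eventually_elim auto
  then show ?thesis by (intro irreducible[of R S]) auto
qed

text \<open>Two points with the same label and small \<open>h\<close> have L^1-close densities, so
  the integral of \<kappa>(x, y) \<kappa>(x', y) over y is close to that of \<kappa>(x, y)^2, which
  is at least 1/(b - a) by Cauchy-Schwarz. Pairs inside a cell thus have a uniform lower bound even
  though \<kappa> itself may vanish on large sets.\<close>

lemma k2_cells:
  "\<exists>E n \<gamma>. irreducible_kernel \<mu>1 k2 (K * (1 / q0)) E n \<gamma>"
proof -
  interpret symmetric_kernel \<mu>1 k2 "K * (1 / q0)" by (rule k2_kernel)
  \<comment> \<open>Two points of a cell have densities at L^1 distance at most 2 \<delta>; the loss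
    2 K \<delta> is then half of 1/(b - a).\<close>
  define \<delta> where "\<delta> = 1 / (4 * K * (b - a))"
  have \<delta>: "0 < \<delta>" unfolding \<delta>_def using K_pos ab by simp
  \<comment> \<open>By Markov's inequality \<open>h\<close> is at least \<delta> with probability at
    most e / \<delta>, the bound required of the complement of the cells for a kernel bounded by K /
    q0.\<close>
  define e where "e = \<delta> * (1 / (2 * (K * (1 / q0))))"
  have e: "0 < e" unfolding e_def using \<delta> K_pos q_bounds(1) by simp
  obtain g where g: "strip_step a b g" "L1 (\<lambda>z. \<kappa> z - g z) \<le> ennreal e"
    using approxD[OF approx_strip_bounded[OF ab \<kappa>_strip] e] by blast
  have gs: "strip_bounded a b g" using g(1) by (rule strip_step_strip_bounded)
  have [measurable]: "g \<in> borel_measurable (borel \<Otimes>\<^sub>M borel)" by (rule strip_boundedD[OF gs])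
  obtain \<iota> :: "real \<Rightarrow> nat" and n where \<iota>[measurable]: "\<iota> \<in> measurable borel (count_space UNIV)"
    and n: "\<And>x. \<iota> x < n" and atom: "\<And>x x' y. \<iota> x = \<iota> x' \<Longrightarrow> g (x, y) = g (x', y)"
    using strip_step_atoms[OF g(1)] by blast
  define h where "h x = (\<integral>\<^sup>+ y. ennreal \<bar>\<kappa> (x, y) - g (x, y)\<bar> \<partial>lborel)" for x
  have [measurable]: "h \<in> borel_measurable borel" unfolding h_def[abs_def] by measurable
  define E where "E i = {x. \<iota> x = i \<and> h x < ennreal \<delta>}" for i
  have E: "E i \<in> sets borel" for i
    unfolding E_def by measurable
  define \<gamma> where "\<gamma> = 1 / q1 * (1 / (2 * (b - a)))"
  have q1: "0 < q1" using q_bounds(1) q0_le_q1 by simp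
  have "irreducible_kernel \<mu>1 k2 (K * (1 / q0)) E n \<gamma>"
  proof
    show "E i \<in> events" for i using E by simp
    show "0 < \<gamma>" unfolding \<gamma>_def using q1 ab by simp
    show "\<gamma> \<le> k2 x y" if "i < n" "x \<in> E i" "y \<in> E i" for i x y
    proof -
      let ?l = "1 / (b - a)"
      have i: "integrable lborel (\<lambda>t. \<kappa> (x, t) - g (x, t))" "integrable lborel (\<lambda>t. \<kappa> (y, t) - g (y, t))"
        by (intro Bochner_Integration.integrable_diff strip_bounded_integrable[OF gs] \<kappa>_int_y)+
      have "(\<integral>t. \<bar>\<kappa> (x, t) - g (x, t)\<bar> \<partial>lborel) \<le> \<delta>" "(\<integral>t. \<bar>\<kappa> (y, t) - g (y, t)\<bar> \<partial>lborel) \<le> \<delta>"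
        using that(2,3) \<delta> nn_integral_eq_integral[OF integrable_abs[OF i(1)]] nn_integral_eq_integral[OF integrable_abs[OF i(2)]]
        unfolding E_def h_def by (auto simp: less_le)
      moreover have "g (x, t) = g (y, t)" for t using that(2,3) atom by (simp add: E_def)
      then have "(\<integral>t. \<bar>\<kappa> (x, t) - \<kappa> (y, t)\<bar> \<partial>lborel)
          \<le> (\<integral>t. \<bar>\<kappa> (x, t) - g (x, t)\<bar> + \<bar>\<kappa> (y, t) - g (y, t)\<bar> \<partial>lborel)"
        by (intro integral_mono Bochner_Integration.integrable_add integrable_abs i
            Bochner_Integration.integrable_diff \<kappa>_int_y) auto
      ultimately have close: "(\<integral>t. \<bar>\<kappa> (x, t) - \<kappa> (y, t)\<bar> \<partial>lborel) \<le> 2 * \<delta>"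
        using i by (simp add: integrable_abs)
      have iu: "integrable lborel (indicator {a..b} :: real \<Rightarrow> real)"
        by (simp add: integrable_indicator_iff emeasure_lborel_Icc_eq)
      \<comment> \<open>Cauchy-Schwarz in tangent form: with l = 1/(b - a), the lower bound 2 l k -
        l^2 for k^2 is linear in k and integrates to l.\<close>
      have "1 / q1 * (2 * ?l * \<kappa> (x, t) - ?l\<^sup>2 * indicator {a..b} t - K * \<bar>\<kappa> (x, t) - \<kappa> (y, t)\<bar>)
          \<le> \<kappa> (x, t) * (\<kappa> (y, t) * (1 / q t))" for t
      proof (cases "t \<in> {a..b}")
        case True
        have "0 \<le> (\<kappa> (x, t) - ?l)\<^sup>2" by simp
        then have "2 * ?l * \<kappa> (x, t) - ?l\<^sup>2 \<le> \<kappa> (x, t) * \<kappa> (x, t)"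
          by (simp add: power2_diff power2_eq_square algebra_simps)
        moreover have "\<kappa> (x, t) * \<kappa> (x, t) - \<kappa> (x, t) * \<kappa> (y, t) \<le> K * \<bar>\<kappa> (x, t) - \<kappa> (y, t)\<bar>"
        proof -
          have "\<kappa> (x, t) * (\<kappa> (x, t) - \<kappa> (y, t)) \<le> \<kappa> (x, t) * \<bar>\<kappa> (x, t) - \<kappa> (y, t)\<bar>"
            by (intro mult_left_mono \<kappa>_nonneg) auto
          also have "\<dots> \<le> K * \<bar>\<kappa> (x, t) - \<kappa> (y, t)\<bar>" by (intro mult_right_mono \<kappa>_le) auto
          finally show ?thesis by (simp add: algebra_simps)
        qed
        ultimately have "2 * ?l * \<kappa> (x, t) - ?l\<^sup>2 * indicator {a..b} t - K * \<bar>\<kappa> (x, t) - \<kappa> (y, t)\<bar> \<le> \<kappa> (x, t) * \<kappa> (y, t)"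
          using True by simp
        then have "1 / q1 * (2 * ?l * \<kappa> (x, t) - ?l\<^sup>2 * indicator {a..b} t - K * \<bar>\<kappa> (x, t) - \<kappa> (y, t)\<bar>)
            \<le> 1 / q1 * (\<kappa> (x, t) * \<kappa> (y, t))"
          using q1 by (intro mult_left_mono) auto
        also have "\<dots> \<le> 1 / q t * (\<kappa> (x, t) * \<kappa> (y, t))"
          using q_bounds(1) q_bounds(2,3)[OF True] q1 \<kappa>_nonneg
          by (intro mult_right_mono divide_left_mono mult_nonneg_nonneg mult_pos_pos) auto
        finally show ?thesis by (simp add: mult_ac)
      next
        case False
        then show ?thesis using \<kappa>_supp[of "(x, t)"] \<kappa>_supp[of "(y, t)"] by simp
      qed
      then have A: "(\<integral>t. 1 / q1 * (2 * ?l * \<kappa> (x, t) - ?l\<^sup>2 * indicator {a..b} t - K * \<bar>\<kappa> (x, t) - \<kappa> (y, t)\<bar>) \<partial>lborel) \<le> k2 x y"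
        unfolding k2_def
        by (intro integral_mono k2_integrable integrable_mult_right Bochner_Integration.integrable_diff
            integrable_abs \<kappa>_int_y iu)
      have B: "(\<integral>t. 1 / q1 * (2 * ?l * \<kappa> (x, t) - ?l\<^sup>2 * indicator {a..b} t - K * \<bar>\<kappa> (x, t) - \<kappa> (y, t)\<bar>) \<partial>lborel)
        = 1 / q1 * (2 * ?l - ?l\<^sup>2 * (b - a) - K * (\<integral>t. \<bar>\<kappa> (x, t) - \<kappa> (y, t)\<bar> \<partial>lborel))"
        using ab by (subst integral_mult_right_zero, subst Bochner_Integration.integral_diff,
            (intro integrable_mult_right Bochner_Integration.integrable_diff integrable_abs \<kappa>_int_y iu)+)
          (subst Bochner_Integration.integral_diff,
            (intro integrable_mult_right Bochner_Integration.integrable_diff integrable_abs \<kappa>_int_y iu)+,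
            simp add: \<kappa>_mass)
      have C: "?l\<^sup>2 * (b - a) = ?l" using ab by (simp add: power2_eq_square)
      have "1 / (2 * (b - a)) \<le> 2 * ?l - ?l - K * (\<integral>t. \<bar>\<kappa> (x, t) - \<kappa> (y, t)\<bar> \<partial>lborel)"
      proof -
        have "K * (\<integral>t. \<bar>\<kappa> (x, t) - \<kappa> (y, t)\<bar> \<partial>lborel) \<le> K * (2 * \<delta>)"
          using close K_pos by (intro mult_left_mono) auto
        also have "\<dots> = 1 / (2 * (b - a))"
        proof -
          have "K * (2 * (1 / (4 * K * d))) = 1 / (2 * d)" if "d > 0" for d
            using K_pos that by (simp add: field_simps)
          then show ?thesis unfolding \<delta>_def using ab by simp
        qed
        finally have "K * (\<integral>t. \<bar>\<kappa> (x, t) - \<kappa> (y, t)\<bar> \<partial>lborel) \<le> 1 / (2 * (b - a))" .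
        moreover have "?l = 1 / (2 * (b - a)) + 1 / (2 * (b - a))" using ab by (simp add: field_simps)
        moreover have "\<And>L H I :: real. I \<le> H \<Longrightarrow> L = H + H \<Longrightarrow> H \<le> 2 * L - L - I" by linarith
        ultimately show ?thesis by blast
      qed
      then have D: "\<gamma> \<le> 1 / q1 * (2 * ?l - ?l - K * (\<integral>t. \<bar>\<kappa> (x, t) - \<kappa> (y, t)\<bar> \<partial>lborel))"
        unfolding \<gamma>_def using q1 by (intro mult_left_mono) auto
      show ?thesis by (rule order_trans[OF D A[unfolded B C]])
    qed
    show "prob (UNIV - (\<Union>i<n. E i)) \<le> 1 / (2 * (K * (1 / q0)))"
    proof -
      have eq: "UNIV - (\<Union>i<n. E i) = {x \<in> space \<mu>1. 1 \<le> ennreal (1 / \<delta>) * h x}"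
      proof -
        have "h x < ennreal \<delta> \<longleftrightarrow> \<not> 1 \<le> ennreal (1 / \<delta>) * h x" for x
        proof (cases "h x")
          case (real r)
          then show ?thesis using \<delta>
            by (simp add: ennreal_mult[symmetric] ennreal_less_iff not_le field_simps flip: ennreal_1)
        next
          case top
          then show ?thesis using \<delta> by (simp add: ennreal_mult_top)
        qed
        then show ?thesis using n by (auto simp: E_def)
      qed
      have "emeasure \<mu>1 {x \<in> space \<mu>1. 1 \<le> ennreal (1 / \<delta>) * h x} \<le> ennreal (1 / \<delta>) * (\<integral>\<^sup>+ x. h x * indicator (space \<mu>1) x \<partial>\<mu>1)"
        by (rule nn_integral_Markov_inequality) auto
      also have "(\<integral>\<^sup>+ x. h x * indicator (space \<mu>1) x \<partial>\<mu>1) = L1 (\<lambda>z. \<kappa> z - g z)"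
        unfolding L1_def h_def by (subst lborel.nn_integral_fst[symmetric]) auto
      also have "ennreal (1 / \<delta>) * \<dots> \<le> ennreal (1 / \<delta>) * ennreal e"
        using g(2) by (intro mult_left_mono) auto
      also have "\<dots> = ennreal (1 / (2 * (K * (1 / q0))))"
        unfolding e_def using \<delta> K_pos q_bounds(1) by (subst ennreal_mult[symmetric]) auto
      finally show ?thesis
        unfolding eq emeasure_eq_measure using K_pos q_bounds(1) by (subst (asm) ennreal_le_iff) auto
    qed
    show "prob R = 0 \<or> prob R = 1"
      if "R \<in> events" "\<And>x. x \<notin> R \<Longrightarrow> AE y in \<mu>1. y \<in> R \<longrightarrow> k2 x y = 0" for R
      using that by (rule k2_irreducible)
  qed
  then show ?thesis by blast
qed

text \<open>Subtracting from \<alpha> its conditional mean \<beta> given y makes D centred given y.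
  Given x, averaging \<beta> against \<kappa>(x, .) completes the two steps of \<open>k2\<close>, so
  D has mean \<alpha> - T \<alpha>. Conditional means do not increase the sup norm, whence twice the
  constant of the Poisson equation.\<close>

lemma corrector:
  "\<exists>C\<ge>0. \<forall>\<epsilon> e. \<epsilon> \<in> borel_measurable borel \<longrightarrow> (\<forall>x. \<bar>\<epsilon> x\<bar> \<le> e) \<longrightarrow> (\<integral>x. \<epsilon> x \<partial>\<mu>1) = 0 \<longrightarrow>
    (\<exists>D\<in>borel_measurable (borel \<Otimes>\<^sub>M borel). (\<forall>z. \<bar>D z\<bar> \<le> C * e) \<and>
       (\<forall>x. (\<integral>y. \<kappa> (x, y) * D (x, y) \<partial>lborel) = \<epsilon> x) \<and> (\<forall>y. (\<integral>x. \<kappa> (x, y) * D (x, y) \<partial>\<mu>1) = 0))"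
proof -
  obtain E n \<gamma> where "irreducible_kernel \<mu>1 k2 (K * (1 / q0)) E n \<gamma>" using k2_cells by blast
  then interpret irreducible_kernel \<mu>1 k2 "K * (1 / q0)" E n \<gamma> .
  obtain C where C: "0 \<le> C" and sol: "\<forall>\<epsilon> e. \<epsilon> \<in> borel_measurable \<mu>1 \<longrightarrow> (\<forall>x. \<bar>\<epsilon> x\<bar> \<le> e) \<longrightarrow> (\<integral>x. \<epsilon> x \<partial>\<mu>1) = 0 \<longrightarrow>
    (\<exists>\<alpha>\<in>borel_measurable \<mu>1. (\<forall>x. \<bar>\<alpha> x\<bar> \<le> C * e) \<and> (\<forall>x. \<alpha> x - T \<alpha> x = \<epsilon> x))"
    by (rule exE[OF poisson_equation], erule conjE, rule that)
  have main: "\<exists>D\<in>borel_measurable (borel \<Otimes>\<^sub>M borel). (\<forall>z. \<bar>D z\<bar> \<le> 2 * C * e) \<and>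
       (\<forall>x. (\<integral>y. \<kappa> (x, y) * D (x, y) \<partial>lborel) = \<epsilon> x) \<and> (\<forall>y. (\<integral>x. \<kappa> (x, y) * D (x, y) \<partial>\<mu>1) = 0)"
    if \<epsilon>: "\<epsilon> \<in> borel_measurable borel" "\<forall>x. \<bar>\<epsilon> x\<bar> \<le> e" "(\<integral>x. \<epsilon> x \<partial>\<mu>1) = 0" for \<epsilon> e
  proof -
    have "\<epsilon> \<in> borel_measurable \<mu>1" using \<epsilon>(1) by simp
    from sol[rule_format, OF this \<epsilon>(2)[rule_format] \<epsilon>(3)]
    obtain \<alpha> where "\<alpha> \<in> borel_measurable \<mu>1" and \<alpha>b: "\<And>x. \<bar>\<alpha> x\<bar> \<le> C * e" and \<alpha>: "\<And>x. \<alpha> x - T \<alpha> x = \<epsilon> x"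
      by (elim bexE conjE) (rule that, auto)
    then have [measurable]: "\<alpha> \<in> borel_measurable borel" by simp
    have Ce: "0 \<le> C * e" using \<alpha>b[of 0] by linarith
    have int: "integrable \<mu>1 (\<lambda>x. \<kappa> (x, y) * \<alpha> x)" for y
    proof (rule integrable_const_bound[where B="K * (C * e)"])
      show "AE x in \<mu>1. norm (\<kappa> (x, y) * \<alpha> x) \<le> K * (C * e)"
        using \<kappa>_nonneg \<kappa>_le \<alpha>b Ce K_pos by (auto simp: abs_mult intro!: mult_mono)
    qed measurable
    define \<beta> where "\<beta> y = (\<integral>x. \<kappa> (x, y) * \<alpha> x \<partial>\<mu>1) * (1 / q y)" for y
    have [measurable]: "\<beta> \<in> borel_measurable borel" unfolding \<beta>_def[abs_def] by measurable
    have \<beta>b: "\<bar>\<beta> y\<bar> \<le> C * e" for y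
    proof -
      have "\<bar>\<integral>x. \<kappa> (x, y) * \<alpha> x \<partial>\<mu>1\<bar> \<le> (\<integral>x. \<kappa> (x, y) * (C * e) \<partial>\<mu>1)"
      proof (rule order_trans[OF integral_abs_bound], rule integral_mono)
        show "\<bar>\<kappa> (x, y) * \<alpha> x\<bar> \<le> \<kappa> (x, y) * (C * e)" for x
          unfolding abs_mult using \<alpha>b \<kappa>_nonneg by (simp add: mult_left_mono)
      qed (intro integrable_abs int integrable_mult_left \<kappa>_int_x)+
      also have "\<dots> = q y * (C * e)" by (simp add: \<kappa>_marg)
      finally have "\<bar>\<beta> y\<bar> \<le> q y * (C * e) * (1 / q y)"
        unfolding \<beta>_def abs_mult abs_of_nonneg[OF inv_q(1)] by (rule mult_right_mono[OF _ inv_q(1)])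
      also have "\<dots> \<le> C * e" using Ce by (cases "q y = 0") auto
      finally show ?thesis .
    qed
    define D where "D z = \<alpha> (fst z) - \<beta> (snd z)" for z
    have D1: "(\<integral>y. \<kappa> (x, y) * D (x, y) \<partial>lborel) = \<epsilon> x" for x
    proof -
      have i1: "integrable lborel (\<lambda>y. \<kappa> (x, y) * \<beta> y)"
        using strip_bounded_integrable[OF strip_bounded_mult[OF \<kappa>_strip, of "\<lambda>z. \<beta> (snd z)" "C * e"], of x] \<beta>b by simp
      have sb: "strip_bounded a b (\<lambda>z. (\<kappa> (x, snd z) * (\<kappa> z * (1 / q (snd z)))) * \<alpha> (fst z))"
        by (rule strip_bounded_mult[OF strip_bounded_k2, of _ "C * e"]) (use \<alpha>b in auto)
      have "(\<integral>y. \<kappa> (x, y) * \<beta> y \<partial>lborel) = (\<integral>y. \<integral>x'. (\<kappa> (x, y) * (\<kappa> (x', y) * (1 / q y))) * \<alpha> x' \<partial>\<mu>1 \<partial>lborel)"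
        unfolding \<beta>_def integral_mult_right_zero[symmetric] integral_mult_left_zero[symmetric]
        by (simp only: mult_ac)
      also have "\<dots> = (\<integral>x'. \<integral>y. (\<kappa> (x, y) * (\<kappa> (x', y) * (1 / q y))) * \<alpha> x' \<partial>lborel \<partial>\<mu>1)"
        using strip_bounded_Fubini[OF _ sb] ab by simp
      also have "\<dots> = T \<alpha> x" unfolding T_def k2_def by (simp only: integral_mult_left_zero)
      finally have T: "(\<integral>y. \<kappa> (x, y) * \<beta> y \<partial>lborel) = T \<alpha> x" .
      have "(\<integral>y. \<kappa> (x, y) * D (x, y) \<partial>lborel) = (\<integral>y. \<kappa> (x, y) * \<alpha> x \<partial>lborel) - (\<integral>y. \<kappa> (x, y) * \<beta> y \<partial>lborel)"
        unfolding D_def right_diff_distrib fst_conv snd_conv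
        by (intro Bochner_Integration.integral_diff integrable_mult_left \<kappa>_int_y i1)
      also have "\<dots> = \<epsilon> x" unfolding T using \<alpha>[of x] by (simp add: \<kappa>_mass)
      finally show ?thesis .
    qed
    have D2: "(\<integral>x. \<kappa> (x, y) * D (x, y) \<partial>\<mu>1) = 0" for y
    proof -
      have "(\<integral>x. \<kappa> (x, y) * D (x, y) \<partial>\<mu>1) = (\<integral>x. \<kappa> (x, y) * \<alpha> x \<partial>\<mu>1) - (\<integral>x. \<kappa> (x, y) * \<beta> y \<partial>\<mu>1)"
        unfolding D_def right_diff_distrib fst_conv snd_conv
        by (intro Bochner_Integration.integral_diff integrable_mult_left \<kappa>_int_x int)
      also have "(\<integral>x. \<kappa> (x, y) * \<beta> y \<partial>\<mu>1) = q y * \<beta> y" by (simp add: \<kappa>_marg)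
      also have "\<dots> = (\<integral>x. \<kappa> (x, y) * \<alpha> x \<partial>\<mu>1)"
        using q_bounds(1) q_bounds(2)[of y] \<kappa>_supp[of "(_, y)"] unfolding \<beta>_def by (cases "y \<in> {a..b}") auto
      finally show ?thesis by simp
    qed
    have "\<bar>D z\<bar> \<le> 2 * C * e" for z
      using \<alpha>b[of "fst z"] \<beta>b[of "snd z"] unfolding D_def by linarith
    moreover have "D \<in> borel_measurable (borel \<Otimes>\<^sub>M borel)" unfolding D_def[abs_def] by measurable
    ultimately show ?thesis by (intro bexI[of _ D] conjI allI D1 D2)
  qed
  show ?thesis
  proof (intro exI conjI allI impI)
    show "0 \<le> 2 * C" using C by simp
  qed (rule main)
qed

end

subsection \<open>Marginals and means of quantile laws\<close>

context real_distr
begin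

text \<open>Mass that ends below t under D ends below t' under D'. This covers monotonicity in t as
  well as the horizontal shifts that \<open>quantile_near\<close> asks for.\<close>

lemma shifted_cdf_le:
  assumes g: "strip_bounded a b g" and "\<And>z. 0 \<le> g z"
    and [measurable]: "D \<in> borel_measurable (borel \<Otimes>\<^sub>M borel)" "D' \<in> borel_measurable (borel \<Otimes>\<^sub>M borel)"
    and "\<And>z. D' z - D z \<le> t' - t"
  shows "shifted_cdf g D (x, t) \<le> shifted_cdf g D' (x, t')"
  unfolding shifted_cdf_def fst_conv snd_conv
proof (rule integral_mono)
  show "(if y + D (x, y) \<le> t then g (x, y) else 0) \<le> (if y + D' (x, y) \<le> t' then g (x, y) else 0)" for y
    using assms(2)[of "(x, y)"] assms(5)[of "(x, y)"] by auto
qed (intro shifted_cdf_integrable[OF g]; measurable)+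

lemma shifted_cdf_mono:
  assumes "strip_bounded a b g" "\<And>z. 0 \<le> g z" "D \<in> borel_measurable (borel \<Otimes>\<^sub>M borel)" "t \<le> t'"
  shows "shifted_cdf g D (x, t) \<le> shifted_cdf g D (x, t')"
  by (rule shifted_cdf_le) (use assms in auto)

lemma shifted_cdf_right_cont:
  assumes g: "strip_bounded a b g" and D[measurable]: "D \<in> borel_measurable (borel \<Otimes>\<^sub>M borel)"
  shows "continuous (at_right t) (\<lambda>t. shifted_cdf g D (x, t))"
  unfolding continuous_within
proof (rule tendsto_at_right_sequentially[of t "t + 1"])
  fix S :: "nat \<Rightarrow> real" assume S: "\<And>n. t < S n" "S \<longlonglongrightarrow> t"
  have gm[measurable]: "g \<in> borel_measurable (borel \<Otimes>\<^sub>M borel)" by (rule strip_boundedD[OF g])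
  show "(\<lambda>n. shifted_cdf g D (x, S n)) \<longlonglongrightarrow> shifted_cdf g D (x, t)"
    unfolding shifted_cdf_def fst_conv snd_conv
  proof (rule integral_dominated_convergence[where w="\<lambda>y. \<bar>g (x, y)\<bar>"])
    show "integrable lborel (\<lambda>y. \<bar>g (x, y)\<bar>)" by (intro integrable_abs strip_bounded_integrable[OF g])
    show "AE y in lborel. (\<lambda>n. if y + D (x, y) \<le> S n then g (x, y) else 0) \<longlonglongrightarrow> (if y + D (x, y) \<le> t then g (x, y) else 0)"
    proof (intro AE_I2 tendsto_eventually)
      fix y
      show "\<forall>\<^sub>F n in sequentially. (if y + D (x, y) \<le> S n then g (x, y) else 0) = (if y + D (x, y) \<le> t then g (x, y) else 0)"
      proof (cases "y + D (x, y) \<le> t")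
        case True
        have "y + D (x, y) \<le> S n" for n using True S(1)[of n] by linarith
        then show ?thesis using True by simp
      next
        case False
        then have "\<forall>\<^sub>F n in sequentially. S n < y + D (x, y)"
          using order_tendstoD(2)[OF S(2)] by simp
        then show ?thesis by eventually_elim (use False in auto)
      qed
    qed
  qed (auto simp: measurable_Pair1')
qed simp

lemma shifted_cdf_below:
  assumes "strip_bounded a b g" "\<And>z. \<bar>D z\<bar> \<le> c" "t < a - c"
  shows "shifted_cdf g D (x, t) = 0"
proof -
  have "(if y + D (x, y) \<le> t then g (x, y) else 0) = 0" for y
  proof (cases "y \<in> {a..b}")
    case True
    with assms(2)[of "(x, y)"] assms(3) have "\<not> y + D (x, y) \<le> t" by (auto simp: abs_le_iff)
    then show ?thesis by simp
  qed (use strip_boundedD(3)[OF assms(1), of "(x, y)"] in simp)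
  then show ?thesis unfolding shifted_cdf_def fst_conv snd_conv by simp
qed

lemma shifted_cdf_above:
  assumes "strip_bounded a b g" "\<And>z. \<bar>D z\<bar> \<le> c" "b + c \<le> t"
  shows "shifted_cdf g D (x, t) = (\<integral>y. g (x, y) \<partial>lborel)"
proof -
  have "(if y + D (x, y) \<le> t then g (x, y) else 0) = g (x, y)" for y
  proof (cases "y \<in> {a..b}")
    case True
    with assms(2)[of "(x, y)"] assms(3) have "y + D (x, y) \<le> t" by (auto simp: abs_le_iff)
    then show ?thesis by simp
  qed (use strip_boundedD(3)[OF assms(1), of "(x, y)"] in simp)
  then show ?thesis unfolding shifted_cdf_def fst_conv snd_conv by simp
qed

text \<open>For a constant displacement the average over x acts on the density alone, so the second
  marginal of the walk can be read off from averages of the jump probabilities at fixed y.\<close>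

lemma shifted_cdf_integral_x:
  assumes ab: "a \<le> b" and g: "strip_bounded a b g"
  shows "(\<integral>x. shifted_cdf g (\<lambda>_. d) (x, t) \<partial>\<mu>1) = (\<integral>y. (if y + d \<le> t then \<integral>x. g (x, y) \<partial>\<mu>1 else 0) \<partial>lborel)"
proof -
  have gm[measurable]: "g \<in> borel_measurable (borel \<Otimes>\<^sub>M borel)" by (rule strip_boundedD[OF g])
  have sb: "strip_bounded a b (\<lambda>z. g z * (if snd z + d \<le> t then 1 else 0))"
    by (rule strip_bounded_mult[OF g, of _ 1]) auto
  have "(\<integral>x. shifted_cdf g (\<lambda>_. d) (x, t) \<partial>\<mu>1) = (\<integral>x. \<integral>y. g (x, y) * (if y + d \<le> t then 1 else 0) \<partial>lborel \<partial>\<mu>1)"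
    unfolding shifted_cdf_def by (intro Bochner_Integration.integral_cong) auto
  also have "\<dots> = (\<integral>y. \<integral>x. g (x, y) * (if y + d \<le> t then 1 else 0) \<partial>\<mu>1 \<partial>lborel)"
    using strip_bounded_Fubini[OF ab sb] by simp
  also have "\<dots> = (\<integral>y. (if y + d \<le> t then \<integral>x. g (x, y) \<partial>\<mu>1 else 0) \<partial>lborel)"
    by (intro Bochner_Integration.integral_cong) auto
  finally show ?thesis .
qed

lemma shifted_cdf_integrable_x:
  assumes ab: "a \<le> b" and g: "strip_bounded a b g" and [measurable]: "D \<in> borel_measurable (borel \<Otimes>\<^sub>M borel)"
  shows "integrable \<mu>1 (\<lambda>x. shifted_cdf g D (x, t))"
proof -
  have gm[measurable]: "g \<in> borel_measurable (borel \<Otimes>\<^sub>M borel)" by (rule strip_boundedD[OF g])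
  have sb: "strip_bounded a b (\<lambda>z. g z * (if snd z + D z \<le> t then 1 else 0))"
    by (rule strip_bounded_mult[OF g, of _ 1]) auto
  have "integrable \<mu>1 (\<lambda>x. \<integral>y. g (x, y) * (if y + D (x, y) \<le> t then 1 else 0) \<partial>lborel)"
    using P.integrable_fst'[OF integrable_strip_bounded[OF ab sb]] by simp
  moreover have "(\<integral>y. g (x, y) * (if y + D (x, y) \<le> t then 1 else 0) \<partial>lborel) = shifted_cdf g D (x, t)" for x
    unfolding shifted_cdf_def by (intro Bochner_Integration.integral_cong) auto
  ultimately show ?thesis by simp
qed

text \<open>Over a window containing all displaced mass, the area under the distribution function is
  the integral of right end minus position. The margin c lets different displacements share one
  window.\<close>

lemma shifted_cdf_integral_t:
  assumes ab: "a \<le> b" and g: "strip_bounded a b g" and "\<bar>d\<bar> \<le> c"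
  shows "integrable lborel (\<lambda>t. indicator {a - c..b + c} t * shifted_cdf g (\<lambda>_. d) (x, t))"
    and "(\<integral>t. indicator {a - c..b + c} t * shifted_cdf g (\<lambda>_. d) (x, t) \<partial>lborel)
      = (\<integral>y. g (x, y) * (b + c - y - d) \<partial>lborel)"
proof -
  have gm[measurable]: "g \<in> borel_measurable (borel \<Otimes>\<^sub>M borel)" by (rule strip_boundedD[OF g])
  let ?f = "\<lambda>t y. indicator {a - c..b + c} t * (if y + d \<le> t then g (x, y) else 0) :: real"
  obtain Kg where Kg: "Kg \<ge> 0" "\<And>z. \<bar>g z\<bar> \<le> Kg" using strip_boundedD(2)[OF g] by auto
  have "integrable (lborel \<Otimes>\<^sub>M lborel) (\<lambda>z. Kg * indicator ({a - c..b + c} \<times> {a..b}) z :: real)"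
    by (intro integrable_mult_right)
       (simp add: integrable_indicator_iff lborel.emeasure_pair_measure_Times ennreal_mult_less_top emeasure_lborel_Icc_eq)
  then have int: "integrable (lborel \<Otimes>\<^sub>M lborel) (\<lambda>(t, y). ?f t y)"
  proof (rule Bochner_Integration.integrable_bound)
    have *: "norm (?f t y) \<le> norm (Kg * indicator ({a - c..b + c} \<times> {a..b}) (t, y) :: real)" for t y
      using Kg strip_boundedD(3)[OF g, of "(x, y)"] by (auto simp: indicator_def)
    show "AE z in lborel \<Otimes>\<^sub>M lborel. norm (case z of (t, y) \<Rightarrow> ?f t y) \<le> norm (Kg * indicator ({a - c..b + c} \<times> {a..b}) z :: real)"
    proof (rule AE_I2)
      show "norm (case z of (t, y) \<Rightarrow> ?f t y) \<le> norm (Kg * indicator ({a - c..b + c} \<times> {a..b}) z :: real)" for z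
        by (cases z) (simp only: prod.case *)
    qed
  qed measurable
  have F: "(\<integral>y. ?f t y \<partial>lborel) = indicator {a - c..b + c} t * shifted_cdf g (\<lambda>_. d) (x, t)" for t
    unfolding shifted_cdf_def fst_conv snd_conv by simp
  show "integrable lborel (\<lambda>t. indicator {a - c..b + c} t * shifted_cdf g (\<lambda>_. d) (x, t))"
    unfolding F[symmetric] using lborel_pair.integrable_fst'[OF int] by (simp only: prod.case)
  have "(\<integral>t. indicator {a - c..b + c} t * shifted_cdf g (\<lambda>_. d) (x, t) \<partial>lborel)
    = (\<integral>y. \<integral>t. ?f t y \<partial>lborel \<partial>lborel)"
    unfolding F[symmetric] using lborel_pair.Fubini_integral[OF int] by simp
  also have "\<dots> = (\<integral>y. g (x, y) * (b + c - y - d) \<partial>lborel)"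
  proof (rule Bochner_Integration.integral_cong[OF refl])
    fix y
    show "(\<integral>t. ?f t y \<partial>lborel) = g (x, y) * (b + c - y - d)"
    proof (cases "y \<in> {a..b}")
      case True
      then have "a - c \<le> y + d" "y + d \<le> b + c" using assms(3) by auto
      then have "?f t y = indicator {y + d..b + c} t * g (x, y)" for t by (auto simp: indicator_def)
      then show ?thesis using \<open>y + d \<le> b + c\<close> by simp
    next
      case False
      then have g0: "g (x, y) = 0" using strip_boundedD(3)[OF g, of "(x, y)"] by simp
      then have z: "(\<lambda>t. ?f t y) = (\<lambda>_. 0)" by (auto simp: fun_eq_iff)
      show ?thesis unfolding z using g0 by simp
    qed
  qed
  finally show "(\<integral>t. indicator {a - c..b + c} t * shifted_cdf g (\<lambda>_. d) (x, t) \<partial>lborel)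
      = (\<integral>y. g (x, y) * (b + c - y - d) \<partial>lborel)" .
qed

lemma cdf_family_shifted:
  assumes ab: "a \<le> b" "0 \<le> c" and g: "strip_bounded a b g" and g0: "\<And>z. 0 \<le> g z"
    and D[measurable]: "D \<in> borel_measurable (borel \<Otimes>\<^sub>M borel)" and Dc: "\<And>z. \<bar>D z\<bar> \<le> c"
    and mass: "\<And>x. (\<integral>y. g (x, y) \<partial>lborel) = 1"
  shows "cdf_family (a - c) (b + c) (shifted_cdf g D)"
proof -
  have [measurable]: "g \<in> borel_measurable (borel \<Otimes>\<^sub>M borel)" by (rule strip_boundedD[OF g])
  show ?thesis
    unfolding cdf_family_def
    using ab shifted_cdf_mono[OF g g0 D] shifted_cdf_right_cont[OF g D] shifted_cdf_below[OF g Dc]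
      shifted_cdf_above[OF g Dc] mass
    by (auto intro!: monoI shifted_cdf_measurable)
qed

lemma quantile_integral:
  assumes G: "cdf_family a b G" and G': "cdf_family a b G'"
    and eq: "(\<integral>\<^sup>+ t. ennreal (indicator {a..b} t * G (x, t)) \<partial>lborel) = (\<integral>\<^sup>+ t. ennreal (indicator {a..b} t * G' (x, t)) \<partial>lborel)"
  shows "(\<integral>u. quantile G x u \<partial>unit_law) = (\<integral>u. quantile G' x u \<partial>unit_law)"
proof -
  have int: "integrable unit_law (quantile H x)" if H: "cdf_family a b H" for H
  proof (rule unit_law.integrable_const_bound[where B="\<bar>a\<bar> + \<bar>b\<bar>"])
    show "AE u in unit_law. norm (quantile H x u) \<le> \<bar>a\<bar> + \<bar>b\<bar>"
      using AE_unit_law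
    proof eventually_elim
      case (elim u)
      then show ?case using quantile_range[OF H, of u x] by auto
    qed
    show "quantile H x \<in> borel_measurable unit_law" using quantile_measurable2[OF H] by simp
  qed
  have nn: "(\<integral>\<^sup>+ u. ennreal (b - quantile H x u) \<partial>unit_law) = ennreal (b - (\<integral>u. quantile H x u \<partial>unit_law))"
    and le: "(\<integral>u. quantile H x u \<partial>unit_law) \<le> b" if H: "cdf_family a b H" for H
  proof -
    have pos: "AE u in unit_law. 0 \<le> b - quantile H x u"
      using AE_unit_law by eventually_elim (use quantile_range[OF H, of _ x] in auto)
    have "(\<integral>\<^sup>+ u. ennreal (b - quantile H x u) \<partial>unit_law) = ennreal (\<integral>u. b - quantile H x u \<partial>unit_law)"
      by (rule nn_integral_eq_integral[OF _ pos]) (use int[OF H] in auto)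
    moreover have "(\<integral>u. b - quantile H x u \<partial>unit_law) = b - (\<integral>u. quantile H x u \<partial>unit_law)"
      using int[OF H] unit_law.prob_space by simp
    ultimately show "(\<integral>\<^sup>+ u. ennreal (b - quantile H x u) \<partial>unit_law) = ennreal (b - (\<integral>u. quantile H x u \<partial>unit_law))"
      by simp
    show "(\<integral>u. quantile H x u \<partial>unit_law) \<le> b"
      using integral_nonneg_AE[OF pos] \<open>(\<integral>u. b - quantile H x u \<partial>unit_law) = _\<close> by simp
  qed
  have "ennreal (b - (\<integral>u. quantile G x u \<partial>unit_law)) = ennreal (b - (\<integral>u. quantile G' x u \<partial>unit_law))"
    unfolding nn[OF G, symmetric] nn[OF G', symmetric] quantile_mean[OF G] quantile_mean[OF G'] by (rule eq)
  then show ?thesis using le[OF G] le[OF G'] by (subst (asm) ennreal_inj) auto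
qed

lemma integral_qlaw:
  fixes f :: "real \<times> real \<Rightarrow> real"
  assumes G: "cdf_family a b G" and [measurable]: "f \<in> borel_measurable borel"
  shows "(\<integral>z. f z \<partial>qlaw G) = (\<integral>z. f (fst z, quantile G (fst z) (snd z)) \<partial>W)"
    and "integrable (qlaw G) f \<longleftrightarrow> integrable W (\<lambda>z. f (fst z, quantile G (fst z) (snd z)))"
  unfolding qlaw_def
  by (subst integral_distr[OF qmap_measurable[OF G] assms(2)], simp add: qmap_def)
     (subst integrable_distr_eq[OF qmap_measurable[OF G] assms(2)], simp add: qmap_def)

lemma marg1_qlaw:
  assumes G: "cdf_family a b G"
  shows "marg1 (qlaw G) = \<mu>1"
proof -
  have f: "fst \<in> borel_measurable (borel :: (real \<times> real) measure)"
    by (intro borel_measurable_continuous_onI continuous_intros)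
  have "marg1 (qlaw G) = distr W borel fst"
    unfolding marg1_def qlaw_def using qmap_measurable[OF G] f
    by (subst distr_distr) (auto simp: comp_def qmap_def)
  also have "\<dots> = \<mu>1"
  proof (rule measure_eqI)
    fix A assume "A \<in> sets (distr W borel fst)"
    then have A: "A \<in> sets \<mu>1" by simp
    have "emeasure (distr W borel fst) A = emeasure W (A \<times> UNIV)"
      using A by (subst emeasure_distr) (auto simp: space_pair_measure intro!: arg_cong[where f="emeasure W"])
    also have "\<dots> = emeasure \<mu>1 A"
      using A unit_law.emeasure_space_1 by (subst unit_law.emeasure_pair_measure_Times) auto
    finally show "emeasure (distr W borel fst) A = emeasure \<mu>1 A" .
  qed simp
  finally show ?thesis .
qed

lemma marg2_qlaw_eq:
  assumes G: "cdf_family a b G" and G': "cdf_family a' b' G'"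
    and eq: "\<And>t. (\<integral>\<^sup>+ x. ennreal (G (x, t)) \<partial>\<mu>1) = (\<integral>\<^sup>+ x. ennreal (G' (x, t)) \<partial>\<mu>1)"
  shows "marg2 (qlaw G) = marg2 (qlaw G')"
proof -
  have s: "snd \<in> borel_measurable (borel :: (real \<times> real) measure)"
    by (intro borel_measurable_continuous_onI continuous_intros)
  have rd: "real_distribution (marg2 (qlaw H))" if "prob_space (qlaw H)" for H
  proof -
    interpret H: prob_space "qlaw H" by fact
    show ?thesis unfolding marg2_def
      by (rule H.real_distribution_distr) (use s in \<open>simp add: measurable_cong_sets[OF sets_qlaw refl]\<close>)
  qed
  have c: "emeasure (marg2 (qlaw H)) {..t} = (\<integral>\<^sup>+ x. ennreal (H (x, t)) \<partial>\<mu>1)" if H: "cdf_family a b H" for H a b t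
  proof -
    have "emeasure (marg2 (qlaw H)) {..t} = emeasure (qlaw H) (UNIV \<times> {..t})"
      unfolding marg2_def using s
      by (subst emeasure_distr) (auto simp: measurable_cong_sets[OF sets_qlaw refl] sets_eq_imp_space_eq[OF sets_qlaw]
          intro!: arg_cong[where f="emeasure (qlaw H)"])
    then show ?thesis using emeasure_qlaw[OF H, of UNIV] by simp
  qed
  show ?thesis
  proof (rule cdf_unique[OF rd[OF prob_space_qlaw[OF G]] rd[OF prob_space_qlaw[OF G']]], rule ext)
    show "cdf (marg2 (qlaw G)) t = cdf (marg2 (qlaw G')) t" for t
      unfolding cdf_def measure_def c[OF G] c[OF G'] eq ..
  qed
qed

text \<open>Averages over x determine the second marginal, and areas at fixed x determine the
  conditional means. As \<open>qlaw G'\<close> has the same conditional means as the martingale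
  measure \<open>qlaw G\<close>, the martingale property carries over.\<close>

lemma Pi_M_qlaw:
  assumes G: "cdf_family a b G" and G': "cdf_family a b G'"
    and marg: "\<And>t. (\<integral>\<^sup>+ x. ennreal (G (x, t)) \<partial>\<mu>1) = (\<integral>\<^sup>+ x. ennreal (G' (x, t)) \<partial>\<mu>1)"
    and mean: "\<And>x. (\<integral>\<^sup>+ t. ennreal (indicator {a..b} t * G (x, t)) \<partial>lborel) = (\<integral>\<^sup>+ t. ennreal (indicator {a..b} t * G' (x, t)) \<partial>lborel)"
    and mart: "martingale_measure (qlaw G)"
  shows "qlaw G' \<in> Pi_M (marg1 (qlaw G)) (marg2 (qlaw G))"
proof -
  note [measurable] = quantile_measurable[OF G] quantile_measurable[OF G']
  have fm[measurable]: "fst \<in> borel_measurable (borel :: (real \<times> real) measure)" "snd \<in> borel_measurable (borel :: (real \<times> real) measure)"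
    by (intro borel_measurable_continuous_onI continuous_intros)+
  have intq: "integrable W (\<lambda>z. indicator B (fst z) * quantile H (fst z) (snd z))"
    if H: "cdf_family a b H" and [measurable]: "B \<in> sets borel" for H B
  proof (rule W.P.integrable_const_bound[where B="\<bar>a\<bar> + \<bar>b\<bar>"])
    note [measurable] = quantile_measurable[OF H]
    have "AE x in \<mu>1. AE u in unit_law. norm (indicator B x * quantile H x u) \<le> \<bar>a\<bar> + \<bar>b\<bar>"
    proof (rule AE_I2)
      fix x
      show "AE u in unit_law. norm (indicator B x * quantile H x u) \<le> \<bar>a\<bar> + \<bar>b\<bar>"
        using AE_unit_law
      proof eventually_elim
        case (elim u)
        then have "\<bar>quantile H x u\<bar> \<le> \<bar>a\<bar> + \<bar>b\<bar>" using quantile_range[OF H, of u x] by auto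
        then show ?case by (auto simp: indicator_def)
      qed
    qed
    then show "AE z in W. norm (indicator B (fst z) * quantile H (fst z) (snd z)) \<le> \<bar>a\<bar> + \<bar>b\<bar>"
      by (subst (asm) W.AE_pair_iff) measurable
    show "(\<lambda>z. indicator B (fst z) * quantile H (fst z) (snd z)) \<in> borel_measurable W" by measurable
  qed
  have Eq: "(\<integral>z. indicator B (fst z) * snd z \<partial>qlaw H) = (\<integral>x. indicator B x * (\<integral>u. quantile H x u \<partial>unit_law) \<partial>\<mu>1)"
    if H: "cdf_family a b H" and B[measurable]: "B \<in> sets borel" for H B
  proof -
    have "(\<integral>z. indicator B (fst z) * snd z \<partial>qlaw H) = (\<integral>z. indicator B (fst z) * quantile H (fst z) (snd z) \<partial>W)"
      using integral_qlaw(1)[OF H, of "\<lambda>z. indicator B (fst z) * snd z"] by simp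
    also have "\<dots> = (\<integral>x. \<integral>u. indicator B x * quantile H x u \<partial>unit_law \<partial>\<mu>1)"
      using W.integral_fst'[OF intq[OF H B]] by simp
    finally show ?thesis by simp
  qed
  have E1: "(\<integral>z. indicator B (fst z) * fst z \<partial>qlaw H) = (\<integral>z. indicator B (fst z) * fst z \<partial>W)"
    if H: "cdf_family a b H" and [measurable]: "B \<in> sets borel" for H B
    using integral_qlaw(1)[OF H, of "\<lambda>z. indicator B (fst z) * fst z"] by simp
  have mG: "prob_space (qlaw G)" "integrable (qlaw G) fst" "integrable (qlaw G) snd"
    "AE x in qlaw G. cexp (qlaw G) fst snd x = fst x"
    using mart by (auto simp: martingale_measure_def)
  have "martingale_measure (qlaw G')"
  proof (rule martingale_measureI)
    show "prob_space (qlaw G')" by (rule prob_space_qlaw[OF G'])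
    show "integrable (qlaw G') fst"
      using mG(2) integral_qlaw(2)[OF G fm(1)] integral_qlaw(2)[OF G' fm(1)] by simp
    show "integrable (qlaw G') snd"
      using intq[OF G', of UNIV] integral_qlaw(2)[OF G' fm(2)] by simp
    fix B :: "real set" assume B: "B \<in> sets borel"
    have "(\<integral>z. indicator B (fst z) * snd z \<partial>qlaw G') = (\<integral>z. indicator B (fst z) * snd z \<partial>qlaw G)"
      unfolding Eq[OF G B] Eq[OF G' B] using quantile_integral[OF G G' mean] by simp
    also have "\<dots> = (\<integral>z. indicator B (fst z) * fst z \<partial>qlaw G)"
      using cexp_set_integral[OF mG(1) _ mG(3), of fst "\<lambda>x. x" B] mG(4) B fm(1) sets_qlaw[of G]
      by (simp add: measurable_cong_sets[OF sets_qlaw refl])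
    finally show "(\<integral>z. indicator B (fst z) * snd z \<partial>qlaw G') = (\<integral>z. indicator B (fst z) * fst z \<partial>qlaw G')"
      using E1[OF G B] E1[OF G' B] by simp
  qed simp
  then show ?thesis
    using marg1_qlaw[OF G] marg1_qlaw[OF G'] marg2_qlaw_eq[OF G G' marg] by (simp add: Pi_M_def)
qed

end

subsection \<open>A tilted reversible walk\<close>

text \<open>Here \<theta> is a version of the direction whose two conditional integrals vanish at
  every point, as the walk is built for each x and t separately; \<Theta> is only a bound for
  |\<theta>|.\<close>

locale null_direction = disintegrated +
  fixes \<theta> :: "real \<times> real \<Rightarrow> real" and \<Theta> :: real
  assumes \<theta>_measurable[measurable]: "\<theta> \<in> borel_measurable (borel \<Otimes>\<^sub>M borel)"
    and \<theta>_le: "\<And>z. \<bar>\<theta> z\<bar> \<le> \<Theta>" and \<Theta>_pos: "0 < \<Theta>"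
    and \<theta>_x: "\<And>x. (\<integral>y. \<kappa> (x, y) * \<theta> (x, y) \<partial>lborel) = 0"
    and \<theta>_y: "\<And>y. (\<integral>x. \<kappa> (x, y) * \<theta> (x, y) \<partial>\<mu>1) = 0"
begin

text \<open>Each untilted jump probability is then at most 1/4, and so is a tilt bounded by w q0;
  the two jump probabilities stay below 1 in total.\<close>

definition w :: real where "w = 1 / (4 * q1)"

definition lower_half :: "real \<Rightarrow> real" where
  "lower_half y = (if y \<le> (a + b) / 2 then 1 else 0)"

text \<open>Jump probabilities of size \<open>\<plusminus>s\<close>. For \<open>\<Psi> = 0\<close> they are reversible with respect to \<open>q\<close>;
  the tilt \<open>\<Psi>\<close> acts on up-jumps in the lower half of \<open>[a, b]\<close> and on down-jumps in the upper half, so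
  that no jump leaves \<open>[a, b]\<close>.\<close>

definition up :: "real \<Rightarrow> (real \<times> real \<Rightarrow> real) \<Rightarrow> real \<times> real \<Rightarrow> real" where
  "up s \<Psi> z = w * q (snd z + s) + lower_half (snd z) * \<Psi> z"

definition dn :: "real \<Rightarrow> (real \<times> real \<Rightarrow> real) \<Rightarrow> real \<times> real \<Rightarrow> real" where
  "dn s \<Psi> z = w * q (snd z - s) - (1 - lower_half (snd z)) * \<Psi> z"

text \<open>The randomness of the jump is put into the densities: each of the three parts has a
  constant displacement, to which the first-order expansion for constant d applies.\<close>

definition walk :: "real \<Rightarrow> (real \<times> real \<Rightarrow> real) \<Rightarrow> real \<times> real \<Rightarrow> real" where
  "walk s \<Psi> z = shifted_cdf (\<lambda>z. \<kappa> z * up s \<Psi> z) (\<lambda>_. s) z + shifted_cdf (\<lambda>z. \<kappa> z * dn s \<Psi> z) (\<lambda>_. - s) z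
     + shifted_cdf (\<lambda>z. \<kappa> z * (1 - up s \<Psi> z - dn s \<Psi> z)) (\<lambda>_. 0) z"

lemma w_pos: "0 < w"
  unfolding w_def using q_bounds(1) q0_le_q1 by simp

lemma lower_half_measurable[measurable]: "lower_half \<in> borel_measurable borel"
  unfolding lower_half_def[abs_def] by measurable

lemma lower_half_range: "0 \<le> lower_half y" "lower_half y \<le> 1"
  by (auto simp: lower_half_def)

lemma up_measurable[measurable]:
  "\<Psi> \<in> borel_measurable (borel \<Otimes>\<^sub>M borel) \<Longrightarrow> up s \<Psi> \<in> borel_measurable (borel \<Otimes>\<^sub>M borel)"
  unfolding up_def[abs_def] by measurable

lemma dn_measurable[measurable]:
  "\<Psi> \<in> borel_measurable (borel \<Otimes>\<^sub>M borel) \<Longrightarrow> dn s \<Psi> \<in> borel_measurable (borel \<Otimes>\<^sub>M borel)"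
  unfolding dn_def[abs_def] by measurable

lemma up_dn_abs_le:
  assumes "\<And>z. \<bar>\<Psi> z\<bar> \<le> B"
  shows "\<bar>up s \<Psi> z\<bar> \<le> w * q1 + B" "\<bar>dn s \<Psi> z\<bar> \<le> w * q1 + B"
proof -
  have 1: "\<bar>w * q y\<bar> \<le> w * q1" for y
    using w_pos q_nonneg[of y] q_le[of y] by (simp add: abs_mult mult_left_mono)
  have 2: "\<bar>lower_half (snd z) * \<Psi> z\<bar> \<le> B" "\<bar>(1 - lower_half (snd z)) * \<Psi> z\<bar> \<le> B"
    using assms[of z] by (auto simp: lower_half_def)
  show "\<bar>up s \<Psi> z\<bar> \<le> w * q1 + B" unfolding up_def
    by (rule order_trans[OF abs_triangle_ineq add_mono[OF 1 2(1)]])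
  show "\<bar>dn s \<Psi> z\<bar> \<le> w * q1 + B" unfolding dn_def
    by (rule order_trans[OF abs_triangle_ineq4 add_mono[OF 1 2(2)]])
qed

lemma strip_up_dn:
  assumes [measurable]: "\<Psi> \<in> borel_measurable (borel \<Otimes>\<^sub>M borel)" and B: "\<And>z. \<bar>\<Psi> z\<bar> \<le> B"
  shows "strip_bounded a b (\<lambda>z. \<kappa> z * up s \<Psi> z)" "strip_bounded a b (\<lambda>z. \<kappa> z * dn s \<Psi> z)"
    "strip_bounded a b (\<lambda>z. \<kappa> z * (1 - up s \<Psi> z - dn s \<Psi> z))"
proof -
  note ud = up_dn_abs_le[OF B, of s]
  show u: "strip_bounded a b (\<lambda>z. \<kappa> z * up s \<Psi> z)" and d: "strip_bounded a b (\<lambda>z. \<kappa> z * dn s \<Psi> z)"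
    by (rule strip_bounded_mult[OF \<kappa>_strip _ ud(1)] strip_bounded_mult[OF \<kappa>_strip _ ud(2)]; measurable)+
  show "strip_bounded a b (\<lambda>z. \<kappa> z * (1 - up s \<Psi> z - dn s \<Psi> z))"
    using strip_bounded_diff[OF strip_bounded_diff[OF \<kappa>_strip u] d] by (simp add: algebra_simps)
qed

section \<open>Exactness of the walk: jump probabilities, second marginal, conditional means\<close>

context
  fixes s :: real and \<Psi> :: "real \<times> real \<Rightarrow> real"
  assumes s: "0 < s" "s < (b - a) / 2"
    and \<Psi>_measurable[measurable]: "\<Psi> \<in> borel_measurable (borel \<Otimes>\<^sub>M borel)"
    and \<Psi>_le: "\<And>z. \<bar>\<Psi> z\<bar> \<le> w * q0"
    and \<Psi>_y: "\<And>y. (\<integral>x. \<kappa> (x, y) * \<Psi> (x, y) \<partial>\<mu>1) = 0"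
    and \<Psi>_x: "\<And>x. (\<integral>y. \<kappa> (x, y) * \<Psi> (x, y) \<partial>lborel) = - w * (\<integral>y. \<kappa> (x, y) * (q (y + s) - q (y - s)) \<partial>lborel)"
begin

text \<open>The tilted jump goes inwards, and s < (b - a) / 2 keeps its target in [a, b], where w q
  is at least w q0 and absorbs the tilt. The other jump is untilted.\<close>

lemma up_dn_prob:
  assumes z: "snd z \<in> {a..b}"
  shows "0 \<le> up s \<Psi> z" "0 \<le> dn s \<Psi> z" "up s \<Psi> z + dn s \<Psi> z \<le> 1"
proof -
  have P: "- (w * q0) \<le> \<Psi> z" "\<Psi> z \<le> w * q0" using \<Psi>_le[of z] by auto
  have q: "0 \<le> w * q y" "w * q y \<le> w * q1" for y
    using w_pos q_nonneg[of y] q_le[of y] by auto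
  have wq: "w * q1 = 1 / 4" unfolding w_def using q_bounds(1) q0_le_q1 by simp
  have wq0: "w * q0 \<le> 1 / 4" using w_pos q0_le_q1 mult_left_mono[of q0 q1 w] wq by simp
  show "0 \<le> up s \<Psi> z"
  proof (cases "snd z \<le> (a + b) / 2")
    case True
    then have "snd z + s \<in> {a..b}" using z s by (auto simp: field_simps)
    then have "w * q0 \<le> w * q (snd z + s)" using q_bounds(2) w_pos by simp
    then show ?thesis using P True by (simp add: up_def lower_half_def)
  qed (use q in \<open>simp add: up_def lower_half_def\<close>)
  show "0 \<le> dn s \<Psi> z"
  proof (cases "snd z \<le> (a + b) / 2")
    case False
    then have "snd z - s \<in> {a..b}" using z s by (auto simp: field_simps)
    then have "w * q0 \<le> w * q (snd z - s)" using q_bounds(2) w_pos by simp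
    then show ?thesis using P False by (simp add: dn_def lower_half_def)
  qed (use q in \<open>simp add: dn_def lower_half_def\<close>)
  show "up s \<Psi> z + dn s \<Psi> z \<le> 1"
    using P q(2)[of "snd z + s"] q(2)[of "snd z - s"] wq wq0
    by (cases "snd z \<le> (a + b) / 2") (auto simp: up_def dn_def lower_half_def)
qed

lemma \<kappa>_up_dn_nonneg: "0 \<le> \<kappa> z * up s \<Psi> z" "0 \<le> \<kappa> z * dn s \<Psi> z" "0 \<le> \<kappa> z * (1 - up s \<Psi> z - dn s \<Psi> z)"
  using up_dn_prob[of z] \<kappa>_nonneg[of z] \<kappa>_supp[of z] by (cases "snd z \<in> {a..b}"; simp)+

lemmas strips = strip_up_dn[OF \<Psi>_measurable \<Psi>_le, of s]

lemma shifted_cdf_split: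
  assumes "D \<in> borel_measurable (borel \<Otimes>\<^sub>M borel)"
  shows "shifted_cdf \<kappa> D z = shifted_cdf (\<lambda>z. \<kappa> z * up s \<Psi> z) D z + shifted_cdf (\<lambda>z. \<kappa> z * dn s \<Psi> z) D z
     + shifted_cdf (\<lambda>z. \<kappa> z * (1 - up s \<Psi> z - dn s \<Psi> z)) D z"
proof -
  have "(\<lambda>z. \<kappa> z * up s \<Psi> z + \<kappa> z * dn s \<Psi> z + \<kappa> z * (1 - up s \<Psi> z - dn s \<Psi> z)) = \<kappa>"
    by (auto simp: algebra_simps)
  then have "shifted_cdf \<kappa> D z = shifted_cdf (\<lambda>z. \<kappa> z * up s \<Psi> z + \<kappa> z * dn s \<Psi> z + \<kappa> z * (1 - up s \<Psi> z - dn s \<Psi> z)) D z"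
    by simp
  also have "\<dots> = shifted_cdf (\<lambda>z. \<kappa> z * up s \<Psi> z) D z + shifted_cdf (\<lambda>z. \<kappa> z * dn s \<Psi> z) D z
     + shifted_cdf (\<lambda>z. \<kappa> z * (1 - up s \<Psi> z - dn s \<Psi> z)) D z"
    by (subst shifted_cdf_add[OF strip_bounded_add[OF strips(1,2)] strips(3) assms],
        subst shifted_cdf_add[OF strips(1,2) assms]) simp
  finally show ?thesis .
qed

lemma walk_near:
  "walk s \<Psi> (x, t) \<le> shifted_cdf \<kappa> (\<lambda>_. 0) (x, t + s)" "shifted_cdf \<kappa> (\<lambda>_. 0) (x, t) \<le> walk s \<Psi> (x, t + s)"
  unfolding walk_def shifted_cdf_split[of "\<lambda>_. 0", simplified]
  by (intro add_mono shifted_cdf_le[OF strips(1) \<kappa>_up_dn_nonneg(1)] shifted_cdf_le[OF strips(2) \<kappa>_up_dn_nonneg(2)]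
      shifted_cdf_le[OF strips(3) \<kappa>_up_dn_nonneg(3)]; use s in simp)+

lemma cdf_family_walk:
  assumes c: "s \<le> c"
  shows "cdf_family (a - c) (b + c) (walk s \<Psi>)"
proof -
  have S: "\<bar>s\<bar> \<le> c" "\<bar>- s\<bar> \<le> c" "\<bar>0\<bar> \<le> c" using s c by auto
  have "walk s \<Psi> \<in> borel_measurable (borel \<Otimes>\<^sub>M borel)"
    unfolding walk_def[abs_def] by measurable
  moreover have "mono (\<lambda>t. walk s \<Psi> (x, t))" for x
    unfolding walk_def
    by (intro monoI add_mono shifted_cdf_mono[OF strips(1) \<kappa>_up_dn_nonneg(1)]
        shifted_cdf_mono[OF strips(2) \<kappa>_up_dn_nonneg(2)] shifted_cdf_mono[OF strips(3) \<kappa>_up_dn_nonneg(3)]; simp)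
  moreover have "continuous (at_right t) (\<lambda>t. walk s \<Psi> (x, t))" for x t
    unfolding walk_def
    by (intro continuous_add shifted_cdf_right_cont[OF strips(1)] shifted_cdf_right_cont[OF strips(2)]
        shifted_cdf_right_cont[OF strips(3)]; simp)
  moreover have "walk s \<Psi> (x, t) = 0" if "t < a - c" for x t
    unfolding walk_def using that S
    by (simp add: shifted_cdf_below[OF strips(1), of _ c] shifted_cdf_below[OF strips(2), of _ c]
        shifted_cdf_below[OF strips(3), of _ c])
  moreover have "walk s \<Psi> (x, t) = 1" if t: "b + c \<le> t" for x t
  proof -
    have "walk s \<Psi> (x, t) = (\<integral>y. \<kappa> (x, y) * up s \<Psi> (x, y) \<partial>lborel) + (\<integral>y. \<kappa> (x, y) * dn s \<Psi> (x, y) \<partial>lborel)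
       + (\<integral>y. \<kappa> (x, y) * (1 - up s \<Psi> (x, y) - dn s \<Psi> (x, y)) \<partial>lborel)"
      unfolding walk_def using t S
      by (simp add: shifted_cdf_above[OF strips(1), of _ c] shifted_cdf_above[OF strips(2), of _ c]
          shifted_cdf_above[OF strips(3), of _ c])
    also have "\<dots> = shifted_cdf \<kappa> (\<lambda>_. 0) (x, t)"
      using t s c
      by (simp add: shifted_cdf_split shifted_cdf_above[OF strips(1), of _ 0] shifted_cdf_above[OF strips(2), of _ 0]
          shifted_cdf_above[OF strips(3), of _ 0])
    also have "\<dots> = 1"
      using t s c \<kappa>_mass[of x] by (subst shifted_cdf_above[OF \<kappa>_strip, of _ 0]) auto
    finally show ?thesis .
  qed
  ultimately show ?thesis
    unfolding cdf_family_def using ab s c by auto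
qed

text \<open>The factor \<open>lower_half\<close> depends on y alone, so \<Psi> averages out given y
  even after being split between the two jumps. What remains is the reversible part.\<close>

lemma up_dn_integral_x:
  "(\<integral>x. \<kappa> (x, y) * up s \<Psi> (x, y) \<partial>\<mu>1) = w * (q y * q (y + s))"
  "(\<integral>x. \<kappa> (x, y) * dn s \<Psi> (x, y) \<partial>\<mu>1) = w * (q y * q (y - s))"
  "(\<integral>x. \<kappa> (x, y) * (1 - up s \<Psi> (x, y) - dn s \<Psi> (x, y)) \<partial>\<mu>1) = q y - w * (q y * q (y + s)) - w * (q y * q (y - s))"
proof -
  have i: "integrable \<mu>1 (\<lambda>x. \<kappa> (x, y) * \<Psi> (x, y))"
  proof (rule integrable_const_bound[where B="K * (w * q0)"])
    show "AE x in \<mu>1. norm (\<kappa> (x, y) * \<Psi> (x, y)) \<le> K * (w * q0)"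
      using \<kappa>_nonneg \<kappa>_le \<Psi>_le K_pos by (auto simp: abs_mult intro!: mult_mono)
  qed measurable
  have e: "(\<lambda>x. \<kappa> (x, y) * up s \<Psi> (x, y)) = (\<lambda>x. \<kappa> (x, y) * (w * q (y + s)) + lower_half y * (\<kappa> (x, y) * \<Psi> (x, y)))"
    "(\<lambda>x. \<kappa> (x, y) * dn s \<Psi> (x, y)) = (\<lambda>x. \<kappa> (x, y) * (w * q (y - s)) - (1 - lower_half y) * (\<kappa> (x, y) * \<Psi> (x, y)))"
    by (auto simp: up_def dn_def algebra_simps)
  have iu: "integrable \<mu>1 (\<lambda>x. \<kappa> (x, y) * up s \<Psi> (x, y))" and id: "integrable \<mu>1 (\<lambda>x. \<kappa> (x, y) * dn s \<Psi> (x, y))"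
    unfolding e by (intro Bochner_Integration.integrable_add Bochner_Integration.integrable_diff
        integrable_mult_left integrable_mult_right \<kappa>_int_x i)+
  show u: "(\<integral>x. \<kappa> (x, y) * up s \<Psi> (x, y) \<partial>\<mu>1) = w * (q y * q (y + s))"
    unfolding e by (subst Bochner_Integration.integral_add) (auto simp: i \<kappa>_int_x \<kappa>_marg \<Psi>_y)
  show d: "(\<integral>x. \<kappa> (x, y) * dn s \<Psi> (x, y) \<partial>\<mu>1) = w * (q y * q (y - s))"
    unfolding e by (subst Bochner_Integration.integral_diff) (auto simp: i \<kappa>_int_x \<kappa>_marg \<Psi>_y)
  have "(\<integral>x. \<kappa> (x, y) * (1 - up s \<Psi> (x, y) - dn s \<Psi> (x, y)) \<partial>\<mu>1)
    = (\<integral>x. \<kappa> (x, y) - \<kappa> (x, y) * up s \<Psi> (x, y) - \<kappa> (x, y) * dn s \<Psi> (x, y) \<partial>\<mu>1)"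
    by (simp add: algebra_simps)
  then show "(\<integral>x. \<kappa> (x, y) * (1 - up s \<Psi> (x, y) - dn s \<Psi> (x, y)) \<partial>\<mu>1) = q y - w * (q y * q (y + s)) - w * (q y * q (y - s))"
    using iu id \<kappa>_int_x[of y] by (simp add: \<kappa>_marg u d)
qed

lemma q_strip: "strip_bounded a b (\<lambda>z. q (snd z))"
  unfolding strip_bounded_def using q_nonneg q_le q_supp by (auto intro!: exI[of _ q1])

text \<open>Detailed balance: the mass density jumping from y up to y + s, namely w q(y) q(y + s),
  equals that jumping from y + s down to y, and a translation of the variable exchanges the
  two.\<close>

lemma walk_marginal:
  "(\<integral>x. walk s \<Psi> (x, t) \<partial>\<mu>1) = (\<integral>x. shifted_cdf \<kappa> (\<lambda>_. 0) (x, t) \<partial>\<mu>1)"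
proof -
  let ?r = "\<lambda>y. w * (q y * q (y + s))" and ?l = "\<lambda>y. w * (q y * q (y - s))"
  have ab': "a \<le> b" using ab by simp
  have iq: "integrable lborel q" using strip_bounded_integrable[OF q_strip] by simp
  have ir: "integrable lborel ?r" and il: "integrable lborel ?l"
    using strip_bounded_integrable[OF strip_bounded_mult[OF q_strip, of "\<lambda>z. q (snd z + s)" q1], of 0]
      strip_bounded_integrable[OF strip_bounded_mult[OF q_strip, of "\<lambda>z. q (snd z - s)" q1], of 0] q_nonneg q_le
    by (auto intro!: integrable_mult_right)
  have it: "integrable lborel (\<lambda>y. if y + d \<le> t then f y else 0)" if "integrable lborel f" for f :: "real \<Rightarrow> real" and d
    by (rule Bochner_Integration.integrable_bound[OF that]) (use that in auto)
  have "(\<integral>x. walk s \<Psi> (x, t) \<partial>\<mu>1) = (\<integral>y. (if y + s \<le> t then ?r y else 0) \<partial>lborel)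
      + (\<integral>y. (if y + - s \<le> t then ?l y else 0) \<partial>lborel)
      + (\<integral>y. (if y + 0 \<le> t then q y - ?r y - ?l y else 0) \<partial>lborel)"
    unfolding walk_def
    by (simp only: Bochner_Integration.integral_add Bochner_Integration.integrable_add
        shifted_cdf_integrable_x[OF ab' strips(1)] shifted_cdf_integrable_x[OF ab' strips(2)]
        shifted_cdf_integrable_x[OF ab' strips(3)] borel_measurable_const
        shifted_cdf_integral_x[OF ab' strips(1)] shifted_cdf_integral_x[OF ab' strips(2)]
        shifted_cdf_integral_x[OF ab' strips(3)] up_dn_integral_x)
  also have "(\<integral>y. (if y + s \<le> t then ?r y else 0) \<partial>lborel) = (\<integral>y. (if y + 0 \<le> t then ?l y else 0) \<partial>lborel)"
    by (subst lborel_integral_real_affine[of 1 _ "- s"]) (auto simp: mult.commute intro!: Bochner_Integration.integral_cong)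
  also have "(\<integral>y. (if y + - s \<le> t then ?l y else 0) \<partial>lborel) = (\<integral>y. (if y + 0 \<le> t then ?r y else 0) \<partial>lborel)"
    by (subst lborel_integral_real_affine[of 1 _ s]) (auto simp: mult.commute add.commute intro!: Bochner_Integration.integral_cong)
  also have "(\<integral>y. (if y + 0 \<le> t then ?l y else 0) \<partial>lborel) + (\<integral>y. (if y + 0 \<le> t then ?r y else 0) \<partial>lborel)
      + (\<integral>y. (if y + 0 \<le> t then q y - ?r y - ?l y else 0) \<partial>lborel) = (\<integral>y. (if y + 0 \<le> t then q y else 0) \<partial>lborel)"
  proof -
    have "(\<lambda>y. if y + 0 \<le> t then q y - ?r y - ?l y else 0)
      = (\<lambda>y. (if y + 0 \<le> t then q y else 0) - (if y + 0 \<le> t then ?r y else 0) - (if y + 0 \<le> t then ?l y else 0))"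
      by auto
    then show ?thesis
      by (simp only: Bochner_Integration.integral_diff Bochner_Integration.integrable_diff it[OF il] it[OF ir] it[OF iq])
  qed
  also have "\<dots> = (\<integral>x. shifted_cdf \<kappa> (\<lambda>_. 0) (x, t) \<partial>\<mu>1)"
    by (simp only: shifted_cdf_integral_x[OF ab' \<kappa>_strip] \<kappa>_marg)
  finally show ?thesis .
qed

text \<open>The tilt enters the up-jump with weight \<open>lower_half\<close> and the down-jump with
  minus the complementary weight, so the difference of the jump probabilities carries all of \<Psi>,
  whose mean given x cancels the drift exactly.\<close>

lemma walk_mean:
  assumes c: "s \<le> c"
  shows "(\<integral>t. indicator {a - c..b + c} t * walk s \<Psi> (x, t) \<partial>lborel)
    = (\<integral>t. indicator {a - c..b + c} t * shifted_cdf \<kappa> (\<lambda>_. 0) (x, t) \<partial>lborel)"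
proof -
  have ab': "a \<le> b" using ab by simp
  have S: "\<bar>s\<bar> \<le> c" "\<bar>- s\<bar> \<le> c" "\<bar>0\<bar> \<le> c" using s c by auto
  let ?u = "\<lambda>y. \<kappa> (x, y) * up s \<Psi> (x, y)" and ?d = "\<lambda>y. \<kappa> (x, y) * dn s \<Psi> (x, y)"
    and ?m = "\<lambda>y. \<kappa> (x, y) * (1 - up s \<Psi> (x, y) - dn s \<Psi> (x, y))"
  have lin: "integrable lborel (\<lambda>y. g (x, y) * (b + c - y - d))" if g: "strip_bounded a b g" for g d
  proof -
    have [measurable]: "g \<in> borel_measurable (borel \<Otimes>\<^sub>M borel)" by (rule strip_boundedD[OF g])
    obtain Kg where Kg: "Kg \<ge> 0" "\<And>z. \<bar>g z\<bar> \<le> Kg" using strip_boundedD(2)[OF g] by auto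
    have "strip_bounded a b (\<lambda>z. g z * (b + c - snd z - d))"
      unfolding strip_bounded_def
    proof (intro conjI allI impI exI)
      let ?B = "\<bar>b + c - d\<bar> + (\<bar>a\<bar> + \<bar>b\<bar>)"
      show "\<bar>g z * (b + c - snd z - d)\<bar> \<le> Kg * ?B" for z
      proof (cases "snd z \<in> {a..b}")
        case True
        then have "\<bar>b + c - snd z - d\<bar> \<le> ?B" by auto
        then show ?thesis unfolding abs_mult by (intro mult_mono Kg) auto
      qed (use strip_boundedD(3)[OF g] Kg in auto)
    qed (use strip_boundedD(3)[OF g] in \<open>auto\<close>)
    from strip_bounded_integrable[OF this, of x] show ?thesis by simp
  qed
  have iu: "integrable lborel ?u" and id: "integrable lborel ?d"
    using strip_bounded_integrable[OF strips(1)] strip_bounded_integrable[OF strips(2)] by auto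
  have zero: "(\<integral>y. ?u y \<partial>lborel) - (\<integral>y. ?d y \<partial>lborel) = 0"
  proof -
    have i1: "integrable lborel (\<lambda>y. \<kappa> (x, y) * (q (y + s) - q (y - s)))"
    proof -
      have "\<bar>q (snd z + s) - q (snd z - s)\<bar> \<le> q1" for z :: "real \<times> real"
        using q_nonneg[of "snd z + s"] q_nonneg[of "snd z - s"] q_le[of "snd z + s"] q_le[of "snd z - s"] by auto
      then have "strip_bounded a b (\<lambda>z. \<kappa> z * (q (snd z + s) - q (snd z - s)))"
        by (rule strip_bounded_mult[OF \<kappa>_strip, rotated]) measurable
      from strip_bounded_integrable[OF this, of x] show ?thesis by simp
    qed
    have i2: "integrable lborel (\<lambda>y. \<kappa> (x, y) * \<Psi> (x, y))"
      using strip_bounded_integrable[OF strip_bounded_mult[OF \<kappa>_strip \<Psi>_measurable \<Psi>_le]] by simp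
    have "(\<integral>y. ?u y \<partial>lborel) - (\<integral>y. ?d y \<partial>lborel) = (\<integral>y. w * (\<kappa> (x, y) * (q (y + s) - q (y - s))) + \<kappa> (x, y) * \<Psi> (x, y) \<partial>lborel)"
      by (subst Bochner_Integration.integral_diff[symmetric, OF iu id])
         (auto simp: up_def dn_def algebra_simps intro!: Bochner_Integration.integral_cong)
    also have "\<dots> = 0"
      using i1 i2 by (subst Bochner_Integration.integral_add) (auto simp: \<Psi>_x)
    finally show ?thesis .
  qed
  have e: "?u y * (b + c - y - s) + ?d y * (b + c - y - - s) + ?m y * (b + c - y - 0)
      = \<kappa> (x, y) * (b + c - y - 0) - s * (?u y - ?d y)" for y
    by (simp add: algebra_simps)
  have "(\<integral>t. indicator {a - c..b + c} t * walk s \<Psi> (x, t) \<partial>lborel)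
    = (\<integral>y. ?u y * (b + c - y - s) \<partial>lborel) + (\<integral>y. ?d y * (b + c - y - - s) \<partial>lborel) + (\<integral>y. ?m y * (b + c - y - 0) \<partial>lborel)"
    unfolding walk_def distrib_left
    by (simp only: Bochner_Integration.integral_add Bochner_Integration.integrable_add
        shifted_cdf_integral_t[OF ab' strips(1) S(1)] shifted_cdf_integral_t[OF ab' strips(2) S(2)]
        shifted_cdf_integral_t[OF ab' strips(3) S(3)])
  also have "\<dots> = (\<integral>y. \<kappa> (x, y) * (b + c - y - 0) - s * (?u y - ?d y) \<partial>lborel)"
    unfolding e[symmetric] using lin[OF strips(1), of s] lin[OF strips(2), of "- s"] lin[OF strips(3), of 0]
    by (simp only: Bochner_Integration.integral_add Bochner_Integration.integrable_add)
  also have "\<dots> = (\<integral>y. \<kappa> (x, y) * (b + c - y - 0) \<partial>lborel) - s * ((\<integral>y. ?u y \<partial>lborel) - (\<integral>y. ?d y \<partial>lborel))"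
    using lin[OF \<kappa>_strip, of 0] iu id
    by (simp only: Bochner_Integration.integral_diff Bochner_Integration.integrable_diff integrable_mult_right
        integral_mult_right_zero)
  also have "\<dots> = (\<integral>t. indicator {a - c..b + c} t * shifted_cdf \<kappa> (\<lambda>_. 0) (x, t) \<partial>lborel)"
    unfolding zero by (simp only: shifted_cdf_integral_t(2)[OF ab' \<kappa>_strip S(3)] mult_zero_right diff_zero)
  finally show ?thesis .
qed

lemma walk_in_Pi_M:
  assumes c: "s \<le> c" and mart: "martingale_measure (qlaw (shifted_cdf \<kappa> (\<lambda>_. 0)))"
  shows "qlaw (walk s \<Psi>) \<in> Pi_M (marg1 (qlaw (shifted_cdf \<kappa> (\<lambda>_. 0)))) (marg2 (qlaw (shifted_cdf \<kappa> (\<lambda>_. 0))))"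
proof (rule Pi_M_qlaw[OF _ cdf_family_walk[OF c] _ _ mart])
  let ?G = "shifted_cdf \<kappa> (\<lambda>_. 0)"
  have ab': "a \<le> b" using ab by simp
  show G: "cdf_family (a - c) (b + c) ?G"
    by (rule cdf_family_shifted[OF ab' _ \<kappa>_strip \<kappa>_nonneg _ _ \<kappa>_mass]) (use s c in auto)
  note W = cdf_family_walk[OF c]
  have [measurable]: "walk s \<Psi> \<in> borel_measurable (borel \<Otimes>\<^sub>M borel)"
    using W by (simp add: cdf_family_def)
  have S: "\<bar>s\<bar> \<le> c" "\<bar>- s\<bar> \<le> c" "\<bar>0\<bar> \<le> c" using s c by auto
  show "(\<integral>\<^sup>+ x. ennreal (?G (x, t)) \<partial>\<mu>1) = (\<integral>\<^sup>+ x. ennreal (walk s \<Psi> (x, t)) \<partial>\<mu>1)" for t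
  proof -
    have "integrable \<mu>1 (\<lambda>x. H (x, t))" if "cdf_family (a - c) (b + c) H" for H
    proof (rule integrable_const_bound[where B=1])
      have [measurable]: "H \<in> borel_measurable (borel \<Otimes>\<^sub>M borel)" using that by (simp add: cdf_family_def)
      show "(\<lambda>x. H (x, t)) \<in> borel_measurable \<mu>1" by measurable
    qed (use cdf_family_range[OF that] in auto)
    from this[OF G] this[OF W] show ?thesis
      using cdf_family_range(1)[OF G] cdf_family_range(1)[OF W]
      by (simp add: nn_integral_eq_integral walk_marginal)
  qed
  show "(\<integral>\<^sup>+ t. ennreal (indicator {a - c..b + c} t * ?G (x, t)) \<partial>lborel)
    = (\<integral>\<^sup>+ t. ennreal (indicator {a - c..b + c} t * walk s \<Psi> (x, t)) \<partial>lborel)" for x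
  proof -
    have i1: "integrable lborel (\<lambda>t. indicator {a - c..b + c} t * ?G (x, t))"
      by (rule shifted_cdf_integral_t(1)[OF ab' \<kappa>_strip S(3)])
    have i2: "integrable lborel (\<lambda>t. indicator {a - c..b + c} t * walk s \<Psi> (x, t))"
      unfolding walk_def distrib_left
      by (intro Bochner_Integration.integrable_add shifted_cdf_integral_t(1)[OF ab' strips(1) S(1)]
          shifted_cdf_integral_t(1)[OF ab' strips(2) S(2)] shifted_cdf_integral_t(1)[OF ab' strips(3) S(3)])
    show ?thesis
      using nn_integral_eq_integral[OF i1] nn_integral_eq_integral[OF i2]
        cdf_family_range(1)[OF G] cdf_family_range(1)[OF W] walk_mean[OF c, of x] by simp
  qed
qed

end

end

subsection \<open>Distance to the walk\<close>

context real_distr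
begin

lemma L1_triangle:
  assumes "f \<in> borel_measurable (borel \<Otimes>\<^sub>M borel)" "g \<in> borel_measurable (borel \<Otimes>\<^sub>M borel)"
    and "L1 f \<le> ennreal x" "L1 g \<le> ennreal y" "0 \<le> x" "0 \<le> y"
  shows "L1 (\<lambda>z. f z + g z) \<le> ennreal (x + y)"
proof -
  have "L1 (\<lambda>z. f z + g z) \<le> L1 f + L1 g" by (rule L1_add_le) (use assms in auto)
  also have "\<dots> \<le> ennreal x + ennreal y" by (intro add_mono assms)
  finally show ?thesis using assms by simp
qed

lemma L1_le_snd:
  assumes [measurable]: "\<phi> \<in> borel_measurable borel" and "\<And>z. \<bar>f z\<bar> \<le> \<phi> (snd z)"
  shows "L1 f \<le> (\<integral>\<^sup>+ y. ennreal (\<phi> y) \<partial>lborel)"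
proof -
  have "L1 f \<le> (\<integral>\<^sup>+ z. ennreal (\<phi> (snd z)) \<partial>M)"
    unfolding L1_def by (intro nn_integral_mono ennreal_leI assms)
  also have "\<dots> = (\<integral>\<^sup>+ x. \<integral>\<^sup>+ y. ennreal (\<phi> y) \<partial>lborel \<partial>\<mu>1)"
    by (subst lborel.nn_integral_fst[symmetric]) auto
  also have "\<dots> = (\<integral>\<^sup>+ y. ennreal (\<phi> y) \<partial>lborel)" using emeasure_space_1 by simp
  finally show ?thesis .
qed

end

section \<open>L^1 continuity of q and the drift of the untilted walk\<close>

context disintegrated
begin

text \<open>An L^1 modulus of continuity of q for both directions of the jump. It includes the drop
  of q to 0 outside [a, b], which a modulus in sup norm would not forgive.\<close>

definition dq :: "real \<Rightarrow> real" where
  "dq s = (\<integral>y. indicator {a..b} y * (\<bar>q (y + s) - q y\<bar> + \<bar>q (y - s) - q y\<bar>) \<partial>lborel)"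

lemma dq_integrable: "integrable lborel (\<lambda>y. indicator {a..b} y * (\<bar>q (y + s) - q y\<bar> + \<bar>q (y - s) - q y\<bar>))"
proof (rule Bochner_Integration.integrable_bound)
  show "integrable lborel (\<lambda>y. (q1 + q1) * indicator {a..b} y)"
    by (intro integrable_mult_right) (simp add: integrable_indicator_iff emeasure_lborel_Icc_eq)
  have 1: "\<bar>q u - q v\<bar> \<le> q1" for u v
    using q_nonneg[of u] q_nonneg[of v] q_le[of u] q_le[of v] by auto
  have "\<bar>\<bar>q (y + s) - q y\<bar> + \<bar>q (y - s) - q y\<bar>\<bar> \<le> q1 + q1" for y
    using 1[of "y + s" y] 1[of "y - s" y] by auto
  then show "AE y in lborel. norm (indicator {a..b} y * (\<bar>q (y + s) - q y\<bar> + \<bar>q (y - s) - q y\<bar>)) \<le> norm ((q1 + q1) * indicator {a..b} y)"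
    using q_bounds(1) q0_le_q1 by (intro AE_I2) (auto simp: indicator_def)
qed measurable

lemma dq_nonneg: "0 \<le> dq s"
  unfolding dq_def by (rule integral_nonneg_AE) (auto simp: indicator_def)

lemma q_isCont:
  assumes "a < y" "y < b"
  shows "isCont q y"
proof -
  have "continuous_on {a<..<b} q"
    by (rule continuous_on_subset[OF q_cont]) auto
  then show ?thesis using assms by (simp add: continuous_on_eq_continuous_at)
qed

text \<open>Dominated convergence; among the points of [a, b], q can be discontinuous on the line
  only at a and b, which form a null set.\<close>

lemma dq_tendsto: "(dq \<longlongrightarrow> 0) (at_right 0)"
proof (rule tendsto_at_right_sequentially[of 0 1])
  fix S :: "nat \<Rightarrow> real" assume S: "\<And>n. 0 < S n" "S \<longlonglongrightarrow> 0"
  have "(\<lambda>n. dq (S n)) \<longlonglongrightarrow> (\<integral>y. 0 \<partial>(lborel :: real measure))"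
    unfolding dq_def
  proof (rule integral_dominated_convergence[where w="\<lambda>y. (q1 + q1) * indicator {a..b} y"])
    show "integrable lborel (\<lambda>y. (q1 + q1) * indicator {a..b} y)"
      by (intro integrable_mult_right) (simp add: integrable_indicator_iff emeasure_lborel_Icc_eq)
    have "AE y in lborel. y \<noteq> a" "AE y in lborel. y \<noteq> b" by (rule AE_lborel_singleton)+
    then show "AE y in lborel. (\<lambda>n. indicator {a..b} y * (\<bar>q (y + S n) - q y\<bar> + \<bar>q (y - S n) - q y\<bar>)) \<longlonglongrightarrow> 0"
    proof eventually_elim
      case (elim y)
      show ?case
      proof (cases "y \<in> {a..b}")
        case True
        then have c: "isCont q y" using elim by (intro q_isCont) auto
        have "(\<lambda>n. y + S n) \<longlonglongrightarrow> y" "(\<lambda>n. y - S n) \<longlonglongrightarrow> y"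
          using tendsto_add[OF tendsto_const S(2), of y] tendsto_diff[OF tendsto_const S(2), of y] by auto
        then have "(\<lambda>n. q (y + S n)) \<longlonglongrightarrow> q y" "(\<lambda>n. q (y - S n)) \<longlonglongrightarrow> q y"
          using isCont_tendsto_compose[OF c] by auto
        then have "(\<lambda>n. indicator {a..b} y * (\<bar>q (y + S n) - q y\<bar> + \<bar>q (y - S n) - q y\<bar>))
            \<longlonglongrightarrow> indicator {a..b} y * (\<bar>q y - q y\<bar> + \<bar>q y - q y\<bar>)"
          by (intro tendsto_intros)
        then show ?thesis by simp
      qed simp
    qed
    have 1: "\<bar>q u - q v\<bar> \<le> q1" for u v
      using q_nonneg[of u] q_nonneg[of v] q_le[of u] q_le[of v] by auto
    have "\<bar>\<bar>q (y + S n) - q y\<bar> + \<bar>q (y - S n) - q y\<bar>\<bar> \<le> q1 + q1" for y n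
      using 1[of "y + S n" y] 1[of "y - S n" y] by auto
    then show "AE y in lborel. norm (indicator {a..b} y * (\<bar>q (y + S n) - q y\<bar> + \<bar>q (y - S n) - q y\<bar>)) \<le> (q1 + q1) * indicator {a..b} y" for n
      by (intro AE_I2) (auto simp: indicator_def)
  qed measurable
  then show "(\<lambda>n. dq (S n)) \<longlonglongrightarrow> 0" by simp
qed simp

text \<open>Multiplied by w s, this is the mean displacement of the untilted walk given x.\<close>

definition drift :: "real \<Rightarrow> real \<Rightarrow> real" where
  "drift s x = (\<integral>y. \<kappa> (x, y) * (q (y + s) - q (y - s)) \<partial>lborel)"

lemma drift_strip: "strip_bounded a b (\<lambda>z. \<kappa> z * (q (snd z + s) - q (snd z - s)))"
proof (rule strip_bounded_mult[OF \<kappa>_strip])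
  show "\<bar>q (snd z + s) - q (snd z - s)\<bar> \<le> q1" for z :: "real \<times> real"
    using q_nonneg[of "snd z + s"] q_nonneg[of "snd z - s"] q_le[of "snd z + s"] q_le[of "snd z - s"] by auto
qed measurable

lemma drift_measurable[measurable]: "drift s \<in> borel_measurable borel"
  unfolding drift_def[abs_def] by measurable

text \<open>As \<kappa> is bounded by K, an L^1 modulus of q controls the drift uniformly in x,
  which is the form of smallness that the corrector needs.\<close>

lemma drift_le: "\<bar>drift s x\<bar> \<le> K * dq s"
proof -
  have "\<bar>drift s x\<bar> \<le> (\<integral>y. K * (indicator {a..b} y * (\<bar>q (y + s) - q y\<bar> + \<bar>q (y - s) - q y\<bar>)) \<partial>lborel)"
    unfolding drift_def
  proof (rule order_trans[OF integral_abs_bound], rule integral_mono)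
    show "integrable lborel (\<lambda>y. \<bar>\<kappa> (x, y) * (q (y + s) - q (y - s))\<bar>)"
      using strip_bounded_integrable[OF drift_strip, of x s] by simp
    show "integrable lborel (\<lambda>y. K * (indicator {a..b} y * (\<bar>q (y + s) - q y\<bar> + \<bar>q (y - s) - q y\<bar>)))"
      by (intro integrable_mult_right dq_integrable)
    show "\<bar>\<kappa> (x, y) * (q (y + s) - q (y - s))\<bar> \<le> K * (indicator {a..b} y * (\<bar>q (y + s) - q y\<bar> + \<bar>q (y - s) - q y\<bar>))" for y
    proof (cases "y \<in> {a..b}")
      case True
      have "\<bar>\<kappa> (x, y) * (q (y + s) - q (y - s))\<bar> \<le> K * (\<bar>q (y + s) - q y\<bar> + \<bar>q (y - s) - q y\<bar>)"
        unfolding abs_mult using \<kappa>_nonneg[of "(x, y)"] \<kappa>_le[of "(x, y)"] K_pos by (intro mult_mono) auto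
      with True show ?thesis by simp
    qed (use \<kappa>_supp[of "(x, y)"] in simp)
  qed
  then show ?thesis by (simp add: dq_def)
qed

text \<open>Reversibility: the untilted walk keeps the second marginal, so its overall mean
  displacement is zero. This is the solvability condition of the Poisson equation.\<close>

lemma drift_mean: "(\<integral>x. drift s x \<partial>\<mu>1) = 0"
proof -
  have ab': "a \<le> b" using ab by simp
  have sb: "strip_bounded a b (\<lambda>z. q (snd z))"
    unfolding strip_bounded_def using q_nonneg q_le q_supp by (auto intro!: exI[of _ q1])
  have i: "integrable lborel (\<lambda>y. q y * q (y + s))" "integrable lborel (\<lambda>y. q y * q (y - s))"
    using strip_bounded_integrable[OF strip_bounded_mult[OF sb, of "\<lambda>z. q (snd z + s)" q1], of 0]
      strip_bounded_integrable[OF strip_bounded_mult[OF sb, of "\<lambda>z. q (snd z - s)" q1], of 0] q_nonneg q_le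
    by auto
  have "(\<integral>x. drift s x \<partial>\<mu>1) = (\<integral>y. \<integral>x. \<kappa> (x, y) * (q (y + s) - q (y - s)) \<partial>\<mu>1 \<partial>lborel)"
    unfolding drift_def using strip_bounded_Fubini[OF ab' drift_strip[of s]] by simp
  also have "\<dots> = (\<integral>y. q y * (q (y + s) - q (y - s)) \<partial>lborel)"
    by (simp add: \<kappa>_marg)
  also have "\<dots> = (\<integral>y. q y * q (y + s) - q y * q (y - s) \<partial>lborel)"
    by (simp add: right_diff_distrib)
  also have "\<dots> = (\<integral>y. q y * q (y + s) \<partial>lborel) - (\<integral>y. q y * q (y - s) \<partial>lborel)"
    by (rule Bochner_Integration.integral_diff[OF i])
  also have "(\<integral>y. q y * q (y + s) \<partial>lborel) = (\<integral>y. q y * q (y - s) \<partial>lborel)"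
    by (subst lborel_integral_real_affine[of 1 _ "- s"]) (auto simp: mult.commute intro!: Bochner_Integration.integral_cong)
  finally show ?thesis by simp
qed

end

section \<open>Choice of the tilt and first-order comparison with the given perturbation\<close>

context null_direction
begin

text \<open>With this choice |\<theta>| / L is at most w q0 / 2; the other half of the allowance w
  q0 is left to the corrector.\<close>

definition L :: real where "L = 2 * \<Theta> / (w * q0)"

lemma L_pos: "0 < L"
  unfolding L_def using \<Theta>_pos w_pos q_bounds(1) by simp

text \<open>Neither conditional mean sees \<theta>, so D alone has to produce - w
  \<open>drift\<close>, a mean-zero right-hand side of size w K \<open>dq s\<close>. The smallness
  asked of \<open>dq s\<close> keeps D within its half of the allowance.\<close>

lemma tilt_exists:
  "\<exists>C\<ge>0. \<forall>s. 0 < s \<longrightarrow> C * dq s \<le> w * q0 / 2 \<longrightarrow> (\<exists>D\<in>borel_measurable (borel \<Otimes>\<^sub>M borel). (\<forall>z. \<bar>D z\<bar> \<le> C * dq s) \<and>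
     (\<forall>z. \<bar>\<theta> z / L + D z\<bar> \<le> w * q0) \<and>
     (\<forall>y. (\<integral>x. \<kappa> (x, y) * (\<theta> (x, y) / L + D (x, y)) \<partial>\<mu>1) = 0) \<and>
     (\<forall>x. (\<integral>y. \<kappa> (x, y) * (\<theta> (x, y) / L + D (x, y)) \<partial>lborel) = - w * drift s x))"
proof -
  obtain C where C: "0 \<le> C" and sol: "\<forall>\<epsilon> e. \<epsilon> \<in> borel_measurable borel \<longrightarrow> (\<forall>x. \<bar>\<epsilon> x\<bar> \<le> e) \<longrightarrow> (\<integral>x. \<epsilon> x \<partial>\<mu>1) = 0 \<longrightarrow>
    (\<exists>D\<in>borel_measurable (borel \<Otimes>\<^sub>M borel). (\<forall>z. \<bar>D z\<bar> \<le> C * e) \<and>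
       (\<forall>x. (\<integral>y. \<kappa> (x, y) * D (x, y) \<partial>lborel) = \<epsilon> x) \<and> (\<forall>y. (\<integral>x. \<kappa> (x, y) * D (x, y) \<partial>\<mu>1) = 0))"
    by (rule exE[OF corrector], erule conjE, rule that)
  let ?C = "C * (w * K)"
  have "\<exists>D\<in>borel_measurable (borel \<Otimes>\<^sub>M borel). (\<forall>z. \<bar>D z\<bar> \<le> ?C * dq s) \<and>
     (\<forall>z. \<bar>\<theta> z / L + D z\<bar> \<le> w * q0) \<and>
     (\<forall>y. (\<integral>x. \<kappa> (x, y) * (\<theta> (x, y) / L + D (x, y)) \<partial>\<mu>1) = 0) \<and>
     (\<forall>x. (\<integral>y. \<kappa> (x, y) * (\<theta> (x, y) / L + D (x, y)) \<partial>lborel) = - w * drift s x)"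
    if s: "0 < s" "?C * dq s \<le> w * q0 / 2" for s
  proof -
    have m: "(\<lambda>x. - w * drift s x) \<in> borel_measurable borel" by measurable
    have b: "\<bar>- w * drift s x\<bar> \<le> w * K * dq s" for x
      using mult_left_mono[OF drift_le[of s x], of w] w_pos by (simp add: abs_mult mult.assoc)
    have z: "(\<integral>x. - w * drift s x \<partial>\<mu>1) = 0" using drift_mean[of s] by simp
    from sol[rule_format, OF m b z]
    obtain D where [measurable]: "D \<in> borel_measurable (borel \<Otimes>\<^sub>M borel)" and Db: "\<forall>z. \<bar>D z\<bar> \<le> C * (w * K * dq s)"
      and Dx: "\<forall>x. (\<integral>y. \<kappa> (x, y) * D (x, y) \<partial>lborel) = - w * drift s x"
      and Dy: "\<forall>y. (\<integral>x. \<kappa> (x, y) * D (x, y) \<partial>\<mu>1) = 0"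
      by (elim bexE conjE) (rule that)
    have Db': "\<bar>D z\<bar> \<le> ?C * dq s" for z using Db[rule_format, of z] by (simp add: mult.assoc)
    have tL: "\<bar>\<theta> z / L\<bar> \<le> w * q0 / 2" for z
    proof -
      have "\<bar>\<theta> z / L\<bar> \<le> \<Theta> / L" using \<theta>_le[of z] L_pos by (simp add: divide_right_mono)
      also have "\<dots> = w * q0 / 2" unfolding L_def using \<Theta>_pos w_pos q_bounds(1) by simp
      finally show ?thesis .
    qed
    have 1: "\<bar>\<theta> z / L + D z\<bar> \<le> w * q0" for z
      using tL[of z] Db'[of z] s(2) by linarith
    have sbD: "strip_bounded a b (\<lambda>z. \<kappa> z * D z)"
      by (rule strip_bounded_mult[OF \<kappa>_strip _ Db']) measurable
    have iy: "integrable lborel (\<lambda>y. \<kappa> (x, y) * \<theta> (x, y))" "integrable lborel (\<lambda>y. \<kappa> (x, y) * D (x, y))" for x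
      using strip_bounded_integrable[OF strip_bounded_mult[OF \<kappa>_strip \<theta>_measurable \<theta>_le]]
        strip_bounded_integrable[OF sbD] by auto
    have ix: "integrable \<mu>1 (\<lambda>x. \<kappa> (x, y) * f (x, y))" if [measurable]: "f \<in> borel_measurable (borel \<Otimes>\<^sub>M borel)" and f: "\<And>z. \<bar>f z\<bar> \<le> B" for f B y
    proof (rule integrable_const_bound[where B="K * B"])
      show "AE x in \<mu>1. norm (\<kappa> (x, y) * f (x, y)) \<le> K * B"
        using \<kappa>_nonneg \<kappa>_le f K_pos by (auto simp: abs_mult intro!: mult_mono)
    qed measurable
    have ixD: "integrable \<mu>1 (\<lambda>x. \<kappa> (x, y) * D (x, y))" for y
      by (rule ix[of D "?C * dq s"], simp, rule Db')
    have ixt: "integrable \<mu>1 (\<lambda>x. \<kappa> (x, y) * \<theta> (x, y))" for y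
      by (rule ix[of \<theta> \<Theta>], simp, rule \<theta>_le)
    have 2: "(\<integral>x. \<kappa> (x, y) * (\<theta> (x, y) / L + D (x, y)) \<partial>\<mu>1) = 0" for y
    proof -
      have "(\<integral>x. \<kappa> (x, y) * (\<theta> (x, y) / L + D (x, y)) \<partial>\<mu>1) = (\<integral>x. (\<kappa> (x, y) * \<theta> (x, y)) / L + \<kappa> (x, y) * D (x, y) \<partial>\<mu>1)"
        by (simp add: distrib_left)
      also have "\<dots> = 0"
        using ixt[of y] ixD[of y] Dy \<theta>_y[of y] by simp
      finally show ?thesis .
    qed
    have 3: "(\<integral>y. \<kappa> (x, y) * (\<theta> (x, y) / L + D (x, y)) \<partial>lborel) = - w * drift s x" for x
    proof -
      have "(\<integral>y. \<kappa> (x, y) * (\<theta> (x, y) / L + D (x, y)) \<partial>lborel) = (\<integral>y. (\<kappa> (x, y) * \<theta> (x, y)) / L + \<kappa> (x, y) * D (x, y) \<partial>lborel)"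
        by (simp add: distrib_left)
      also have "\<dots> = - w * drift s x"
        using iy[of x] Dx \<theta>_x[of x] by simp
      finally show ?thesis .
    qed
    show ?thesis by (intro bexI[of _ D] conjI allI Db' 1 2 3) simp
  qed
  then show ?thesis using C w_pos K_pos by (intro exI[of _ ?C] conjI allI impI) auto
qed

text \<open>The part that does not jump cancels. With s = L r the jumps are r times the constants L
  and - L, which is the scaling of \<open>flux\<close>.\<close>

lemma walk_flux:
  assumes "0 < r" and \<Psi>[measurable]: "\<Psi> \<in> borel_measurable (borel \<Otimes>\<^sub>M borel)" and B: "\<And>z. \<bar>\<Psi> z\<bar> \<le> B"
  defines "u \<equiv> \<lambda>z. \<kappa> z * up (L * r) \<Psi> z" and "d \<equiv> \<lambda>z. \<kappa> z * dn (L * r) \<Psi> z"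
  shows "shifted_cdf \<kappa> (\<lambda>z. r * \<theta> z) z - walk (L * r) \<Psi> z
    = r * (flux u (\<lambda>_. L) r z + flux d (\<lambda>_. - L) r z - flux \<kappa> \<theta> r z)"
proof -
  note S = strip_up_dn[OF \<Psi> B, of "L * r"]
  have "(\<lambda>z. u z + d z + \<kappa> z * (1 - up (L * r) \<Psi> z - dn (L * r) \<Psi> z)) = \<kappa>"
    by (auto simp: u_def d_def algebra_simps)
  then have "shifted_cdf \<kappa> (\<lambda>_. 0) z = shifted_cdf (\<lambda>z. u z + d z + \<kappa> z * (1 - up (L * r) \<Psi> z - dn (L * r) \<Psi> z)) (\<lambda>_. 0) z"
    by simp
  also have "\<dots> = shifted_cdf u (\<lambda>_. 0) z + shifted_cdf d (\<lambda>_. 0) z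
     + shifted_cdf (\<lambda>z. \<kappa> z * (1 - up (L * r) \<Psi> z - dn (L * r) \<Psi> z)) (\<lambda>_. 0) z"
    unfolding u_def d_def
    by (subst shifted_cdf_add[OF strip_bounded_add[OF S(1,2)] S(3)], simp, subst shifted_cdf_add[OF S(1,2)], auto)
  finally show ?thesis
    using \<open>0 < r\<close> unfolding flux_def walk_def u_def[symmetric] d_def[symmetric]
    by (simp add: field_simps)
qed

text \<open>The jump densities vary with r, while flux limits concern fixed densities. They are
  therefore compared with their values at s = 0 and D = 0, at an L^1 cost that the flux passes on
  uniformly in r. The estimate covers all admissible D at once because D will depend on r.\<close>

lemma L1_walk_small:
  assumes "0 \<le> C0" and e: "0 < e"
  shows "\<forall>\<^sub>F r in at_right 0. \<forall>D\<in>borel_measurable (borel \<Otimes>\<^sub>M borel). (\<forall>z. \<bar>D z\<bar> \<le> C0 * dq (L * r)) \<longrightarrow>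
    L1 (\<lambda>z. shifted_cdf \<kappa> (\<lambda>z. r * \<theta> z) z - walk (L * r) (\<lambda>z. \<theta> z / L + D z) z) \<le> ennreal (r * e)"
proof -
  \<comment> \<open>The first summand pays for replacing q at distance s by q y, the second for
    dropping D on a strip of width b - a; L and K bound displacement and density.\<close>
  define C2 where "C2 = L * (K * (w + C0 * (b - a)))"
  have C2: "0 \<le> C2" unfolding C2_def using L_pos K_pos w_pos assms(1) ab by simp
  let ?\<psi> = "\<lambda>z. \<theta> z / L"
  have \<psi>m[measurable]: "?\<psi> \<in> borel_measurable (borel \<Otimes>\<^sub>M borel)" by measurable
  have \<psi>b: "\<bar>?\<psi> z\<bar> \<le> \<Theta> / L" for z using \<theta>_le[of z] L_pos by (simp add: divide_right_mono)
  let ?uz = "\<lambda>z. \<kappa> z * up 0 ?\<psi> z" and ?dz = "\<lambda>z. \<kappa> z * dn 0 ?\<psi> z"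
  note S0 = strip_up_dn[OF \<psi>m \<psi>b, of 0]
  \<comment> \<open>At s = 0 the symmetric parts w q cancel between up and down, and L times the
    tilt \<theta> / L gives back the current \<kappa> \<theta>.\<close>
  have split: "\<kappa> z * \<theta> z = ?uz z * L + ?dz z * (- L)" for z
    unfolding up_def dn_def using L_pos by (simp add: field_simps)
  have f1: "\<forall>\<^sub>F r in at_right 0. L1 (\<lambda>z. flux \<kappa> \<theta> r z - \<kappa> z * \<theta> z) \<le> ennreal (e/5)"
    using fluxlim_bounded[OF ab \<kappa>_strip \<theta>_measurable \<theta>_le] e unfolding fluxlim_def by simp
  have f2: "\<forall>\<^sub>F r in at_right 0. L1 (\<lambda>z. flux ?uz (\<lambda>_. L) r z - ?uz z * L) \<le> ennreal (e/5)"
    using fluxlim_const[OF ab S0(1), of L] e unfolding fluxlim_def by simp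
  have f3: "\<forall>\<^sub>F r in at_right 0. L1 (\<lambda>z. flux ?dz (\<lambda>_. - L) r z - ?dz z * (- L)) \<le> ennreal (e/5)"
    using fluxlim_const[OF ab S0(2), of "- L"] e unfolding fluxlim_def by simp
  have lim: "((\<lambda>r. dq (L * r)) \<longlongrightarrow> 0) (at_right 0)"
  proof (rule filterlim_compose[OF dq_tendsto])
    show "filterlim (\<lambda>r. L * r) (at_right 0) (at_right 0)"
      unfolding filterlim_at using L_pos
      by (auto intro!: tendsto_eq_intros simp: eventually_at_right_less eventually_at_filter)
  qed
  have "((\<lambda>r. C2 * dq (L * r)) \<longlongrightarrow> C2 * 0) (at_right 0)" by (intro tendsto_intros lim)
  then have f4: "\<forall>\<^sub>F r in at_right 0. C2 * dq (L * r) < e/5"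
    using order_tendstoD(2)[of "\<lambda>r. C2 * dq (L * r)" "C2 * 0" "at_right 0" "e/5"] e by simp
  show "\<forall>\<^sub>F r in at_right 0. \<forall>D\<in>borel_measurable (borel \<Otimes>\<^sub>M borel). (\<forall>z. \<bar>D z\<bar> \<le> C0 * dq (L * r)) \<longrightarrow>
    L1 (\<lambda>z. shifted_cdf \<kappa> (\<lambda>z. r * \<theta> z) z - walk (L * r) (\<lambda>z. \<theta> z / L + D z) z) \<le> ennreal (r * e)"
    using f1 f2 f3 f4 eventually_at_right_less[of 0]
  proof eventually_elim
    case (elim r)
    show ?case
    proof (intro ballI impI)
      fix D :: "real \<times> real \<Rightarrow> real" assume Dm[measurable]: "D \<in> borel_measurable (borel \<Otimes>\<^sub>M borel)" and D: "\<forall>z. \<bar>D z\<bar> \<le> C0 * dq (L * r)"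
      let ?s = "L * r" and ?\<Psi> = "\<lambda>z. \<theta> z / L + D z"
      have \<Psi>m[measurable]: "?\<Psi> \<in> borel_measurable (borel \<Otimes>\<^sub>M borel)" by measurable
      have \<Psi>b: "\<bar>?\<Psi> z\<bar> \<le> \<Theta> / L + C0 * dq ?s" for z
        by (rule order_trans[OF abs_triangle_ineq add_mono[OF \<psi>b D[rule_format]]])
      let ?u = "\<lambda>z. \<kappa> z * up ?s ?\<Psi> z" and ?d = "\<lambda>z. \<kappa> z * dn ?s ?\<Psi> z"
      note S = strip_up_dn[OF \<Psi>m \<Psi>b, of ?s]
      have E: "L1 (\<lambda>z. (?u z - ?uz z) * L) \<le> ennreal (e/5)" "L1 (\<lambda>z. (?d z - ?dz z) * (- L)) \<le> ennreal (e/5)"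
      proof -
        let ?i = "\<lambda>y. indicator {a..b} y * (\<bar>q (y + ?s) - q y\<bar> + \<bar>q (y - ?s) - q y\<bar>)"
        let ?\<phi> = "\<lambda>y. L * (K * (w * ?i y + C0 * dq ?s * indicator {a..b} y))"
        have iu: "integrable lborel (indicator {a..b} :: real \<Rightarrow> real)"
          by (simp add: integrable_indicator_iff emeasure_lborel_Icc_eq)
        have \<phi>i: "integrable lborel ?\<phi>"
          by (intro integrable_mult_right Bochner_Integration.integrable_add dq_integrable iu)
        have \<phi>0: "0 \<le> ?\<phi> y" for y
          using L_pos K_pos w_pos assms(1) dq_nonneg[of ?s] by (auto simp: indicator_def intro!: mult_nonneg_nonneg add_nonneg_nonneg)
        have "(\<integral>\<^sup>+ y. ennreal (?\<phi> y) \<partial>lborel) = ennreal (\<integral>y. ?\<phi> y \<partial>lborel)"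
          by (rule nn_integral_eq_integral[OF \<phi>i]) (use \<phi>0 in auto)
        also have "(\<integral>y. ?\<phi> y \<partial>lborel) = C2 * dq ?s"
        proof -
          have "(\<integral>y. ?\<phi> y \<partial>lborel) = L * (K * (w * dq ?s + C0 * dq ?s * (b - a)))"
            unfolding dq_def[of ?s, symmetric] integral_mult_right_zero
            by (subst Bochner_Integration.integral_add)
               (use ab iu dq_integrable[of ?s] in \<open>auto simp: dq_def intro!: integrable_mult_right\<close>)
          then show ?thesis unfolding C2_def by (simp add: algebra_simps)
        qed
        finally have \<phi>: "(\<integral>\<^sup>+ y. ennreal (?\<phi> y) \<partial>lborel) \<le> ennreal (e/5)"
          using elim(4) by (simp add: ennreal_leI)
        \<comment> \<open>A stands for an increment of q by a jump up or down, k for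
          \<open>lower_half\<close> or \<open>lower_half\<close> minus 1.\<close>
        have core: "\<bar>\<kappa> z * (w * A + k * D z) * L\<bar> \<le> ?\<phi> (snd z)"
          if "\<bar>A\<bar> \<le> \<bar>q (snd z + ?s) - q (snd z)\<bar> + \<bar>q (snd z - ?s) - q (snd z)\<bar>" "\<bar>k\<bar> \<le> 1" for z A k
        proof (cases "snd z \<in> {a..b}")
          case True
          have "\<bar>w * A + k * D z\<bar> \<le> \<bar>w * A\<bar> + \<bar>k * D z\<bar>" by (rule abs_triangle_ineq)
          also have "\<bar>w * A\<bar> \<le> w * (\<bar>q (snd z + ?s) - q (snd z)\<bar> + \<bar>q (snd z - ?s) - q (snd z)\<bar>)"
            using that(1) w_pos by (simp add: abs_mult)
          also have "\<bar>k * D z\<bar> \<le> 1 * (C0 * dq ?s)"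
            unfolding abs_mult by (intro mult_mono D[rule_format] that(2)) auto
          finally have "\<bar>w * A + k * D z\<bar> \<le> w * ?i (snd z) + C0 * dq ?s * indicator {a..b} (snd z)"
            using True by simp
          then have "\<bar>\<kappa> z\<bar> * \<bar>w * A + k * D z\<bar> \<le> K * (w * ?i (snd z) + C0 * dq ?s * indicator {a..b} (snd z))"
            using \<kappa>_nonneg[of z] \<kappa>_le[of z] K_pos by (intro mult_mono) auto
          then have "L * (\<bar>\<kappa> z\<bar> * \<bar>w * A + k * D z\<bar>) \<le> ?\<phi> (snd z)"
            using L_pos by (intro mult_left_mono) auto
          then show ?thesis using L_pos by (simp add: abs_mult mult_ac)
        next
          case False
          then show ?thesis using \<kappa>_supp[of z] \<phi>0[of "snd z"] by simp
        qed
        have id1: "(k * (w * Q + h * (p + d)) - k * (w * Q' + h * p)) * l = k * (w * (Q - Q') + h * d) * l"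
          and id2: "(k * (w * Q - (1 - h) * (p + d)) - k * (w * Q' - (1 - h) * p)) * (- l)
            = - (k * (w * (Q - Q') + (h - 1) * d) * l)" for k w Q Q' h p d l :: real
          by algebra+
        have eu: "(?u z - ?uz z) * L = \<kappa> z * (w * (q (snd z + ?s) - q (snd z)) + lower_half (snd z) * D z) * L" for z
          unfolding up_def add_0_right by (rule id1)
        have ed: "(?d z - ?dz z) * (- L) = - (\<kappa> z * (w * (q (snd z - ?s) - q (snd z)) + (lower_half (snd z) - 1) * D z) * L)" for z
          unfolding dn_def diff_0_right by (rule id2)
        have "L1 (\<lambda>z. (?u z - ?uz z) * L) \<le> (\<integral>\<^sup>+ y. ennreal (?\<phi> y) \<partial>lborel)"
        proof (rule L1_le_snd)
          show "\<bar>(?u z - ?uz z) * L\<bar> \<le> ?\<phi> (snd z)" for z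
            unfolding eu by (rule core) (use lower_half_range[of "snd z"] in auto)
        qed measurable
        then show "L1 (\<lambda>z. (?u z - ?uz z) * L) \<le> ennreal (e/5)" using \<phi> by (rule order_trans)
        have "L1 (\<lambda>z. (?d z - ?dz z) * (- L)) \<le> (\<integral>\<^sup>+ y. ennreal (?\<phi> y) \<partial>lborel)"
        proof (rule L1_le_snd)
          show "\<bar>(?d z - ?dz z) * (- L)\<bar> \<le> ?\<phi> (snd z)" for z
            unfolding ed abs_minus_cancel by (rule core) (use lower_half_range[of "snd z"] in auto)
        qed measurable
        then show "L1 (\<lambda>z. (?d z - ?dz z) * (- L)) \<le> ennreal (e/5)" using \<phi> by (rule order_trans)
      qed
      have g4: "L1 (flux (\<lambda>z. ?u z - ?uz z) (\<lambda>_. L) r) \<le> ennreal (e/5)"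
        by (rule order_trans[OF L1_flux[OF strip_bounded_diff[OF S(1) S0(1)] elim(5)] E(1)]) simp
      have g5: "L1 (flux (\<lambda>z. ?d z - ?dz z) (\<lambda>_. - L) r) \<le> ennreal (e/5)"
        by (rule order_trans[OF L1_flux[OF strip_bounded_diff[OF S(2) S0(2)] elim(5)] E(2)]) simp
      have g1: "L1 (\<lambda>z. \<kappa> z * \<theta> z - flux \<kappa> \<theta> r z) \<le> ennreal (e/5)"
        using elim(1) unfolding L1_def by (simp add: abs_minus_commute)
      \<comment> \<open>Five errors: the expansion for the displacement r \<theta>, those for the
        two frozen jump densities, and the fluxes of the two density corrections.\<close>
      have eq: "flux ?u (\<lambda>_. L) r z + flux ?d (\<lambda>_. - L) r z - flux \<kappa> \<theta> r z
        = (\<kappa> z * \<theta> z - flux \<kappa> \<theta> r z) + ((flux ?uz (\<lambda>_. L) r z - ?uz z * L) + ((flux ?dz (\<lambda>_. - L) r z - ?dz z * (- L))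
          + (flux (\<lambda>z. ?u z - ?uz z) (\<lambda>_. L) r z + flux (\<lambda>z. ?d z - ?dz z) (\<lambda>_. - L) r z)))" for z
        unfolding flux_diff[OF S(1) S0(1) borel_measurable_const] flux_diff[OF S(2) S0(2) borel_measurable_const]
        using split[of z] by linarith
      have "L1 (\<lambda>z. (\<kappa> z * \<theta> z - flux \<kappa> \<theta> r z) + ((flux ?uz (\<lambda>_. L) r z - ?uz z * L) + ((flux ?dz (\<lambda>_. - L) r z - ?dz z * (- L))
          + (flux (\<lambda>z. ?u z - ?uz z) (\<lambda>_. L) r z + flux (\<lambda>z. ?d z - ?dz z) (\<lambda>_. - L) r z)))) \<le> ennreal (e/5 + (e/5 + (e/5 + (e/5 + e/5))))"
        using e by (intro L1_triangle g1 elim(2) elim(3) g4 g5; measurable)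
      then have sum: "L1 (\<lambda>z. flux ?u (\<lambda>_. L) r z + flux ?d (\<lambda>_. - L) r z - flux \<kappa> \<theta> r z) \<le> ennreal e"
        unfolding eq by (simp add: field_simps)
      have "L1 (\<lambda>z. shifted_cdf \<kappa> (\<lambda>z. r * \<theta> z) z - walk ?s ?\<Psi> z)
        = L1 (\<lambda>z. r * (flux ?u (\<lambda>_. L) r z + flux ?d (\<lambda>_. - L) r z - flux \<kappa> \<theta> r z))"
        by (simp only: walk_flux[OF elim(5) \<Psi>m \<Psi>b])
      also have "\<dots> = ennreal \<bar>r\<bar> * L1 (\<lambda>z. flux ?u (\<lambda>_. L) r z + flux ?d (\<lambda>_. - L) r z - flux \<kappa> \<theta> r z)"
        by (rule L1_cmult) measurable
      also have "\<dots> \<le> ennreal \<bar>r\<bar> * ennreal e" by (intro mult_left_mono sum) auto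
      also have "\<dots> = ennreal (r * e)" using elim(5) e by (simp add: ennreal_mult)
      finally show "L1 (\<lambda>z. shifted_cdf \<kappa> (\<lambda>z. r * \<theta> z) z - walk ?s ?\<Psi> z) \<le> ennreal (r * e)" .
    qed
  qed
qed

theorem W_ad_set_small:
  assumes p: "1 < p" and mart: "martingale_measure (qlaw (shifted_cdf \<kappa> (\<lambda>_. 0)))" and e: "0 < e"
  defines "U \<equiv> Pi_M (marg1 (qlaw (shifted_cdf \<kappa> (\<lambda>_. 0)))) (marg2 (qlaw (shifted_cdf \<kappa> (\<lambda>_. 0))))"
  shows "\<forall>\<^sub>F r in at_right 0. W_ad_set p (qlaw (shifted_cdf \<kappa> (\<lambda>z. r * \<theta> z))) U \<le> ennreal (e * r)"
proof -
  obtain C where C: "0 \<le> C" and tilt: "\<forall>s. 0 < s \<longrightarrow> C * dq s \<le> w * q0 / 2 \<longrightarrow> (\<exists>D\<in>borel_measurable (borel \<Otimes>\<^sub>M borel). (\<forall>z. \<bar>D z\<bar> \<le> C * dq s) \<and>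
     (\<forall>z. \<bar>\<theta> z / L + D z\<bar> \<le> w * q0) \<and>
     (\<forall>y. (\<integral>x. \<kappa> (x, y) * (\<theta> (x, y) / L + D (x, y)) \<partial>\<mu>1) = 0) \<and>
     (\<forall>x. (\<integral>y. \<kappa> (x, y) * (\<theta> (x, y) / L + D (x, y)) \<partial>lborel) = - w * drift s x))"
    by (rule exE[OF tilt_exists], erule conjE, rule that)
  have ab': "a \<le> b" using ab by simp
  \<comment> \<open>Per unit of r, the given perturbation moves points by at most \<Theta> and the
    walk by at most L, so k r bounds the horizontal shift between the two distribution
    functions.\<close>
  define k where "k = L + \<Theta>"
  have k: "0 < k" unfolding k_def using L_pos \<Theta>_pos by simp
  \<comment> \<open>Chosen so that the product of (k r)^(p-1) and r e' is (e r)^p.\<close>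
  define e' where "e' = e powr p / k powr (p - 1)"
  have e': "0 < e'" unfolding e'_def using e k by simp
  have lim: "((\<lambda>r. C * dq (L * r)) \<longlongrightarrow> C * 0) (at_right 0)"
  proof (intro tendsto_intros filterlim_compose[OF dq_tendsto])
    show "filterlim (\<lambda>r. L * r) (at_right 0) (at_right 0)"
      unfolding filterlim_at using L_pos
      by (auto intro!: tendsto_eq_intros simp: eventually_at_right_less eventually_at_filter)
  qed
  have h1: "\<forall>\<^sub>F r in at_right 0. C * dq (L * r) < w * q0 / 2"
    using order_tendstoD(2)[OF lim, of "w * q0 / 2"] w_pos q_bounds(1) by simp
  have "((\<lambda>r. L * r) \<longlongrightarrow> L * 0) (at_right 0)" by (intro tendsto_intros)
  then have h2: "\<forall>\<^sub>F r in at_right 0. L * r < (b - a) / 2"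
    using order_tendstoD(2)[of "\<lambda>r. L * r" "L * 0" "at_right 0" "(b - a) / 2"] ab by simp
  have h3: "\<forall>\<^sub>F r in at_right 0. \<forall>D\<in>borel_measurable (borel \<Otimes>\<^sub>M borel). (\<forall>z. \<bar>D z\<bar> \<le> C * dq (L * r)) \<longrightarrow>
    L1 (\<lambda>z. shifted_cdf \<kappa> (\<lambda>z. r * \<theta> z) z - walk (L * r) (\<lambda>z. \<theta> z / L + D z) z) \<le> ennreal (r * e')"
    by (rule L1_walk_small[OF C e'])
  show ?thesis
    using h1 h2 h3 eventually_at_right_less[of 0]
  proof eventually_elim
    case (elim r)
    have s: "0 < L * r" using L_pos elim by simp
    from tilt[rule_format, OF s less_imp_le[OF elim(1)]]
    obtain D where Dm[measurable]: "D \<in> borel_measurable (borel \<Otimes>\<^sub>M borel)" and Db: "\<forall>z. \<bar>D z\<bar> \<le> C * dq (L * r)"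
      and \<Psi>b: "\<forall>z. \<bar>\<theta> z / L + D z\<bar> \<le> w * q0"
      and \<Psi>y: "\<forall>y. (\<integral>x. \<kappa> (x, y) * (\<theta> (x, y) / L + D (x, y)) \<partial>\<mu>1) = 0"
      and \<Psi>x: "\<forall>x. (\<integral>y. \<kappa> (x, y) * (\<theta> (x, y) / L + D (x, y)) \<partial>lborel) = - w * drift (L * r) x"
      by (elim bexE conjE) (rule that)
    define \<Psi> where "\<Psi> z = \<theta> z / L + D z" for z
    have \<Psi>m: "\<Psi> \<in> borel_measurable (borel \<Otimes>\<^sub>M borel)" unfolding \<Psi>_def[abs_def] by measurable
    note W = s elim(2) \<Psi>m \<Psi>b[rule_format, folded \<Psi>_def] \<Psi>y[rule_format, folded \<Psi>_def] \<Psi>x[rule_format, folded \<Psi>_def, unfolded drift_def]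
    have kr: "L * r \<le> k * r" "\<Theta> * r \<le> k * r" "0 \<le> k * r" "k * r = \<Theta> * r + L * r"
      unfolding k_def using elim(4) L_pos \<Theta>_pos by (auto simp: algebra_simps)
    have "qlaw (walk (L * r) \<Psi>) \<in> U"
      unfolding U_def by (rule walk_in_Pi_M[OF W kr(1) mart])
    then have "W_ad_set p (qlaw (shifted_cdf \<kappa> (\<lambda>z. r * \<theta> z))) U
        \<le> W_ad p (qlaw (shifted_cdf \<kappa> (\<lambda>z. r * \<theta> z))) (qlaw (walk (L * r) \<Psi>))"
      unfolding W_ad_set_def by (rule INF_lower)
    also have "\<dots> \<le> eroot p (ennreal ((k * r) powr (p - 1)) * L1 (\<lambda>z. shifted_cdf \<kappa> (\<lambda>z. r * \<theta> z) z - walk (L * r) \<Psi> z))"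
    proof (rule W_ad_qlaw_le[OF _ cdf_family_walk[OF W kr(1)] kr(3)])
      have rt: "\<bar>r * \<theta> z\<bar> \<le> \<Theta> * r" for z
        using \<theta>_le[of z] elim(4) by (simp add: abs_mult mult.commute)
      show "cdf_family (a - k * r) (b + k * r) (shifted_cdf \<kappa> (\<lambda>z. r * \<theta> z))"
        by (rule cdf_family_shifted[OF ab' kr(3) \<kappa>_strip \<kappa>_nonneg _ _ \<kappa>_mass])
           (use rt kr(2) in \<open>auto intro: order_trans\<close>)
      fix x t
      have "shifted_cdf \<kappa> (\<lambda>z. r * \<theta> z) (x, t) \<le> shifted_cdf \<kappa> (\<lambda>_. 0) (x, t + \<Theta> * r)"
        by (rule shifted_cdf_le[OF \<kappa>_strip \<kappa>_nonneg]) (use rt in \<open>auto simp: abs_le_iff minus_le_iff\<close>)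
      also have "\<dots> \<le> walk (L * r) \<Psi> (x, t + \<Theta> * r + L * r)" by (rule walk_near(2)[OF W])
      finally show "shifted_cdf \<kappa> (\<lambda>z. r * \<theta> z) (x, t) \<le> walk (L * r) \<Psi> (x, t + k * r)"
        by (simp add: kr(4) add.assoc)
      have "walk (L * r) \<Psi> (x, t) \<le> shifted_cdf \<kappa> (\<lambda>_. 0) (x, t + L * r)" by (rule walk_near(1)[OF W])
      also have "\<dots> \<le> shifted_cdf \<kappa> (\<lambda>z. r * \<theta> z) (x, t + k * r)"
        by (rule shifted_cdf_le[OF \<kappa>_strip \<kappa>_nonneg]) (use rt kr(4) in \<open>auto simp: abs_le_iff\<close>)
      finally show "walk (L * r) \<Psi> (x, t) \<le> shifted_cdf \<kappa> (\<lambda>z. r * \<theta> z) (x, t + k * r)" .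
    qed (use p in simp)
    also have "\<dots> \<le> ennreal (e * r)"
    proof (rule eroot_le_ennreal)
      have "L1 (\<lambda>z. shifted_cdf \<kappa> (\<lambda>z. r * \<theta> z) z - walk (L * r) \<Psi> z) \<le> ennreal (r * e')"
        using elim(3)[rule_format, OF Dm Db[rule_format]] unfolding \<Psi>_def[abs_def] .
      then have "ennreal ((k * r) powr (p - 1)) * L1 (\<lambda>z. shifted_cdf \<kappa> (\<lambda>z. r * \<theta> z) z - walk (L * r) \<Psi> z)
          \<le> ennreal ((k * r) powr (p - 1)) * ennreal (r * e')" by (rule mult_left_mono) simp
      also have "\<dots> = ennreal ((k * r) powr (p - 1) * (r * e'))"
        using elim(4) e' by (subst ennreal_mult) auto
      also have "(k * r) powr (p - 1) * (r * e') = (e * r) powr p"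
      proof -
        have "(k * r) powr (p - 1) = k powr (p - 1) * r powr (p - 1)"
          by (rule powr_mult)
        moreover have "r powr p = r powr (p - 1) * r"
          using elim(4) by (simp add: powr_diff)
        moreover have "(e * r) powr p = e powr p * r powr p"
          by (rule powr_mult)
        ultimately show ?thesis unfolding e'_def using k by simp
      qed
      finally show "ennreal ((k * r) powr (p - 1)) * L1 (\<lambda>z. shifted_cdf \<kappa> (\<lambda>z. r * \<theta> z) z - walk (L * r) \<Psi> z)
          \<le> ennreal ((e * r) powr p)" .
    qed (use p e elim(4) in auto)
    finally show ?case .
  qed
qed

end

subsection \<open>Disintegration under condition C\<close>

lemma AE_eq_0_if_set_integrals:
  fixes f :: "'a \<Rightarrow> real"
  assumes f: "integrable M f"
    and zero: "\<And>B. B \<in> sets M \<Longrightarrow> (\<integral>x. indicator B x * f x \<partial>M) = 0"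
  shows "AE x in M. f x = 0"
proof -
  have [measurable]: "f \<in> borel_measurable M" using f by auto
  have *: "AE x in M. indicator B x * g x = 0"
    if "B = {x \<in> space M. 0 < g x}" "g = f \<or> g = (\<lambda>x. - f x)" for B g
  proof -
    have g[measurable]: "g \<in> borel_measurable M" using that by auto
    have B: "B \<in> sets M" unfolding that(1) by measurable
    have "integrable M (\<lambda>x. indicator B x * g x)"
      using that(2) B f by (auto intro!: integrable_mult_indicator[where 'b=real, simplified] simp flip: mult_minus_right)
    moreover have "(\<integral>x. indicator B x * g x \<partial>M) = 0" using that(2) zero[OF B] by auto
    moreover have "0 \<le> indicator B x * g x" for x using that(1) by (auto simp: indicator_def)
    ultimately show ?thesis using integral_nonneg_eq_0_iff_AE by blast
  qed
  have "AE x in M. indicator {x \<in> space M. 0 < f x} x * f x = 0"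
    "AE x in M. indicator {x \<in> space M. 0 < - f x} x * (- f x) = 0"
    using *[OF refl, of f] *[OF refl, of "\<lambda>x. - f x"] by auto
  then show ?thesis using AE_space by eventually_elim (auto simp: indicator_def split: if_splits)
qed

context disintegrated
begin

text \<open>The passage from laws on the plane to conditional distribution functions: with D = 0 it
  represents the given measure, with D = r \<theta> its perturbation.\<close>

lemma law_shifted:
  assumes D[measurable]: "D \<in> borel_measurable (borel \<Otimes>\<^sub>M borel)" and c: "\<And>z. \<bar>D z\<bar> \<le> c"
  shows "distr (density M (\<lambda>z. ennreal (\<kappa> z))) borel (\<lambda>z. (fst z, snd z + D z)) = qlaw (shifted_cdf \<kappa> D)"
proof -
  have c0: "0 \<le> c" using c[of "(0, 0)"] by linarith
  have G: "cdf_family (a - c) (b + c) (shifted_cdf \<kappa> D)"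
    by (rule cdf_family_shifted[OF less_imp_le[OF ab] c0 \<kappa>_strip \<kappa>_nonneg D c \<kappa>_mass])
  let ?N = "density M (\<lambda>z. ennreal (\<kappa> z))" and ?T = "\<lambda>z. (fst z, snd z + D z)"
  have T[measurable]: "?T \<in> measurable M borel"
    unfolding borel_prod[symmetric] by measurable
  have prob: "prob_space ?N"
  proof
    have "emeasure ?N (space ?N) = (\<integral>\<^sup>+ z. ennreal (\<kappa> z) \<partial>M)"
      using sets.top[of M] by (subst emeasure_density) (auto simp del: space_M intro!: nn_integral_cong)
    also have "\<dots> = (\<integral>\<^sup>+ x. \<integral>\<^sup>+ y. ennreal (\<kappa> (x, y)) \<partial>lborel \<partial>\<mu>1)"
      by (subst lborel.nn_integral_fst[symmetric]) auto
    also have "\<dots> = (\<integral>\<^sup>+ x. 1 \<partial>\<mu>1)"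
      using \<kappa>_int_y \<kappa>_mass \<kappa>_nonneg by (intro nn_integral_cong) (simp add: nn_integral_eq_integral)
    finally show "emeasure ?N (space ?N) = 1" using emeasure_space_1 by simp
  qed
  show ?thesis
  proof (rule eq_qlawI[OF G])
    show "prob_space (distr ?N borel ?T)" by (rule prob_space.prob_space_distr[OF prob]) simp
    fix B :: "real set" and t :: real assume B[measurable]: "B \<in> sets borel"
    have [measurable]: "B \<times> {..t} \<in> sets borel" unfolding borel_prod[symmetric] by measurable
    have "emeasure (distr ?N borel ?T) (B \<times> {..t}) = (\<integral>\<^sup>+ z. indicator (B \<times> {..t}) (?T z) \<partial>?N)"
      by (subst nn_integral_indicator[symmetric], simp, subst nn_integral_distr) auto
    also have "\<dots> = (\<integral>\<^sup>+ z. ennreal (\<kappa> z) * indicator (B \<times> {..t}) (?T z) \<partial>M)"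
      by (subst nn_integral_density) auto
    also have "\<dots> = (\<integral>\<^sup>+ z. indicator B (fst z) * ennreal (if snd z + D z \<le> t then \<kappa> z else 0) \<partial>M)"
      by (intro nn_integral_cong) (auto simp: indicator_def)
    also have "\<dots> = (\<integral>\<^sup>+ x. \<integral>\<^sup>+ y. indicator B x * ennreal (if y + D (x, y) \<le> t then \<kappa> (x, y) else 0) \<partial>lborel \<partial>\<mu>1)"
      by (subst lborel.nn_integral_fst[symmetric]) auto
    also have "\<dots> = (\<integral>\<^sup>+ x. indicator B x * ennreal (shifted_cdf \<kappa> D (x, t)) \<partial>\<mu>1)"
    proof (rule nn_integral_cong)
      fix x
      have "(\<integral>\<^sup>+ y. ennreal (if y + D (x, y) \<le> t then \<kappa> (x, y) else 0) \<partial>lborel) = ennreal (shifted_cdf \<kappa> D (x, t))"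
        unfolding shifted_cdf_def fst_conv snd_conv
        by (rule nn_integral_eq_integral[OF shifted_cdf_integrable[OF \<kappa>_strip D]]) (auto simp: \<kappa>_nonneg)
      then show "(\<integral>\<^sup>+ y. indicator B x * ennreal (if y + D (x, y) \<le> t then \<kappa> (x, y) else 0) \<partial>lborel)
          = indicator B x * ennreal (shifted_cdf \<kappa> D (x, t))"
        by (subst nn_integral_cmult) auto
    qed
    finally show "emeasure (distr ?N borel ?T) (B \<times> {..t}) = (\<integral>\<^sup>+ x. indicator B x * ennreal (shifted_cdf \<kappa> D (x, t)) \<partial>\<mu>1)" .
  qed simp
qed

lemma density_set_integral:
  assumes "h \<in> borel_measurable (borel \<Otimes>\<^sub>M borel)"
  shows "(\<integral>z. h z \<partial>density M (\<lambda>z. ennreal (\<kappa> z))) = (\<integral>z. \<kappa> z * h z \<partial>M)"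
  using assms \<kappa>_nonneg by (subst integral_density) auto

text \<open>A direction annihilated by both conditional expectations can be redefined on a null set so
  that the two integrals vanish everywhere.\<close>

lemma null_directionI:
  assumes h[measurable]: "h \<in> borel_measurable (borel \<Otimes>\<^sub>M borel)" and B: "\<And>z. \<bar>h z\<bar> \<le> \<Theta>" "0 < \<Theta>"
    and zx: "\<And>A. A \<in> sets borel \<Longrightarrow> (\<integral>z. indicator A (fst z) * h z \<partial>density M (\<lambda>z. ennreal (\<kappa> z))) = 0"
    and zy: "\<And>A. A \<in> sets borel \<Longrightarrow> (\<integral>z. indicator A (snd z) * h z \<partial>density M (\<lambda>z. ennreal (\<kappa> z))) = 0"
  shows "\<exists>\<theta>. null_direction \<mu>1 \<kappa> q a b K q0 q1 \<theta> \<Theta> \<and> (AE z in M. \<theta> z = h z)"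
proof -
  have ab': "a \<le> b" using ab by simp
  have sb: "strip_bounded a b (\<lambda>z. \<kappa> z * h z)" by (rule strip_bounded_mult[OF \<kappa>_strip h B(1)])
  define f where "f x = (\<integral>y. \<kappa> (x, y) * h (x, y) \<partial>lborel)" for x
  define g where "g y = (\<integral>x. \<kappa> (x, y) * h (x, y) \<partial>\<mu>1)" for y
  have [measurable]: "f \<in> borel_measurable borel" "g \<in> borel_measurable borel"
    unfolding f_def[abs_def] g_def[abs_def] by measurable
  have "AE x in \<mu>1. f x = 0"
  proof (rule AE_eq_0_if_set_integrals)
    show "integrable \<mu>1 f"
      unfolding f_def using P.integrable_fst'[OF integrable_strip_bounded[OF ab' sb]] by simp
    fix A assume "A \<in> sets \<mu>1"
    then have A[measurable]: "A \<in> sets borel" by simp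
    have sbA: "strip_bounded a b (\<lambda>z. \<kappa> z * (indicator A (fst z) * h z))"
      by (rule strip_bounded_mult[OF \<kappa>_strip, of _ \<Theta>]) (use B in \<open>auto simp: indicator_def\<close>)
    have "0 = (\<integral>z. \<kappa> z * (indicator A (fst z) * h z) \<partial>M)"
      using zx[OF A] by (subst (asm) density_set_integral) auto
    also have "\<dots> = (\<integral>x. \<integral>y. \<kappa> (x, y) * (indicator A x * h (x, y)) \<partial>lborel \<partial>\<mu>1)"
      using P.integral_fst'[OF integrable_strip_bounded[OF ab' sbA]] by simp
    also have "\<dots> = (\<integral>x. indicator A x * f x \<partial>\<mu>1)"
      unfolding f_def integral_mult_right_zero[symmetric] by (simp only: mult_ac)
    finally show "(\<integral>x. indicator A x * f x \<partial>\<mu>1) = 0" by simp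
  qed
  have "AE y in lborel. g y = 0"
  proof (rule AE_eq_0_if_set_integrals)
    show "integrable lborel g"
      unfolding g_def using P.integrable_snd[of "\<lambda>x y. \<kappa> (x, y) * h (x, y)"] integrable_strip_bounded[OF ab' sb]
      by (simp add: split_beta')
    fix A assume "A \<in> sets (lborel :: real measure)"
    then have A[measurable]: "A \<in> sets borel" by simp
    have sbA: "strip_bounded a b (\<lambda>z. \<kappa> z * (indicator A (snd z) * h z))"
      by (rule strip_bounded_mult[OF \<kappa>_strip, of _ \<Theta>]) (use B in \<open>auto simp: indicator_def\<close>)
    have "0 = (\<integral>z. \<kappa> z * (indicator A (snd z) * h z) \<partial>M)"
      using zy[OF A] by (subst (asm) density_set_integral) auto
    also have "\<dots> = (\<integral>x. \<integral>y. \<kappa> (x, y) * (indicator A y * h (x, y)) \<partial>lborel \<partial>\<mu>1)"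
      using P.integral_fst'[OF integrable_strip_bounded[OF ab' sbA]] by simp
    also have "\<dots> = (\<integral>y. \<integral>x. \<kappa> (x, y) * (indicator A y * h (x, y)) \<partial>\<mu>1 \<partial>lborel)"
      using strip_bounded_Fubini[OF ab' sbA] by simp
    also have "\<dots> = (\<integral>y. indicator A y * g y \<partial>lborel)"
      unfolding g_def integral_mult_right_zero[symmetric] by (simp only: mult_ac)
    finally show "(\<integral>y. indicator A y * g y \<partial>lborel) = 0" by simp
  qed
  \<comment> \<open>The direction is cut off along whole lines: sections at a bad x vanish
    identically, at a good x only a null set of y is affected, and likewise with the coordinates
    exchanged. So both integrals vanish at every point.\<close>
  define \<theta> where "\<theta> z = (if f (fst z) = 0 \<and> g (snd z) = 0 then h z else 0)" for z
  have \<theta>m[measurable]: "\<theta> \<in> borel_measurable (borel \<Otimes>\<^sub>M borel)" unfolding \<theta>_def[abs_def] by measurable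
  have "null_direction \<mu>1 \<kappa> q a b K q0 q1 \<theta> \<Theta>"
  proof
    show "\<bar>\<theta> z\<bar> \<le> \<Theta>" for z using B by (simp add: \<theta>_def)
    show "(\<integral>y. \<kappa> (x, y) * \<theta> (x, y) \<partial>lborel) = 0" for x
    proof (cases "f x = 0")
      case True
      have "(\<integral>y. \<kappa> (x, y) * \<theta> (x, y) \<partial>lborel) = f x"
        unfolding f_def
      proof (rule integral_cong_AE)
        show "AE y in lborel. \<kappa> (x, y) * \<theta> (x, y) = \<kappa> (x, y) * h (x, y)"
          using \<open>AE y in lborel. g y = 0\<close> by eventually_elim (simp add: \<theta>_def True)
      qed measurable
      with True show ?thesis by simp
    qed (simp add: \<theta>_def)
    show "(\<integral>x. \<kappa> (x, y) * \<theta> (x, y) \<partial>\<mu>1) = 0" for y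
    proof (cases "g y = 0")
      case True
      have "(\<integral>x. \<kappa> (x, y) * \<theta> (x, y) \<partial>\<mu>1) = g y"
        unfolding g_def
      proof (rule integral_cong_AE)
        show "AE x in \<mu>1. \<kappa> (x, y) * \<theta> (x, y) = \<kappa> (x, y) * h (x, y)"
          using \<open>AE x in \<mu>1. f x = 0\<close> by eventually_elim (simp add: \<theta>_def True)
      qed measurable
      with True show ?thesis by simp
    qed (simp add: \<theta>_def)
  qed (use B in simp_all)
  moreover have "AE z in M. \<theta> z = h z"
  proof -
    have "AE x in \<mu>1. AE y in lborel. f x = 0 \<and> g y = 0"
      using \<open>AE x in \<mu>1. f x = 0\<close> by eventually_elim (use \<open>AE y in lborel. g y = 0\<close> in auto)
    then have "AE z in M. f (fst z) = 0 \<and> g (snd z) = 0"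
      by (subst (asm) P.AE_pair_iff) measurable
    then show ?thesis by eventually_elim (simp add: \<theta>_def)
  qed
  ultimately show ?thesis by blast
qed

end

text \<open>The density is changed twice on null sets: first \<open>k1\<close> makes range and
  support correct everywhere, then a product density on exceptional lines makes both marginal
  identities hold everywhere.\<close>

lemma condition_C_disintegrated:
  assumes "condition_C p \<mu>"
  shows "\<exists>\<kappa> q a b K q0 q1. disintegrated (marg1 \<mu>) \<kappa> q a b K q0 q1 \<and>
    \<mu> = density (marg1 \<mu> \<Otimes>\<^sub>M lborel) (\<lambda>z. ennreal (\<kappa> z))"
proof -
  obtain k K a b q where mu: "prob_space \<mu>" "sets \<mu> = sets borel"
    and k[measurable]: "k \<in> borel_measurable borel"
    and kK: "AE x in marg1 \<mu> \<Otimes>\<^sub>M lborel. 0 \<le> k x \<and> k x \<le> K"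
    and dens: "\<mu> = density (marg1 \<mu> \<Otimes>\<^sub>M lborel) (\<lambda>x. ennreal (k x))"
    and qc: "continuous_on {a..b} q" and qpos: "\<forall>y\<in>{a..b}. 0 < q y"
    and m2: "marg2 \<mu> = density lborel (\<lambda>y. ennreal (q y) * indicator {a..b} y)"
    and irr: "\<And>f g. integrable (marg1 \<mu>) f \<Longrightarrow> integrable (marg2 \<mu>) g \<Longrightarrow>
        (AE x in \<mu>. f (fst x) = g (snd x)) \<Longrightarrow>
        (\<exists>c :: real. (AE x in \<mu>. f (fst x) = c) \<and> (AE x in \<mu>. g (snd x) = c))"
    using assms unfolding condition_C_def martingale_measure_def by blast
  interpret mu: prob_space \<mu> by fact
  have fs: "fst \<in> borel_measurable \<mu>" "snd \<in> borel_measurable \<mu>"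
    unfolding measurable_cong_sets[OF mu(2) refl]
    by (auto intro!: borel_measurable_continuous_onI continuous_intros)
  have p1: "prob_space (marg1 \<mu>)" and p2: "prob_space (marg2 \<mu>)"
    unfolding marg1_def marg2_def using fs by (auto intro: mu.prob_space_distr)
  interpret m1: real_distr "marg1 \<mu>"
    by (intro real_distr.intro p1 real_distr_axioms.intro) (simp add: marg1_def)
  interpret m2: prob_space "marg2 \<mu>" by (rule p2)
  have km[measurable]: "k \<in> borel_measurable (borel \<Otimes>\<^sub>M borel)" using k by (simp add: borel_prod)
  define r where "r y = (if y \<in> {a..b} then q y else 0)" for y
  have rm[measurable]: "r \<in> borel_measurable borel"
  proof -
    have "(\<lambda>y. indicator {a..b} y *\<^sub>R q y) \<in> borel_measurable borel"
      by (rule borel_measurable_continuous_on_indicator[OF _ qc]) simp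
    moreover have "(\<lambda>y. indicator {a..b} y *\<^sub>R q y) = r" by (auto simp: r_def fun_eq_iff)
    ultimately show ?thesis by simp
  qed
  have r0: "0 \<le> r y" for y using qpos by (auto simp: r_def less_imp_le)
  have m2r: "marg2 \<mu> = density lborel (\<lambda>y. ennreal (r y))"
    unfolding m2 by (intro arg_cong[where f="density lborel"] ext) (auto simp: r_def indicator_def)
  have r_mass: "(\<integral>\<^sup>+ y. ennreal (r y) \<partial>lborel) = 1"
  proof -
    have "1 = emeasure (marg2 \<mu>) (space (marg2 \<mu>))" using m2.emeasure_space_1 by simp
    also have "\<dots> = (\<integral>\<^sup>+ y. ennreal (r y) \<partial>lborel)"
      unfolding m2r by (subst emeasure_density) (auto intro!: nn_integral_cong)
    finally show ?thesis by simp
  qed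
  \<comment> \<open>A degenerate interval would leave the second marginal without mass.\<close>
  have ab: "a < b"
  proof (rule ccontr)
    assume "\<not> a < b"
    then have "AE y in lborel. ennreal (r y) = 0"
      using AE_lborel_singleton[of a] by (auto simp: r_def elim!: eventually_mono)
    then have "(\<integral>\<^sup>+ y. ennreal (r y) \<partial>lborel) = 0" by (simp add: nn_integral_0_iff_AE)
    then show False using r_mass by simp
  qed
  obtain y0 where y0: "y0 \<in> {a..b}" "\<And>y. y \<in> {a..b} \<Longrightarrow> q y0 \<le> q y"
    using continuous_attains_inf[OF compact_Icc _ qc] ab by auto
  obtain y1 where y1: "y1 \<in> {a..b}" "\<And>y. y \<in> {a..b} \<Longrightarrow> q y \<le> q y1"
    using continuous_attains_sup[OF compact_Icc _ qc] ab by auto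
  let ?M = "marg1 \<mu> \<Otimes>\<^sub>M lborel"
  \<comment> \<open>An upper bound for k and also for r, which replaces the density on exceptional
    lines.\<close>
  define K' where "K' = max K (q y1)"
  have K'pos: "0 < K'" unfolding K'_def using qpos y1(1) by (auto simp: less_max_iff_disj)
  define k1 where "k1 z = (if 0 \<le> k z \<and> k z \<le> K' \<and> snd z \<in> {a..b} then k z else 0)" for z
  have k1m[measurable]: "k1 \<in> borel_measurable (borel \<Otimes>\<^sub>M borel)" unfolding k1_def[abs_def] by measurable
  have k1_range: "0 \<le> k1 z" "k1 z \<le> K'" for z using K'pos by (auto simp: k1_def)
  have supp: "AE z in ?M. 0 < k z \<longrightarrow> snd z \<in> {a..b}"
  proof -
    have "AE y in marg2 \<mu>. y \<in> {a..b}"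
      unfolding m2r by (subst AE_density, measurable) (auto simp: r_def)
    then have "AE z in \<mu>. snd z \<in> {a..b}"
      unfolding marg2_def using fs by (subst (asm) AE_distr_iff) auto
    then show ?thesis by (subst (asm) dens, subst (asm) AE_density) auto
  qed
  have k1_eq: "AE z in ?M. k1 z = k z"
    using kK supp by eventually_elim (auto simp: k1_def K'_def)
  have dens1: "\<mu> = density ?M (\<lambda>z. ennreal (k1 z))"
    by (subst dens, rule density_cong) (use k1_eq in \<open>auto elim: eventually_mono\<close>)
  define f where "f x = (\<integral>\<^sup>+ y. ennreal (k1 (x, y)) \<partial>lborel)" for x
  define g where "g y = (\<integral>\<^sup>+ x. ennreal (k1 (x, y)) \<partial>marg1 \<mu>)" for y
  have fgm[measurable]: "f \<in> borel_measurable borel" "g \<in> borel_measurable borel"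
    unfolding f_def[abs_def] g_def[abs_def] by measurable
  have f1: "AE x in marg1 \<mu>. f x = 1"
  proof -
    have "density (marg1 \<mu>) f = density (marg1 \<mu>) (\<lambda>_. 1)"
    proof (rule measure_eqI)
      fix A assume "A \<in> sets (density (marg1 \<mu>) f)"
      then have A[measurable]: "A \<in> sets borel" by simp
      have "emeasure (density (marg1 \<mu>) f) A = (\<integral>\<^sup>+ x. \<integral>\<^sup>+ y. ennreal (k1 (x, y)) * indicator A x \<partial>lborel \<partial>marg1 \<mu>)"
        unfolding f_def by (subst emeasure_density) (auto simp: nn_integral_multc)
      also have "\<dots> = (\<integral>\<^sup>+ z. ennreal (k1 z) * indicator A (fst z) \<partial>?M)"
        by (subst lborel.nn_integral_fst[symmetric]) auto
      also have "\<dots> = (\<integral>\<^sup>+ z. indicator A (fst z) \<partial>\<mu>)"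
        by (subst (2) dens1, subst nn_integral_density) auto
      also have "\<dots> = emeasure (marg1 \<mu>) A"
        unfolding marg1_def using fs(1)
        by (subst nn_integral_indicator[symmetric], simp, subst nn_integral_distr) auto
      finally show "emeasure (density (marg1 \<mu>) f) A = emeasure (density (marg1 \<mu>) (\<lambda>_. 1)) A"
        by (simp add: density_1)
    qed simp
    then show ?thesis by (subst (asm) m1.density_unique_iff) auto
  qed
  have g1: "AE y in lborel. g y = ennreal (r y)"
  proof -
    have "density lborel g = density lborel (\<lambda>y. ennreal (r y))"
      unfolding m2r[symmetric]
    proof (rule measure_eqI)
      show "sets (density lborel g) = sets (marg2 \<mu>)" by (simp add: marg2_def)
      fix A assume "A \<in> sets (density lborel g)"
      then have A[measurable]: "A \<in> sets borel" by simp
      have "emeasure (density lborel g) A = (\<integral>\<^sup>+ y. \<integral>\<^sup>+ x. ennreal (k1 (x, y)) * indicator A y \<partial>marg1 \<mu> \<partial>lborel)"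
        unfolding g_def by (subst emeasure_density) (auto simp: nn_integral_multc)
      also have "\<dots> = (\<integral>\<^sup>+ z. ennreal (k1 z) * indicator A (snd z) \<partial>?M)"
        using m1.P.nn_integral_snd[of "\<lambda>z. ennreal (k1 z) * indicator A (snd z)"] by simp
      also have "\<dots> = (\<integral>\<^sup>+ z. indicator A (snd z) \<partial>\<mu>)"
        by (subst (2) dens1, subst nn_integral_density) auto
      also have "\<dots> = emeasure (marg2 \<mu>) A"
        unfolding marg2_def using fs(2)
        by (subst nn_integral_indicator[symmetric], simp, subst nn_integral_distr) auto
      finally show "emeasure (density lborel g) A = emeasure (marg2 \<mu>) A" .
    qed
    then show ?thesis by (subst (asm) sigma_finite_measure.density_unique_iff[OF sigma_finite_lborel]) auto
  qed
  \<comment> \<open>The default \<open>r (snd z)\<close> is the density of the product of the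
    marginals: it integrates to 1 over y and to r y over x. Good sections are changed on a null set
    only.\<close>
  define \<kappa> where "\<kappa> z = (if f (fst z) = 1 \<and> g (snd z) = ennreal (r (snd z)) then k1 z else r (snd z))" for z
  have \<kappa>m[measurable]: "\<kappa> \<in> borel_measurable (borel \<Otimes>\<^sub>M borel)" unfolding \<kappa>_def[abs_def] by measurable
  have r_le: "r y \<le> K'" for y using y1(2) K'pos by (auto simp: r_def K'_def le_max_iff_disj)
  have \<kappa>_eq: "AE z in ?M. \<kappa> z = k1 z"
  proof -
    have "AE x in marg1 \<mu>. AE y in lborel. f x = 1 \<and> g y = ennreal (r y)"
      using f1 by eventually_elim (use g1 in auto)
    then have "AE z in ?M. f (fst z) = 1 \<and> g (snd z) = ennreal (r (snd z))"
      by (subst (asm) m1.P.AE_pair_iff) measurable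
    then show ?thesis by eventually_elim (simp add: \<kappa>_def)
  qed
  have dens2: "\<mu> = density ?M (\<lambda>z. ennreal (\<kappa> z))"
    by (subst dens1, rule density_cong) (use \<kappa>_eq in \<open>auto elim: eventually_mono\<close>)
  have \<kappa>0: "0 \<le> \<kappa> z" for z using k1_range r0 by (simp add: \<kappa>_def)
  have "disintegrated (marg1 \<mu>) \<kappa> r a b K' (q y0) (q y1)"
  proof
    show "\<kappa> z \<le> K'" for z using k1_range r_le by (simp add: \<kappa>_def)
    show "\<kappa> z = 0" if "snd z \<notin> {a..b}" for z using that by (auto simp: \<kappa>_def k1_def r_def)
    show "(\<integral>y. \<kappa> (x, y) \<partial>lborel) = 1" for x
    proof -
      have "(\<integral>\<^sup>+ y. ennreal (\<kappa> (x, y)) \<partial>lborel) = 1"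
      proof (cases "f x = 1")
        case True
        have "(\<integral>\<^sup>+ y. ennreal (\<kappa> (x, y)) \<partial>lborel) = f x"
          unfolding f_def by (rule nn_integral_cong_AE) (use g1 in \<open>auto simp: \<kappa>_def True elim!: eventually_mono\<close>)
        with True show ?thesis by simp
      qed (simp add: \<kappa>_def r_mass)
      then show ?thesis using \<kappa>0 by (subst integral_eq_nn_integral) auto
    qed
    show "(\<integral>x. \<kappa> (x, y) \<partial>marg1 \<mu>) = r y" for y
    proof -
      have "(\<integral>\<^sup>+ x. ennreal (\<kappa> (x, y)) \<partial>marg1 \<mu>) = ennreal (r y)"
      proof (cases "g y = ennreal (r y)")
        case True
        have "(\<integral>\<^sup>+ x. ennreal (\<kappa> (x, y)) \<partial>marg1 \<mu>) = g y"
          unfolding g_def by (rule nn_integral_cong_AE) (use f1 in \<open>auto simp: \<kappa>_def True elim!: eventually_mono\<close>)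
        with True show ?thesis by simp
      qed (use m1.emeasure_space_1 in \<open>simp add: \<kappa>_def\<close>)
      then show ?thesis using \<kappa>0 r0 by (subst integral_eq_nn_integral) auto
    qed
    show "continuous_on {a..b} r"
      using qc by (subst continuous_on_cong[where g=q]) (auto simp: r_def)
    show "0 < q y0" using qpos y0 by auto
    show "prob_space.prob (marg1 \<mu>) R = 0 \<or> prob_space.prob (marg1 \<mu>) R = 1"
      if [measurable]: "R \<in> sets borel" "S \<in> sets borel"
        and AE: "AE z in ?M. 0 < \<kappa> z \<longrightarrow> (fst z \<in> R) = (snd z \<in> S)" for R S
    proof -
      have "AE z in \<mu>. (fst z \<in> R) = (snd z \<in> S)"
        using AE by (subst dens2, subst AE_density) auto
      \<comment> \<open>Condition (iii) is applied to indicators, which turns it into a zero-one law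
        for events that are determined by either coordinate.\<close>
      then have e: "AE z in \<mu>. (indicator R (fst z) :: real) = indicator S (snd z)"
        by eventually_elim (auto simp: indicator_def)
      have i1: "integrable (marg1 \<mu>) (indicator R :: real \<Rightarrow> real)"
        by (rule m1.integrable_const_bound[where B=1]) (auto simp: indicator_def)
      have i2: "integrable (marg2 \<mu>) (indicator S :: real \<Rightarrow> real)"
        by (rule m2.integrable_const_bound[where B=1]) (auto simp: indicator_def marg2_def)
      obtain c :: real where c: "AE z in \<mu>. (indicator R (fst z) :: real) = c"
        using irr[OF i1 i2 e] by auto
      then have cR: "AE x in marg1 \<mu>. (indicator R x :: real) = c"
        unfolding marg1_def using fs(1) by (subst AE_distr_iff) auto
      have "(AE x in marg1 \<mu>. x \<in> R) \<or> (AE x in marg1 \<mu>. x \<notin> R)"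
      proof (cases "c = 1")
        case True
        then have "AE x in marg1 \<mu>. x \<in> R"
          using cR by (auto simp: indicator_def elim!: eventually_mono split: if_splits)
        then show ?thesis ..
      next
        case False
        then have "AE x in marg1 \<mu>. x \<notin> R"
          using cR by (auto simp: indicator_def elim!: eventually_mono split: if_splits)
        then show ?thesis ..
      qed
      then show ?thesis
        using m1.prob_eq_1[of R] m1.prob_eq_0[of R] by auto
    qed
  qed (use ab \<kappa>m \<kappa>0 rm y0 y1 in \<open>auto simp: r_def\<close>)
  with dens2 show ?thesis by blast
qed

subsection \<open>The linear bound\<close>

lemma compactly_supported_bounded:
  fixes f :: "'a::topological_space \<Rightarrow> real"
  assumes "compactly_supported f" "continuous_on UNIV f"
  shows "\<exists>B>0. \<forall>x. \<bar>f x\<bar> \<le> B"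
proof -
  let ?S = "closure (support_on UNIV f)"
  have "compact (f ` ?S)"
    using assms by (intro compact_continuous_image continuous_on_subset[OF assms(2)]) (auto simp: compactly_supported_def)
  then obtain B where B: "B > 0" "\<And>x. x \<in> ?S \<Longrightarrow> \<bar>f x\<bar> \<le> B"
    using bounded_pos[of "f ` ?S"] compact_imp_bounded by auto
  have "\<bar>f x\<bar> \<le> B" for x
  proof (cases "x \<in> ?S")
    case False
    then have "x \<notin> support_on UNIV f" using closure_subset[of "support_on UNIV f"] by blast
    then show ?thesis using B(1) by (simp add: support_on_def)
  qed (use B in auto)
  with B(1) show ?thesis by blast
qed

lemma W_ad_set_perturb_le:
  fixes h :: "plane \<Rightarrow> real"
  assumes "prob_space \<mu>" and S: "sets \<mu> = sets borel" and h: "h \<in> borel_measurable borel" "\<And>x. \<bar>h x\<bar> \<le> B"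
    and "\<mu> \<in> U" "1 < p" "0 < r"
  shows "W_ad_set p (perturb \<mu> (\<lambda>x. r *\<^sub>R (0, h x))) U \<le> ennreal (B * r)"
proof -
  have B: "0 \<le> B" using h(2)[of "(0, 0)"] by linarith
  have m: "(\<lambda>x. x + r *\<^sub>R (0, h x)) \<in> borel_measurable \<mu>"
    unfolding measurable_cong_sets[OF S refl] using h(1)
    by (intro borel_measurable_add borel_measurable_scaleR borel_measurable_Pair) auto
  have i: "(\<lambda>x. x) \<in> borel_measurable \<mu>" unfolding measurable_cong_sets[OF S refl] by simp
  have "W_ad_set p (perturb \<mu> (\<lambda>x. r *\<^sub>R (0, h x))) U \<le> W_ad p (perturb \<mu> (\<lambda>x. r *\<^sub>R (0, h x))) \<mu>"
    unfolding W_ad_set_def using assms(5) by (rule INF_lower)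
  also have "\<dots> = W_ad p (distr \<mu> borel (\<lambda>x. x + r *\<^sub>R (0, h x))) (distr \<mu> borel (\<lambda>x. x))"
    unfolding perturb_def distr_id2[OF S[symmetric]] ..
  also have "\<dots> \<le> eroot p (\<integral>\<^sup>+ x. ennreal (norm (x + r *\<^sub>R (0, h x) - x) powr p) \<partial>\<mu>)"
    by (rule W_ad_distr_le[OF assms(1) m i]) simp
  also have "\<dots> \<le> ennreal (B * r)"
  proof (rule eroot_le_ennreal)
    have "(\<integral>\<^sup>+ x. ennreal (norm (x + r *\<^sub>R (0, h x) - x) powr p) \<partial>\<mu>) \<le> (\<integral>\<^sup>+ x. ennreal ((B * r) powr p) \<partial>\<mu>)"
    proof (intro nn_integral_mono ennreal_leI powr_mono2)
      show "norm (x + r *\<^sub>R (0, h x) - x) \<le> B * r" for x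
        using h(2)[of x] assms(7) by (simp add: norm_Pair abs_mult mult.commute)
    qed (use assms in auto)
    also have "\<dots> = ennreal ((B * r) powr p)"
      using prob_space.emeasure_space_1[OF assms(1)] by simp
    finally show "(\<integral>\<^sup>+ x. ennreal (norm (x + r *\<^sub>R (0, h x) - x) powr p) \<partial>\<mu>) \<le> ennreal ((B * r) powr p)" .
  qed (use assms B in auto)
  finally show ?thesis .
qed

lemma Lp_norm_eq_0:
  assumes "p > 0" "f \<in> borel_measurable M" "Lp_norm p M f = 0"
  shows "AE x in M. f x = 0"
proof -
  have "(\<integral>\<^sup>+ x. ennreal (\<bar>f x\<bar> powr p) \<partial>M) = 0"
    using assms(1,3) by (simp add: Lp_norm_def eroot_eq_0_iff)
  then have "AE x in M. ennreal (\<bar>f x\<bar> powr p) = 0"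
    using assms(2) by (subst (asm) nn_integral_0_iff_AE) auto
  then show ?thesis by eventually_elim (use assms(1) in \<open>auto simp: ennreal_eq_0_iff\<close>)
qed

lemma Limsup_divide_le:
  assumes "\<forall>\<^sub>F r in at_right 0. X r \<le> ennreal (e * r)" "0 \<le> e"
  shows "Limsup (at_right 0) (\<lambda>r::real. X r / ennreal r) \<le> ennreal e"
proof (rule Limsup_bounded)
  show "\<forall>\<^sub>F r in at_right 0. X r / ennreal r \<le> ennreal e"
    using assms(1) eventually_at_right_less[of 0]
  proof eventually_elim
    case (elim r)
    have "X r / ennreal r \<le> ennreal (e * r) / ennreal r" by (rule divide_right_mono_ennreal[OF elim(1)])
    also have "\<dots> = ennreal e" using elim(2) assms(2) by (simp add: divide_ennreal)
    finally show ?case .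
  qed
qed

theorem proposition3p10:
  fixes p :: real and \<mu> :: "plane measure"
    and \<Theta>\<^sub>2 :: "plane \<Rightarrow> real" and \<Theta> :: "plane \<Rightarrow> plane"
  assumes "p > 1"
    and "\<mu> \<in> P_p p"
    and "condition_C p \<mu>"
    and "compactly_supported \<Theta>\<^sub>2"
    and "C2_function \<Theta>\<^sub>2"
    and "\<Theta> = (\<lambda>x. (0, \<Theta>\<^sub>2 x))"
  shows "\<exists>C::real. C > 0 \<and>
    Limsup (at_right 0)
      (\<lambda>r::real. W_ad_set p (perturb \<mu> (\<lambda>x. r *\<^sub>R \<Theta> x)) (Pi_M (marg1 \<mu>) (marg2 \<mu>)) / ennreal r)
      \<le> ennreal C * product_norm p \<mu> (L_Mm \<mu> \<Theta>)"
proof -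
  let ?W = "\<lambda>r. W_ad_set p (perturb \<mu> (\<lambda>x. r *\<^sub>R \<Theta> x)) (Pi_M (marg1 \<mu>) (marg2 \<mu>))"
  let ?N = "product_norm p \<mu> (L_Mm \<mu> \<Theta>)"
  have mart: "martingale_measure \<mu>" using assms(3) by (simp add: condition_C_def)
  then have mu: "prob_space \<mu>" "sets \<mu> = sets borel" by (auto simp: martingale_measure_def)
  have cont: "continuous_on UNIV \<Theta>\<^sub>2"
    using assms(5) unfolding C2_function_def
    by (meson continuous_at_imp_continuous_on has_derivative_continuous)
  have hm: "\<Theta>\<^sub>2 \<in> borel_measurable borel" by (rule borel_measurable_continuous_onI[OF cont])
  obtain B where B: "B > 0" "\<And>x. \<bar>\<Theta>\<^sub>2 x\<bar> \<le> B"
    using compactly_supported_bounded[OF assms(4) cont] by auto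
  have crude: "Limsup (at_right 0) (\<lambda>r. ?W r / ennreal r) \<le> ennreal B"
  proof (rule Limsup_divide_le)
    have "\<mu> \<in> Pi_M (marg1 \<mu>) (marg2 \<mu>)" using mart by (simp add: Pi_M_def)
    from W_ad_set_perturb_le[OF mu hm B(2) this assms(1)]
    show "\<forall>\<^sub>F r in at_right 0. ?W r \<le> ennreal (B * r)"
      using eventually_at_right_less[of 0] by (auto simp: assms(6) elim!: eventually_mono)
  qed (use B in simp)
  show ?thesis
  proof (cases "?N = 0")
    case False
    \<comment> \<open>For a finite norm C is B divided by the norm; an infinite norm absorbs any
      bound.\<close>
    have "\<exists>C>0. ennreal B \<le> ennreal C * ?N"
    proof (cases "?N")
      case (real x)
      then have "x > 0" using False by (cases "x = 0") auto
      then have "ennreal B = ennreal (B / x) * ?N" using real B by (simp add: ennreal_mult[symmetric])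
      then show ?thesis using B \<open>x > 0\<close> by (intro exI[of _ "B / x"]) auto
    next
      case top
      then show ?thesis by (intro exI[of _ 1]) simp
    qed
    with crude show ?thesis by (meson order_trans)
  next
    case True
    have fs: "fst \<in> borel_measurable \<mu>" "snd \<in> borel_measurable \<mu>" "\<Theta>\<^sub>2 \<in> borel_measurable \<mu>"
      unfolding measurable_cong_sets[OF mu(2) refl] using hm
      by (auto intro!: borel_measurable_continuous_onI continuous_intros)
    interpret mu: prob_space \<mu> by (rule mu)
    have ih: "integrable \<mu> \<Theta>\<^sub>2"
      by (rule mu.integrable_const_bound[where B=B]) (use B fs in auto)
    \<comment> \<open>The third component of the operator is the conditional expectation of
      \<open>\<Theta>\<^sub>2\<close> given the first coordinate, because \<Theta> has first
      component zero.\<close>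
    have z: "Lp_norm p \<mu> (cexp \<mu> snd \<Theta>\<^sub>2) = 0" "Lp_norm p \<mu> (cexp \<mu> fst \<Theta>\<^sub>2) = 0"
      using True by (auto simp: product_norm_def L_Mm_def assms(6))
    have cm: "cexp \<mu> Y \<Theta>\<^sub>2 \<in> borel_measurable \<mu>" for Y unfolding cexp_def by simp
    have zz: "AE x in \<mu>. cexp \<mu> snd \<Theta>\<^sub>2 x = 0" "AE x in \<mu>. cexp \<mu> fst \<Theta>\<^sub>2 x = 0"
      using Lp_norm_eq_0[OF _ cm z(1)] Lp_norm_eq_0[OF _ cm z(2)] assms(1) by auto
    obtain \<kappa> q a b K q0 q1 where dis: "disintegrated (marg1 \<mu>) \<kappa> q a b K q0 q1"
      and dens: "\<mu> = density (marg1 \<mu> \<Otimes>\<^sub>M lborel) (\<lambda>z. ennreal (\<kappa> z))"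
      using condition_C_disintegrated[OF assms(3)] by blast
    interpret disintegrated "marg1 \<mu>" \<kappa> q a b K q0 q1 by (rule dis)
    have hm': "\<Theta>\<^sub>2 \<in> borel_measurable (borel \<Otimes>\<^sub>M borel)" using hm by (simp add: borel_prod)
    have "\<exists>\<theta>. null_direction (marg1 \<mu>) \<kappa> q a b K q0 q1 \<theta> B \<and> (AE z in M. \<theta> z = \<Theta>\<^sub>2 z)"
    proof (rule null_directionI[OF hm' B(2,1)])
      show "(\<integral>z. indicator A (fst z) * \<Theta>\<^sub>2 z \<partial>density M (\<lambda>z. ennreal (\<kappa> z))) = 0" if "A \<in> sets borel" for A
        unfolding dens[symmetric]
        using cexp_set_integral[OF mu(1) fs(1) ih, of "\<lambda>_. 0"] zz(2) that by simp
      show "(\<integral>z. indicator A (snd z) * \<Theta>\<^sub>2 z \<partial>density M (\<lambda>z. ennreal (\<kappa> z))) = 0" if "A \<in> sets borel" for A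
        unfolding dens[symmetric]
        using cexp_set_integral[OF mu(1) fs(2) ih, of "\<lambda>_. 0"] zz(1) that by simp
    qed
    then obtain \<theta> where nd: "null_direction (marg1 \<mu>) \<kappa> q a b K q0 q1 \<theta> B" and \<theta>: "AE z in M. \<theta> z = \<Theta>\<^sub>2 z"
      by blast
    interpret null_direction "marg1 \<mu>" \<kappa> q a b K q0 q1 \<theta> B by (rule nd)
    have base: "qlaw (shifted_cdf \<kappa> (\<lambda>_. 0)) = \<mu>"
    proof -
      have "qlaw (shifted_cdf \<kappa> (\<lambda>_. 0)) = distr \<mu> borel (\<lambda>z. (fst z, snd z + 0))"
        by (subst (2) dens) (rule law_shifted[symmetric, where c=0], auto)
      also have "\<dots> = distr \<mu> borel (\<lambda>z. z)" by simp
      finally show ?thesis using distr_id2[OF mu(2)[symmetric]] by simp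
    qed
    \<comment> \<open>\<theta> and \<open>\<Theta>\<^sub>2\<close> differ on a null set only, so the
      perturbed law is unaffected by the passage to the corrected version.\<close>
    have pert: "perturb \<mu> (\<lambda>x. r *\<^sub>R \<Theta> x) = qlaw (shifted_cdf \<kappa> (\<lambda>z. r * \<theta> z))" for r
    proof -
      have "AE z in \<mu>. \<theta> z = \<Theta>\<^sub>2 z"
        using \<theta> by (subst dens, subst AE_density) (auto elim: eventually_mono)
      then have "perturb \<mu> (\<lambda>x. r *\<^sub>R \<Theta> x) = distr \<mu> borel (\<lambda>z. (fst z, snd z + r * \<theta> z))"
        unfolding perturb_def
      proof (intro distr_cong_AE refl)
        assume "AE z in \<mu>. \<theta> z = \<Theta>\<^sub>2 z"
        then show "AE z in \<mu>. z + r *\<^sub>R \<Theta> z = (fst z, snd z + r * \<theta> z)"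
          by eventually_elim (simp add: assms(6) prod_eq_iff)
        show "(\<lambda>z. z + r *\<^sub>R \<Theta> z) \<in> borel_measurable \<mu>"
          unfolding measurable_cong_sets[OF mu(2) refl] assms(6) using hm
          by (intro borel_measurable_add borel_measurable_scaleR borel_measurable_Pair) auto
        have "(\<lambda>z. (fst z, snd z + r * \<theta> z)) \<in> measurable (borel \<Otimes>\<^sub>M borel) (borel \<Otimes>\<^sub>M borel)" by measurable
        then show "(\<lambda>z. (fst z, snd z + r * \<theta> z)) \<in> borel_measurable \<mu>"
          unfolding measurable_cong_sets[OF mu(2) refl] by (simp only: borel_prod)
      qed
      also have "\<dots> = qlaw (shifted_cdf \<kappa> (\<lambda>z. r * \<theta> z))"
        by (subst dens, rule law_shifted[where c="\<bar>r\<bar> * B"])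
           (auto simp: abs_mult intro!: mult_left_mono \<theta>_le)
      finally show ?thesis .
    qed
    have "Limsup (at_right 0) (\<lambda>r. ?W r / ennreal r) \<le> 0"
    proof (rule ennreal_le_epsilon)
      fix e :: real assume "e > 0"
      have "Limsup (at_right 0) (\<lambda>r. ?W r / ennreal r) \<le> ennreal e"
      proof (rule Limsup_divide_le)
        show "\<forall>\<^sub>F r in at_right 0. ?W r \<le> ennreal (e * r)"
          using W_ad_set_small[OF assms(1) _ \<open>e > 0\<close>] mart unfolding base pert by simp
      qed (use \<open>e > 0\<close> in simp)
      then show "Limsup (at_right 0) (\<lambda>r. ?W r / ennreal r) \<le> 0 + ennreal e" by simp
    qed
    then show ?thesis by (intro exI[of _ 1]) (use True in simp)
  qed
qed

end
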